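(* Let $\mathcal{A}$ be a semi-abelian category satisfying the Smith is Huq condition (SH), let $M,N$ be objects of $\mathcal{A}$, and let $\xi^M_N\colon M\flat N\to N$ and $\xi^N_M\colon N\flat M\to M$ be internal actions. Then $\xi^M_N$ and $\xi^N_M$ are compatible if and only if there exists an object $L$ endowed with internal crossed module structures $(\mu\colon M\to L,\ \xi^L_M)$ and $(\nu\colon N\to L,\ \xi^L_N)$ such that $$\xi^M_N=\xi^L_N\circ(\mu\flat 1_N)\qquad\text{and}\qquad \xi^N_M=\xi^L_M\circ(\nu\flat 1_M).$$
   Context: A semi-abelian category is a pointed, Barr exact, Bourn protomodular category with binary coproducts. (SH): two internal equivalence relations on the same object centralise each other in the Smith–Pedicchio sense as soon as their normalisations (the corresponding normal subobjects) commute in the sense of Huq. Notation: $+$ is the coproduct (with $A+B$ and $B+A$ identified), $i_A\colon A\to A+B$ and $i_B\colon B\to A+B$ are the inclusions, $[f,g]\colon A+B\to C$ is the morphism induced by $f\colon A\to C$, $g\colon B\to C$. The functor $\flat$: $k_{A,B}\colon A\flat B\to A+B$ is the kernel of $[1_A,0]\colon A+B\to A$; for $f\colon A\to A'$, $g\colon B\to B'$, $f\flat g$ is the restriction of $f+g$ to kernels. For fixed $A$, $A\flat(-)$ is a monad with unit $\eta^A_B\colon B\to A\flat B$ determined by $k_{A,B}\circ\eta^A_B=i_B$ and multiplication $\mu^A_B\colon A\flat(A\flat B)\to A\flat B$ determined by $k_{A,B}\circ\mu^A_B=[i_A,k_{A,B}]\circ k_{A,A\flat B}$. An internal action of $A$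 on $X$ is a morphism $\xi\colon A\flat X\to X$ making $X$ an algebra for this monad. The conjugation action is $\chi_A=[1_A,1_A]\circ k_{A,A}\colon A\flat A\to A$. Internal crossed module (under (SH)): a pair $(\partial\colon X\to A,\xi)$ with $\xi\colon A\flat X\to X$ an internal action such that $\xi\circ(\partial\flat 1_X)=\chi_X$ and $\partial\circ\xi=\chi_A\circ(1_A\flat\partial)$. Cosmash products: $h_{A,B}\colon A\diamond B\to A+B$ is the kernel of the canonical morphism $A+B\to A\times B$; it factors as $h_{A,B}=k_{A,B}\circ i_{A,B}$ with $i_{A,B}\colon A\diamond B\to A\flat B$. $h_{A,B,C}\colon A\diamond B\diamond C\to A+B+C$ is the kernel of the morphism $A+B+C\to(A+B)\times(A+C)\times(B+C)$ with components $[i_A,i_B,0]$, $[i_A,0,i_C]$, $[0,i_B,i_C]$. The morphism $j_{A,B,C}\colon A\diamond B\diamond C\to(A+B)\flat C$ is the unique one with $k_{A+B,C}\circ j_{A,B,C}=h_{A,B,C}$. The folding morphism $S^{N,M}_{1,2}\colon M\diamond N\diamond M\to N\diamond M$ is the unique one such that $h_{N,M}\circ S^{N,M}_{1,2}$ equals $h_{M,N,M}$ followed by the morphism $M+N+M\to M+N$ which folds the two copies of $M$ by the codiagonal and is the identity on $N$. Similarly $S^{M,N}_{1,2}\colon M\diamond N\diamond N\to M\diamond N$ is induced by folding the two copies of $N$. Compatibility: internal actions $\xi^M_N\colon M\flat N\to N$ and $\xi^N_M\colon N\flat M\to M$ are compatible if there exist internal actions $\xi^{M+N}_M\colon(M+N)\flat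 M\to M$ and $\xi^{M+N}_N\colon(M+N)\flat N\to N$ such that: (CA.0) $\xi^{M+N}_M\circ(i_N\flat 1_M)=\xi^N_M$, $\ \xi^{M+N}_M\circ(i_M\flat 1_M)=\chi_M$, $\ \xi^{M+N}_M\circ j_{M,N,M}=\xi^N_M\circ i_{N,M}\circ S^{N,M}_{1,2}$, and $\xi^{M+N}_N\circ(i_M\flat 1_N)=\xi^M_N$, $\ \xi^{M+N}_N\circ(i_N\flat 1_N)=\chi_N$, $\ \xi^{M+N}_N\circ j_{M,N,N}=\xi^M_N\circ i_{M,N}\circ S^{M,N}_{1,2}$; (CA.M) $\xi^{M+N}_M\circ\big((\xi^N_M+\xi^M_N)\flat 1_M\big)=\xi^{M+N}_M\circ\big([k_{N,M},k_{M,N}]\flat 1_M\big)$ as morphisms $((N\flat M)+(M\flat N))\flat M\to M$; (CA.N) $\xi^{M+N}_N\circ\big((\xi^N_M+\xi^M_N)\flat 1_N\big)=\xi^{M+N}_N\circ\big([k_{N,M},k_{M,N}]\flat 1_N\big)$ as morphisms $((N\flat M)+(M\flat N))\flat N\to N$. *)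

theory Defs
  imports Main
begin

section \<open>Categories\<close>

text \<open>
  Only the values of \<open>Dom\<close>, \<open>Cod\<close>, \<open>ident\<close> and \<open>Comp\<close> on objects, arrows and composable
  pairs are meaningful.  Composition is written in the usual order: \<open>g \<cdot> f\<close> is \<open>f\<close> followed
  by \<open>g\<close>.
\<close>

record ('o, 'm) cat =
  Ob :: "'o set"
  Arr :: "'m set"
  Dom :: "'m \<Rightarrow> 'o"
  Cod :: "'m \<Rightarrow> 'o"
  ident :: "'o \<Rightarrow> 'm" ("\<one>\<index>")
  Comp :: "'m \<Rightarrow> 'm \<Rightarrow> 'm" (infixr "\<cdot>\<index>" 70)

definition hom :: "('o, 'm) cat \<Rightarrow> 'o \<Rightarrow> 'o \<Rightarrow> 'm set" where
  "hom C A B = {f \<in> Arr C. Dom C f = A \<and> Cod C f = B}"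

locale category =
  fixes C :: "('o, 'm) cat" (structure)
  assumes dom_Ob: "f \<in> Arr C \<Longrightarrow> Dom C f \<in> Ob C"
    and cod_Ob: "f \<in> Arr C \<Longrightarrow> Cod C f \<in> Ob C"
    and ident_hom: "A \<in> Ob C \<Longrightarrow> \<one> A \<in> hom C A A"
    and comp_hom: "f \<in> hom C A B \<Longrightarrow> g \<in> hom C B D \<Longrightarrow> g \<cdot> f \<in> hom C A D"
    and ident_left: "f \<in> hom C A B \<Longrightarrow> \<one> B \<cdot> f = f"
    and ident_right: "f \<in> hom C A B \<Longrightarrow> f \<cdot> \<one> A = f"
    and comp_assoc: "f \<in> hom C A B \<Longrightarrow> g \<in> hom C B D \<Longrightarrow> h \<in> hom C D E \<Longrightarrow>
      (h \<cdot> g) \<cdot> f = h \<cdot> (g \<cdot> f)"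

definition is_iso :: "('o, 'm) cat \<Rightarrow> 'o \<Rightarrow> 'o \<Rightarrow> 'm \<Rightarrow> bool" where
  "is_iso C A B f \<longleftrightarrow> f \<in> hom C A B \<and>
    (\<exists>g \<in> hom C B A. g \<cdot>\<^bsub>C\<^esub> f = \<one>\<^bsub>C\<^esub> A \<and> f \<cdot>\<^bsub>C\<^esub> g = \<one>\<^bsub>C\<^esub> B)"


section \<open>Limits and colimits\<close>

definition is_terminal :: "('o, 'm) cat \<Rightarrow> 'o \<Rightarrow> bool" where
  "is_terminal C T \<longleftrightarrow> T \<in> Ob C \<and> (\<forall>A \<in> Ob C. \<exists>!f. f \<in> hom C A T)"

definition is_initial :: "('o, 'm) cat \<Rightarrow> 'o \<Rightarrow> bool" where
  "is_initial C I \<longleftrightarrow> I \<in> Ob C \<and> (\<forall>A \<in> Ob C. \<exists>!f. f \<in> hom C I A)"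

definition is_zero_object :: "('o, 'm) cat \<Rightarrow> 'o \<Rightarrow> bool" where
  "is_zero_object C Z \<longleftrightarrow> is_initial C Z \<and> is_terminal C Z"

definition is_product :: "('o, 'm) cat \<Rightarrow> 'o \<Rightarrow> 'o \<Rightarrow> 'o \<Rightarrow> 'm \<Rightarrow> 'm \<Rightarrow> bool" where
  "is_product C A B P p q \<longleftrightarrow> p \<in> hom C P A \<and> q \<in> hom C P B \<and>
    (\<forall>D. \<forall>f \<in> hom C D A. \<forall>g \<in> hom C D B.
      \<exists>!h. h \<in> hom C D P \<and> p \<cdot>\<^bsub>C\<^esub> h = f \<and> q \<cdot>\<^bsub>C\<^esub> h = g)"

definition is_coproduct :: "('o, 'm) cat \<Rightarrow> 'o \<Rightarrow> 'o \<Rightarrow> 'o \<Rightarrow> 'm \<Rightarrow> 'm \<Rightarrow> bool" where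
  "is_coproduct C A B P i j \<longleftrightarrow> i \<in> hom C A P \<and> j \<in> hom C B P \<and>
    (\<forall>D. \<forall>f \<in> hom C A D. \<forall>g \<in> hom C B D.
      \<exists>!h. h \<in> hom C P D \<and> h \<cdot>\<^bsub>C\<^esub> i = f \<and> h \<cdot>\<^bsub>C\<^esub> j = g)"

text \<open>\<open>is_pullback C f g P p q\<close>: the square \<open>f \<cdot> p = g \<cdot> q\<close> is a pullback of the cospan \<open>(f, g)\<close>.\<close>

definition is_pullback :: "('o, 'm) cat \<Rightarrow> 'm \<Rightarrow> 'm \<Rightarrow> 'o \<Rightarrow> 'm \<Rightarrow> 'm \<Rightarrow> bool" where
  "is_pullback C f g P p q \<longleftrightarrow>
    f \<in> Arr C \<and> g \<in> Arr C \<and> Cod C f = Cod C g \<and>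
    p \<in> hom C P (Dom C f) \<and> q \<in> hom C P (Dom C g) \<and> f \<cdot>\<^bsub>C\<^esub> p = g \<cdot>\<^bsub>C\<^esub> q \<and>
    (\<forall>D. \<forall>u \<in> hom C D (Dom C f). \<forall>v \<in> hom C D (Dom C g). f \<cdot>\<^bsub>C\<^esub> u = g \<cdot>\<^bsub>C\<^esub> v \<longrightarrow>
      (\<exists>!h. h \<in> hom C D P \<and> p \<cdot>\<^bsub>C\<^esub> h = u \<and> q \<cdot>\<^bsub>C\<^esub> h = v))"

definition is_coequalizer :: "('o, 'm) cat \<Rightarrow> 'm \<Rightarrow> 'm \<Rightarrow> 'o \<Rightarrow> 'm \<Rightarrow> bool" where
  "is_coequalizer C f g Q q \<longleftrightarrow>
    f \<in> Arr C \<and> g \<in> Arr C \<and> Dom C f = Dom C g \<and> Cod C f = Cod C g \<and>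
    q \<in> hom C (Cod C f) Q \<and> q \<cdot>\<^bsub>C\<^esub> f = q \<cdot>\<^bsub>C\<^esub> g \<and>
    (\<forall>D. \<forall>h \<in> hom C (Cod C f) D. h \<cdot>\<^bsub>C\<^esub> f = h \<cdot>\<^bsub>C\<^esub> g \<longrightarrow>
      (\<exists>!u. u \<in> hom C Q D \<and> u \<cdot>\<^bsub>C\<^esub> q = h))"

definition regular_epi :: "('o, 'm) cat \<Rightarrow> 'm \<Rightarrow> bool" where
  "regular_epi C q \<longleftrightarrow> (\<exists>f g. is_coequalizer C f g (Cod C q) q)"


section \<open>Internal equivalence relations\<close>

definition jointly_monic :: "('o, 'm) cat \<Rightarrow> 'o \<Rightarrow> 'm \<Rightarrow> 'm \<Rightarrow> bool" where
  "jointly_monic C R r1 r2 \<longleftrightarrow> (\<forall>D. \<forall>u \<in> hom C D R. \<forall>v \<in> hom C D R.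
    r1 \<cdot>\<^bsub>C\<^esub> u = r1 \<cdot>\<^bsub>C\<^esub> v \<and> r2 \<cdot>\<^bsub>C\<^esub> u = r2 \<cdot>\<^bsub>C\<^esub> v \<longrightarrow> u = v)"

definition equivalence_relation :: "('o, 'm) cat \<Rightarrow> 'o \<Rightarrow> 'o \<Rightarrow> 'm \<Rightarrow> 'm \<Rightarrow> bool" where
  "equivalence_relation C X R r1 r2 \<longleftrightarrow>
    r1 \<in> hom C R X \<and> r2 \<in> hom C R X \<and> jointly_monic C R r1 r2 \<and>
    (\<exists>e \<in> hom C X R. r1 \<cdot>\<^bsub>C\<^esub> e = \<one>\<^bsub>C\<^esub> X \<and> r2 \<cdot>\<^bsub>C\<^esub> e = \<one>\<^bsub>C\<^esub> X) \<and>
    (\<exists>s \<in> hom C R R. r1 \<cdot>\<^bsub>C\<^esub> s = r2 \<and> r2 \<cdot>\<^bsub>C\<^esub> s = r1) \<and>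
    (\<forall>P p q. is_pullback C r2 r1 P p q \<longrightarrow>
      (\<exists>t \<in> hom C P R. r1 \<cdot>\<^bsub>C\<^esub> t = r1 \<cdot>\<^bsub>C\<^esub> p \<and> r2 \<cdot>\<^bsub>C\<^esub> t = r2 \<cdot>\<^bsub>C\<^esub> q))"

text \<open>A relation is effective if it is the kernel pair of some arrow.\<close>

definition effective :: "('o, 'm) cat \<Rightarrow> 'o \<Rightarrow> 'o \<Rightarrow> 'm \<Rightarrow> 'm \<Rightarrow> bool" where
  "effective C X R r1 r2 \<longleftrightarrow> (\<exists>f \<in> Arr C. Dom C f = X \<and> is_pullback C f f R r1 r2)"


section \<open>Semi-abelian categories\<close>

text \<open>Finite completeness is expressed by a terminal object and pullbacks.\<close>

locale finitely_complete_category = category +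
  assumes terminal_ex: "\<exists>T. is_terminal C T"
    and pullback_ex: "f \<in> hom C A D \<Longrightarrow> g \<in> hom C B D \<Longrightarrow> \<exists>P p q. is_pullback C f g P p q"

locale regular_category = finitely_complete_category +
  assumes kernel_pair_coequalizer: "is_pullback C f f R r1 r2 \<Longrightarrow> \<exists>Q q. is_coequalizer C r1 r2 Q q"
    and regular_epi_stable: "is_pullback C f g P p q \<Longrightarrow> regular_epi C f \<Longrightarrow> regular_epi C q"

locale barr_exact_category = regular_category +
  assumes equivalence_effective: "equivalence_relation C X R r1 r2 \<Longrightarrow> effective C X R r1 r2"

text \<open>\<open>is_point C B E p s\<close>: \<open>p\<close> is a split epimorphism onto \<open>B\<close> with chosen section \<open>s\<close>.\<close>

definition is_point :: "('o, 'm) cat \<Rightarrow> 'o \<Rightarrow> 'o \<Rightarrow> 'm \<Rightarrow> 'm \<Rightarrow> bool" where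
  "is_point C B E p s \<longleftrightarrow> p \<in> hom C E B \<and> s \<in> hom C B E \<and> p \<cdot>\<^bsub>C\<^esub> s = \<one>\<^bsub>C\<^esub> B"

text \<open>
  Bourn protomodularity: for every \<open>f : A \<rightarrow> B\<close>, the change-of-base functor from points over
  \<open>B\<close> to points over \<open>A\<close> reflects isomorphisms.  Here \<open>k\<close> is the image of the morphism of points
  \<open>h\<close> under pulling back along \<open>f\<close>.
\<close>

definition protomodular :: "('o, 'm) cat \<Rightarrow> bool" where
  "protomodular C \<longleftrightarrow>
    (\<forall>A B f E p s E' p' s' h P a b P' a' b' k.
      f \<in> hom C A B \<and> is_point C B E p s \<and> is_point C B E' p' s' \<and>
      h \<in> hom C E E' \<and> p' \<cdot>\<^bsub>C\<^esub> h = p \<and> h \<cdot>\<^bsub>C\<^esub> s = s' \<and>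
      is_pullback C p f P a b \<and> is_pullback C p' f P' a' b' \<and>
      k \<in> hom C P P' \<and> a' \<cdot>\<^bsub>C\<^esub> k = h \<cdot>\<^bsub>C\<^esub> a \<and> b' \<cdot>\<^bsub>C\<^esub> k = b \<and>
      is_iso C P P' k \<longrightarrow> is_iso C E E' h)"

locale semi_abelian_category = barr_exact_category +
  assumes pointed: "\<exists>Z. is_zero_object C Z"
    and protomodular: "protomodular C"
    and coproduct_ex: "A \<in> Ob C \<Longrightarrow> B \<in> Ob C \<Longrightarrow> \<exists>P i j. is_coproduct C A B P i j"


section \<open>Chosen products, coproducts and kernels\<close>

text \<open>
  Products, coproducts and kernels are determined up to unique isomorphism; as usual, one choice
  of each is fixed once and for all.
\<close>

definition zero :: "('o, 'm) cat \<Rightarrow> 'o \<Rightarrow> 'o \<Rightarrow> 'm" where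
  "zero C A B = (THE f. \<exists>Z g h. is_zero_object C Z \<and> g \<in> hom C A Z \<and> h \<in> hom C Z B \<and>
    f = h \<cdot>\<^bsub>C\<^esub> g)"

definition product :: "('o, 'm) cat \<Rightarrow> 'o \<Rightarrow> 'o \<Rightarrow> 'o \<times> 'm \<times> 'm" where
  "product C A B = (SOME (P, p, q). is_product C A B P p q)"

definition prod_ob :: "('o, 'm) cat \<Rightarrow> 'o \<Rightarrow> 'o \<Rightarrow> 'o" where
  "prod_ob C A B = fst (product C A B)"

definition proj1 :: "('o, 'm) cat \<Rightarrow> 'o \<Rightarrow> 'o \<Rightarrow> 'm" where
  "proj1 C A B = fst (snd (product C A B))"

definition proj2 :: "('o, 'm) cat \<Rightarrow> 'o \<Rightarrow> 'o \<Rightarrow> 'm" where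
  "proj2 C A B = snd (snd (product C A B))"

definition pair :: "('o, 'm) cat \<Rightarrow> 'm \<Rightarrow> 'm \<Rightarrow> 'm" where
  "pair C f g = (THE h. h \<in> hom C (Dom C f) (prod_ob C (Cod C f) (Cod C g)) \<and>
    proj1 C (Cod C f) (Cod C g) \<cdot>\<^bsub>C\<^esub> h = f \<and> proj2 C (Cod C f) (Cod C g) \<cdot>\<^bsub>C\<^esub> h = g)"

definition coproduct :: "('o, 'm) cat \<Rightarrow> 'o \<Rightarrow> 'o \<Rightarrow> 'o \<times> 'm \<times> 'm" where
  "coproduct C A B = (SOME (P, i, j). is_coproduct C A B P i j)"

definition coprod_ob :: "('o, 'm) cat \<Rightarrow> 'o \<Rightarrow> 'o \<Rightarrow> 'o" (infixl "\<oplus>\<index>" 65) where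
  "A \<oplus>\<^bsub>C\<^esub> B = fst (coproduct C A B)"

definition in1 :: "('o, 'm) cat \<Rightarrow> 'o \<Rightarrow> 'o \<Rightarrow> 'm" where
  "in1 C A B = fst (snd (coproduct C A B))"

definition in2 :: "('o, 'm) cat \<Rightarrow> 'o \<Rightarrow> 'o \<Rightarrow> 'm" where
  "in2 C A B = snd (snd (coproduct C A B))"

definition copair :: "('o, 'm) cat \<Rightarrow> 'm \<Rightarrow> 'm \<Rightarrow> 'm" where
  "copair C f g = (THE h. h \<in> hom C (Dom C f \<oplus>\<^bsub>C\<^esub> Dom C g) (Cod C f) \<and>
    h \<cdot>\<^bsub>C\<^esub> in1 C (Dom C f) (Dom C g) = f \<and> h \<cdot>\<^bsub>C\<^esub> in2 C (Dom C f) (Dom C g) = g)"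

definition coprod_map :: "('o, 'm) cat \<Rightarrow> 'm \<Rightarrow> 'm \<Rightarrow> 'm" where
  "coprod_map C f g =
    copair C (in1 C (Cod C f) (Cod C g) \<cdot>\<^bsub>C\<^esub> f) (in2 C (Cod C f) (Cod C g) \<cdot>\<^bsub>C\<^esub> g)"

text \<open>The canonical isomorphism \<open>A + B \<rightarrow> B + A\<close>, by which the two are identified.\<close>

definition coprod_swap :: "('o, 'm) cat \<Rightarrow> 'o \<Rightarrow> 'o \<Rightarrow> 'm" where
  "coprod_swap C A B = copair C (in2 C B A) (in1 C B A)"

definition is_kernel :: "('o, 'm) cat \<Rightarrow> 'm \<Rightarrow> 'o \<Rightarrow> 'm \<Rightarrow> bool" where
  "is_kernel C f K k \<longleftrightarrow> f \<in> Arr C \<and> k \<in> hom C K (Dom C f) \<and>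
    f \<cdot>\<^bsub>C\<^esub> k = zero C K (Cod C f) \<and>
    (\<forall>D. \<forall>u \<in> hom C D (Dom C f). f \<cdot>\<^bsub>C\<^esub> u = zero C D (Cod C f) \<longrightarrow>
      (\<exists>!v. v \<in> hom C D K \<and> k \<cdot>\<^bsub>C\<^esub> v = u))"

definition kernel :: "('o, 'm) cat \<Rightarrow> 'm \<Rightarrow> 'o \<times> 'm" where
  "kernel C f = (SOME (K, k). is_kernel C f K k)"

definition ker_ob :: "('o, 'm) cat \<Rightarrow> 'm \<Rightarrow> 'o" where
  "ker_ob C f = fst (kernel C f)"

definition ker :: "('o, 'm) cat \<Rightarrow> 'm \<Rightarrow> 'm" where
  "ker C f = snd (kernel C f)"


section \<open>The Smith is Huq condition\<close>

definition huq_commute :: "('o, 'm) cat \<Rightarrow> 'm \<Rightarrow> 'm \<Rightarrow> bool" where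
  "huq_commute C m n \<longleftrightarrow> m \<in> Arr C \<and> n \<in> Arr C \<and> Cod C m = Cod C n \<and>
    (\<exists>\<phi> \<in> hom C (prod_ob C (Dom C m) (Dom C n)) (Cod C m).
      \<phi> \<cdot>\<^bsub>C\<^esub> pair C (\<one>\<^bsub>C\<^esub> (Dom C m)) (zero C (Dom C m) (Dom C n)) = m \<and>
      \<phi> \<cdot>\<^bsub>C\<^esub> pair C (zero C (Dom C n) (Dom C m)) (\<one>\<^bsub>C\<^esub> (Dom C n)) = n)"

text \<open>
  The equivalence relations \<open>R\<close> and \<open>S\<close> on \<open>X\<close> centralise each other if there is a connector
  \<open>\<theta> : R \<times>\<^sub>X S \<rightarrow> X\<close>, written \<open>\<theta>(x, y, z)\<close> for \<open>x R y S z\<close>, with \<open>\<theta>(x, y, y) = x\<close> and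
  \<open>\<theta>(y, y, z) = z\<close>.  Here \<open>P = R \<times>\<^sub>X S\<close>, and \<open>l : R \<rightarrow> P\<close>, \<open>r : S \<rightarrow> P\<close> are the inclusions
  \<open>(x, y) \<mapsto> (x, y, y)\<close> and \<open>(y, z) \<mapsto> (y, y, z)\<close>.  In a Mal'tsev category (in particular in a
  semi-abelian one) these two identities already imply the remaining axioms of a connector.
\<close>

definition smith_centralise ::
    "('o, 'm) cat \<Rightarrow> 'o \<Rightarrow> 'o \<Rightarrow> 'm \<Rightarrow> 'm \<Rightarrow> 'o \<Rightarrow> 'm \<Rightarrow> 'm \<Rightarrow> bool" where
  "smith_centralise C X R r1 r2 S s1 s2 \<longleftrightarrow>
    (\<exists>P p q eR eS l r \<theta>.
      is_pullback C r2 s1 P p q \<and>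
      eR \<in> hom C X R \<and> r1 \<cdot>\<^bsub>C\<^esub> eR = \<one>\<^bsub>C\<^esub> X \<and> r2 \<cdot>\<^bsub>C\<^esub> eR = \<one>\<^bsub>C\<^esub> X \<and>
      eS \<in> hom C X S \<and> s1 \<cdot>\<^bsub>C\<^esub> eS = \<one>\<^bsub>C\<^esub> X \<and> s2 \<cdot>\<^bsub>C\<^esub> eS = \<one>\<^bsub>C\<^esub> X \<and>
      l \<in> hom C R P \<and> p \<cdot>\<^bsub>C\<^esub> l = \<one>\<^bsub>C\<^esub> R \<and> q \<cdot>\<^bsub>C\<^esub> l = eS \<cdot>\<^bsub>C\<^esub> r2 \<and>
      r \<in> hom C S P \<and> p \<cdot>\<^bsub>C\<^esub> r = eR \<cdot>\<^bsub>C\<^esub> s1 \<and> q \<cdot>\<^bsub>C\<^esub> r = \<one>\<^bsub>C\<^esub> S \<and>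
      \<theta> \<in> hom C P X \<and> \<theta> \<cdot>\<^bsub>C\<^esub> l = r1 \<and> \<theta> \<cdot>\<^bsub>C\<^esub> r = s2)"

text \<open>The normalisation of an equivalence relation \<open>(R, r1, r2)\<close> on \<open>X\<close>, as a subobject of \<open>X\<close>.\<close>

definition normalisation :: "('o, 'm) cat \<Rightarrow> 'm \<Rightarrow> 'm \<Rightarrow> 'm" where
  "normalisation C r1 r2 = r2 \<cdot>\<^bsub>C\<^esub> ker C r1"

definition smith_is_huq :: "('o, 'm) cat \<Rightarrow> bool" where
  "smith_is_huq C \<longleftrightarrow>
    (\<forall>X R r1 r2 S s1 s2.
      equivalence_relation C X R r1 r2 \<and> equivalence_relation C X S s1 s2 \<and>
      huq_commute C (normalisation C r1 r2) (normalisation C s1 s2) \<longrightarrow>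
      smith_centralise C X R r1 r2 S s1 s2)"


section \<open>Internal actions and internal crossed modules\<close>

definition flat_retraction :: "('o, 'm) cat \<Rightarrow> 'o \<Rightarrow> 'o \<Rightarrow> 'm" where
  "flat_retraction C A B = copair C (\<one>\<^bsub>C\<^esub> A) (zero C B A)"

definition flat :: "('o, 'm) cat \<Rightarrow> 'o \<Rightarrow> 'o \<Rightarrow> 'o" (infixr "\<flat>\<index>" 68) where
  "A \<flat>\<^bsub>C\<^esub> B = ker_ob C (flat_retraction C A B)"

definition flat_ker :: "('o, 'm) cat \<Rightarrow> 'o \<Rightarrow> 'o \<Rightarrow> 'm" where
  "flat_ker C A B = ker C (flat_retraction C A B)"

definition flat_map :: "('o, 'm) cat \<Rightarrow> 'm \<Rightarrow> 'm \<Rightarrow> 'm" where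
  "flat_map C f g =
    (THE h. h \<in> hom C (Dom C f \<flat>\<^bsub>C\<^esub> Dom C g) (Cod C f \<flat>\<^bsub>C\<^esub> Cod C g) \<and>
      flat_ker C (Cod C f) (Cod C g) \<cdot>\<^bsub>C\<^esub> h =
      coprod_map C f g \<cdot>\<^bsub>C\<^esub> flat_ker C (Dom C f) (Dom C g))"

definition flat_unit :: "('o, 'm) cat \<Rightarrow> 'o \<Rightarrow> 'o \<Rightarrow> 'm" where
  "flat_unit C A B =
    (THE h. h \<in> hom C B (A \<flat>\<^bsub>C\<^esub> B) \<and> flat_ker C A B \<cdot>\<^bsub>C\<^esub> h = in2 C A B)"

definition flat_mult :: "('o, 'm) cat \<Rightarrow> 'o \<Rightarrow> 'o \<Rightarrow> 'm" where
  "flat_mult C A B =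
    (THE h. h \<in> hom C (A \<flat>\<^bsub>C\<^esub> (A \<flat>\<^bsub>C\<^esub> B)) (A \<flat>\<^bsub>C\<^esub> B) \<and>
      flat_ker C A B \<cdot>\<^bsub>C\<^esub> h =
      copair C (in1 C A B) (flat_ker C A B) \<cdot>\<^bsub>C\<^esub> flat_ker C A (A \<flat>\<^bsub>C\<^esub> B))"

definition internal_action :: "('o, 'm) cat \<Rightarrow> 'o \<Rightarrow> 'o \<Rightarrow> 'm \<Rightarrow> bool" where
  "internal_action C A X \<xi> \<longleftrightarrow> A \<in> Ob C \<and> X \<in> Ob C \<and> \<xi> \<in> hom C (A \<flat>\<^bsub>C\<^esub> X) X \<and>
    \<xi> \<cdot>\<^bsub>C\<^esub> flat_unit C A X = \<one>\<^bsub>C\<^esub> X \<and>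
    \<xi> \<cdot>\<^bsub>C\<^esub> flat_mult C A X = \<xi> \<cdot>\<^bsub>C\<^esub> flat_map C (\<one>\<^bsub>C\<^esub> A) \<xi>"

definition conjugation :: "('o, 'm) cat \<Rightarrow> 'o \<Rightarrow> 'm" where
  "conjugation C A = copair C (\<one>\<^bsub>C\<^esub> A) (\<one>\<^bsub>C\<^esub> A) \<cdot>\<^bsub>C\<^esub> flat_ker C A A"

definition crossed_module :: "('o, 'm) cat \<Rightarrow> 'o \<Rightarrow> 'o \<Rightarrow> 'm \<Rightarrow> 'm \<Rightarrow> bool" where
  "crossed_module C X A \<delta> \<xi> \<longleftrightarrow> \<delta> \<in> hom C X A \<and> internal_action C A X \<xi> \<and>
    \<xi> \<cdot>\<^bsub>C\<^esub> flat_map C \<delta> (\<one>\<^bsub>C\<^esub> X) = conjugation C X \<and>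
    \<delta> \<cdot>\<^bsub>C\<^esub> \<xi> = conjugation C A \<cdot>\<^bsub>C\<^esub> flat_map C (\<one>\<^bsub>C\<^esub> A) \<delta>"


section \<open>Cosmash products\<close>

definition cosmash_comparison :: "('o, 'm) cat \<Rightarrow> 'o \<Rightarrow> 'o \<Rightarrow> 'm" where
  "cosmash_comparison C A B =
    pair C (copair C (\<one>\<^bsub>C\<^esub> A) (zero C B A)) (copair C (zero C A B) (\<one>\<^bsub>C\<^esub> B))"

definition cosmash :: "('o, 'm) cat \<Rightarrow> 'o \<Rightarrow> 'o \<Rightarrow> 'o" (infixr "\<diamond>\<index>" 68) where
  "A \<diamond>\<^bsub>C\<^esub> B = ker_ob C (cosmash_comparison C A B)"

definition cosmash_ker :: "('o, 'm) cat \<Rightarrow> 'o \<Rightarrow> 'o \<Rightarrow> 'm" where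
  "cosmash_ker C A B = ker C (cosmash_comparison C A B)"

definition cosmash_to_flat :: "('o, 'm) cat \<Rightarrow> 'o \<Rightarrow> 'o \<Rightarrow> 'm" where
  "cosmash_to_flat C A B =
    (THE i. i \<in> hom C (A \<diamond>\<^bsub>C\<^esub> B) (A \<flat>\<^bsub>C\<^esub> B) \<and> flat_ker C A B \<cdot>\<^bsub>C\<^esub> i = cosmash_ker C A B)"

text \<open>
  The ternary coproduct is \<open>(A + B) + D\<close>, the ternary product is bracketed to the left as well.
\<close>

definition cosmash3_comparison :: "('o, 'm) cat \<Rightarrow> 'o \<Rightarrow> 'o \<Rightarrow> 'o \<Rightarrow> 'm" where
  "cosmash3_comparison C A B D =
    pair C
      (pair C
        (copair C (copair C (in1 C A B) (in2 C A B)) (zero C D (A \<oplus>\<^bsub>C\<^esub> B)))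
        (copair C (copair C (in1 C A D) (zero C B (A \<oplus>\<^bsub>C\<^esub> D))) (in2 C A D)))
      (copair C (copair C (zero C A (B \<oplus>\<^bsub>C\<^esub> D)) (in1 C B D)) (in2 C B D))"

definition cosmash3 :: "('o, 'm) cat \<Rightarrow> 'o \<Rightarrow> 'o \<Rightarrow> 'o \<Rightarrow> 'o" where
  "cosmash3 C A B D = ker_ob C (cosmash3_comparison C A B D)"

definition cosmash3_ker :: "('o, 'm) cat \<Rightarrow> 'o \<Rightarrow> 'o \<Rightarrow> 'o \<Rightarrow> 'm" where
  "cosmash3_ker C A B D = ker C (cosmash3_comparison C A B D)"

definition cosmash3_to_flat :: "('o, 'm) cat \<Rightarrow> 'o \<Rightarrow> 'o \<Rightarrow> 'o \<Rightarrow> 'm" where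
  "cosmash3_to_flat C A B D =
    (THE j. j \<in> hom C (cosmash3 C A B D) ((A \<oplus>\<^bsub>C\<^esub> B) \<flat>\<^bsub>C\<^esub> D) \<and>
      flat_ker C (A \<oplus>\<^bsub>C\<^esub> B) D \<cdot>\<^bsub>C\<^esub> j = cosmash3_ker C A B D)"

text \<open>
  The two foldings used below.  \<open>fold_outer C N M : M \<diamond> N \<diamond> M \<rightarrow> N \<diamond> M\<close> folds the outer
  copies of \<open>M\<close> (with \<open>M + N\<close> identified with \<open>N + M\<close>, so that it lands in \<open>N \<diamond> M\<close>), and
  \<open>fold_right C M N : M \<diamond> N \<diamond> N \<rightarrow> M \<diamond> N\<close> folds the two copies of \<open>N\<close>.
\<close>

definition fold_outer :: "('o, 'm) cat \<Rightarrow> 'o \<Rightarrow> 'o \<Rightarrow> 'm" where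
  "fold_outer C N M =
    (THE s. s \<in> hom C (cosmash3 C M N M) (N \<diamond>\<^bsub>C\<^esub> M) \<and>
      cosmash_ker C N M \<cdot>\<^bsub>C\<^esub> s =
      copair C (copair C (in2 C N M) (in1 C N M)) (in2 C N M) \<cdot>\<^bsub>C\<^esub> cosmash3_ker C M N M)"

definition fold_right :: "('o, 'm) cat \<Rightarrow> 'o \<Rightarrow> 'o \<Rightarrow> 'm" where
  "fold_right C M N =
    (THE s. s \<in> hom C (cosmash3 C M N N) (M \<diamond>\<^bsub>C\<^esub> N) \<and>
      cosmash_ker C M N \<cdot>\<^bsub>C\<^esub> s =
      copair C (copair C (in1 C M N) (in2 C M N)) (in2 C M N) \<cdot>\<^bsub>C\<^esub> cosmash3_ker C M N N)"


section \<open>Compatible actions\<close>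

text \<open>
  \<open>\<xi>MN\<close> is the action of \<open>M\<close> on \<open>N\<close> and \<open>\<xi>NM\<close> the action of \<open>N\<close> on \<open>M\<close>; \<open>\<zeta>M\<close> and \<open>\<zeta>N\<close> are
  actions of \<open>M + N\<close> on \<open>M\<close> and on \<open>N\<close>.
\<close>

definition CA0_M :: "('o, 'm) cat \<Rightarrow> 'o \<Rightarrow> 'o \<Rightarrow> 'm \<Rightarrow> 'm \<Rightarrow> bool" where
  "CA0_M C M N \<xi>NM \<zeta>M \<longleftrightarrow>
    \<zeta>M \<cdot>\<^bsub>C\<^esub> flat_map C (in2 C M N) (\<one>\<^bsub>C\<^esub> M) = \<xi>NM \<and>
    \<zeta>M \<cdot>\<^bsub>C\<^esub> flat_map C (in1 C M N) (\<one>\<^bsub>C\<^esub> M) = conjugation C M \<and>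
    \<zeta>M \<cdot>\<^bsub>C\<^esub> cosmash3_to_flat C M N M = \<xi>NM \<cdot>\<^bsub>C\<^esub> cosmash_to_flat C N M \<cdot>\<^bsub>C\<^esub> fold_outer C N M"

definition CA0_N :: "('o, 'm) cat \<Rightarrow> 'o \<Rightarrow> 'o \<Rightarrow> 'm \<Rightarrow> 'm \<Rightarrow> bool" where
  "CA0_N C M N \<xi>MN \<zeta>N \<longleftrightarrow>
    \<zeta>N \<cdot>\<^bsub>C\<^esub> flat_map C (in1 C M N) (\<one>\<^bsub>C\<^esub> N) = \<xi>MN \<and>
    \<zeta>N \<cdot>\<^bsub>C\<^esub> flat_map C (in2 C M N) (\<one>\<^bsub>C\<^esub> N) = conjugation C N \<and>
    \<zeta>N \<cdot>\<^bsub>C\<^esub> cosmash3_to_flat C M N N = \<xi>MN \<cdot>\<^bsub>C\<^esub> cosmash_to_flat C M N \<cdot>\<^bsub>C\<^esub> fold_right C M N"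

text \<open>
  Used for \<open>X = M\<close> and \<open>X = N\<close>: the compatibility equation between morphisms
  \<open>((N \<flat> M) + (M \<flat> N)) \<flat> X \<rightarrow> X\<close>.  The morphism \<open>k\<^sub>N\<^sub>,\<^sub>M\<close> is composed with
  the isomorphism \<open>N + M \<rightarrow> M + N\<close>, as \<open>N + M\<close> and \<open>M + N\<close> are not literally equal here.
\<close>

definition CA_on :: "('o, 'm) cat \<Rightarrow> 'o \<Rightarrow> 'o \<Rightarrow> 'm \<Rightarrow> 'm \<Rightarrow> 'o \<Rightarrow> 'm \<Rightarrow> bool" where
  "CA_on C M N \<xi>MN \<xi>NM X \<zeta> \<longleftrightarrow>
    \<zeta> \<cdot>\<^bsub>C\<^esub> flat_map C (coprod_map C \<xi>NM \<xi>MN) (\<one>\<^bsub>C\<^esub> X) =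
    \<zeta> \<cdot>\<^bsub>C\<^esub> flat_map C
      (copair C (coprod_swap C N M \<cdot>\<^bsub>C\<^esub> flat_ker C N M) (flat_ker C M N)) (\<one>\<^bsub>C\<^esub> X)"

definition compatible :: "('o, 'm) cat \<Rightarrow> 'o \<Rightarrow> 'o \<Rightarrow> 'm \<Rightarrow> 'm \<Rightarrow> bool" where
  "compatible C M N \<xi>MN \<xi>NM \<longleftrightarrow>
    (\<exists>\<zeta>M \<zeta>N. internal_action C (M \<oplus>\<^bsub>C\<^esub> N) M \<zeta>M \<and> internal_action C (M \<oplus>\<^bsub>C\<^esub> N) N \<zeta>N \<and>
      CA0_M C M N \<xi>NM \<zeta>M \<and> CA0_N C M N \<xi>MN \<zeta>N \<and>
      CA_on C M N \<xi>MN \<xi>NM M \<zeta>M \<and> CA_on C M N \<xi>MN \<xi>NM N \<zeta>N)"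

end

theory Submission
  imports Defs
begin

text \<open>
  From compatible actions one takes for \<open>L\<close> the coequalizer \<open>q\<close> of the reflexive pair
  \<open>\<xi>NM + \<xi>MN, [k, k] : (N \<flat> M) + (M \<flat> N) \<rightarrow> M + N\<close>.  The functor \<open>(-) \<flat> X\<close> preserves
  coequalizers of reflexive pairs, so the two actions of \<open>M + N\<close> descend to \<open>L\<close>.  Equivariance of
  \<open>M \<rightarrow> L\<close> is checked on the three pieces \<open>M \<flat> M\<close>, \<open>N \<flat> M\<close> and \<open>M \<diamond> N \<diamond> M\<close>, which are jointly
  epic over \<open>(M + N) \<flat> M\<close>; these are the three conditions of (CA.0).

  Conversely, a crossed module \<open>(\<delta> : X \<rightarrow> L, \<xi>)\<close> gives a reflexive graph \<open>d, c : G \<rightarrow> L\<close> on the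
  semidirect product.  The Peiffer condition provides \<open>\<phi> : X \<times> X \<rightarrow> G\<close> (in a groupoid,
  \<open>\<phi>(x, y) = x \<circ> y\<inverse>\<close>), whose restrictions to the two factors are kernels of \<open>d\<close> and of \<open>c\<close>.
  Hence these commute, and (SH) yields a connector between the kernel pairs of \<open>d\<close> and \<open>c\<close>, that
  is, a composition of arrows.  With it, any \<open>v : B \<rightarrow> G\<close> is seen to act on \<open>X\<close> by conjugation as
  \<open>s c v\<close> does, and this contains the ternary condition of (CA.0) for the action of \<open>M + N\<close> along
  \<open>[\<mu>, \<nu>]\<close>.

  Subobjects are handled with generalised elements; existence over regular epimorphisms replaces
  choice of preimages.
\<close>

section \<open>Generalised elements\<close>

text \<open>For groups, \<open>L\<close> is the Peiffer product: the free product of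
  \<open>M\<close> and \<open>N\<close> modulo the relations that identify the result of an action
  with the corresponding conjugate. (CA.M) and (CA.N) say exactly that the actions of
  \<open>M + N\<close> do not see these relations.

  Reflexivity of the pair matters because \<open>\<flat>\<close> is defined by a kernel, and kernels
  do not commute with coequalizers in general. A semi-abelian category is exact and Mal'tsev, so the
  image of a reflexive pair is the kernel pair of its coequalizer: elements identified in the
  quotient are locally related in one step. The same fact makes the semidirect product computable as
  a coequalizer.

  In the converse, the obstacle is the ternary condition. Through \<open>[\<mu>, \<nu>]\<close> it
  concerns \<open>[s \<mu>, s \<nu>, k]\<close> on \<open>M + N + M\<close>, where the two copies of
  \<open>M\<close> enter \<open>G\<close> differently, so that no folding applies. Since
  \<open>c k = \<mu> = c s \<mu>\<close>, conjugation by \<open>k\<close> may replace conjugation by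
  \<open>s \<mu>\<close>, and this replacement is what composition of arrows provides.\<close>

text \<open>
  An arrow into \<open>A\<close> is treated as an element of \<open>A\<close>, whatever its domain.  Equations \<open>g \<cdot> f = h\<close>
  between arrows are used in the applied form \<open>g \<cdot> f \<cdot> x = h \<cdot> x\<close> (lemma \<open>el\<close>), so that
  right-nested composites are normal forms and no reassociation is needed.
\<close>

definition elts :: "('o, 'm) cat \<Rightarrow> 'o \<Rightarrow> 'm set" where
  "elts C A = {x \<in> Arr C. Cod C x = A}"

definition monic :: "('o, 'm) cat \<Rightarrow> 'm \<Rightarrow> bool" where
  "monic C m \<longleftrightarrow> m \<in> Arr C \<and>
    (\<forall>D. \<forall>x \<in> hom C D (Dom C m). \<forall>y \<in> hom C D (Dom C m). m \<cdot>\<^bsub>C\<^esub> x = m \<cdot>\<^bsub>C\<^esub> y \<longrightarrow> x = y)"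

context category
begin

text \<open>
  The last conjunct is redundant; with it, the simplifier discharges typing conditions of nested
  composites in linear time.
\<close>

lemma hom_iff [simp]:
  "f \<in> hom C A B \<longleftrightarrow> f \<in> Arr C \<and> Dom C f = A \<and> Cod C f = B \<and> f \<in> elts C B"
  by (auto simp: hom_def elts_def)

lemma comp_typing:
  assumes "g \<in> Arr C" "f \<in> elts C (Dom C g)"
  shows "g \<cdot> f \<in> hom C (Dom C f) (Cod C g)"
  using assms comp_hom[of f "Dom C f" "Dom C g" g "Cod C g"] by (simp add: elts_def)

lemma comp_simps [simp]:
  assumes "g \<in> Arr C" "f \<in> elts C (Dom C g)"
  shows "g \<cdot> f \<in> Arr C" "Dom C (g \<cdot> f) = Dom C f" "Cod C (g \<cdot> f) = Cod C g"
    "g \<cdot> f \<in> elts C B \<longleftrightarrow> Cod C g = B"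
  using comp_typing[OF assms] by (auto simp: elts_def)

lemma assoc [simp]:
  assumes "h \<in> Arr C" "g \<in> elts C (Dom C h)" "f \<in> elts C (Dom C g)"
  shows "(h \<cdot> g) \<cdot> f = h \<cdot> g \<cdot> f"
  using assms comp_assoc[of f "Dom C f" "Dom C g" g "Dom C h" h "Cod C h"]
  by (simp add: elts_def)

lemma dom_cod_Ob [simp]: "f \<in> Arr C \<Longrightarrow> Dom C f \<in> Ob C" "f \<in> Arr C \<Longrightarrow> Cod C f \<in> Ob C"
  by (auto intro: dom_Ob cod_Ob)

lemma hom_Ob: assumes "f \<in> hom C A B" shows "A \<in> Ob C" "B \<in> Ob C"
  using assms by auto

lemma ident_simps [simp]:
  assumes "A \<in> Ob C"
  shows "\<one> A \<in> Arr C" "Dom C (\<one> A) = A" "Cod C (\<one> A) = A" "\<one> A \<in> elts C B \<longleftrightarrow> A = B"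
  using ident_hom[OF assms] by (auto simp: elts_def)

lemma ident_comp [simp]: "A \<in> Ob C \<Longrightarrow> x \<in> elts C A \<Longrightarrow> \<one> A \<cdot> x = x"
  using ident_left[of x "Dom C x" A] by (simp add: elts_def)

lemma comp_ident [simp]: "f \<in> Arr C \<Longrightarrow> Dom C f = A \<Longrightarrow> f \<cdot> \<one> A = f"
  using ident_right[of f A "Cod C f"] by (simp add: elts_def)

lemma eltsD: "x \<in> elts C A \<Longrightarrow> x \<in> Arr C" "x \<in> elts C A \<Longrightarrow> Cod C x = A"
  "x \<in> elts C A \<Longrightarrow> x \<in> hom C (Dom C x) A" "x \<in> elts C A \<Longrightarrow> A \<in> Ob C"
  by (auto simp: elts_def)

lemma Arr_elts [simp]: "f \<in> Arr C \<Longrightarrow> f \<in> elts C (Cod C f)"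
  by (simp add: elts_def)

lemma eltsI: "f \<in> Arr C \<Longrightarrow> Cod C f = B \<Longrightarrow> f \<in> elts C B"
  by (simp add: elts_def)

lemma el:
  assumes "g \<cdot> f = h" "g \<in> Arr C" "f \<in> elts C (Dom C g)" "x \<in> elts C (Dom C f)"
  shows "g \<cdot> f \<cdot> x = h \<cdot> x"
  using assms by (metis assoc)

lemma el3:
  assumes "g \<cdot> f \<cdot> k = h" "g \<in> Arr C" "f \<in> elts C (Dom C g)" "k \<in> elts C (Dom C f)"
    "x \<in> elts C (Dom C k)"
  shows "g \<cdot> f \<cdot> k \<cdot> x = h \<cdot> x"
proof -
  have "f \<in> Arr C" "k \<in> Arr C" "Cod C f = Dom C g" "Cod C k = Dom C f"
    using assms(3,4) eltsD by auto
  then have "(g \<cdot> f \<cdot> k) \<cdot> x = g \<cdot> f \<cdot> k \<cdot> x" using assms(2-5) by simp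
  then show ?thesis using assms(1) by simp
qed

lemma monicD: "monic C m \<Longrightarrow> x \<in> hom C D (Dom C m) \<Longrightarrow> y \<in> hom C D (Dom C m) \<Longrightarrow>
    m \<cdot> x = m \<cdot> y \<Longrightarrow> x = y"
  unfolding monic_def by blast

lemma monicI:
  assumes "m \<in> hom C A B" "\<And>D x y. x \<in> hom C D A \<Longrightarrow> y \<in> hom C D A \<Longrightarrow> m \<cdot> x = m \<cdot> y \<Longrightarrow> x = y"
  shows "monic C m"
  using assms unfolding monic_def by simp

section \<open>Pullbacks and kernel pairs\<close>

lemma pullback_lift:
  assumes "is_pullback C f g P p q" "u \<in> hom C D (Dom C f)" "v \<in> hom C D (Dom C g)" "f \<cdot> u = g \<cdot> v"
  obtains w where "w \<in> hom C D P" "p \<cdot> w = u" "q \<cdot> w = v"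
  using assms unfolding is_pullback_def by meson

lemma pullback_hom:
  assumes "is_pullback C f g P p q"
  shows "p \<in> hom C P (Dom C f)" "q \<in> hom C P (Dom C g)" "f \<cdot> p = g \<cdot> q"
    "f \<in> Arr C" "g \<in> Arr C" "Cod C f = Cod C g"
  using assms unfolding is_pullback_def by meson+

lemma pullback_eqI:
  assumes pb: "is_pullback C f g P p q" and "x \<in> hom C D P" "y \<in> hom C D P" "p \<cdot> x = p \<cdot> y" "q \<cdot> x = q \<cdot> y"
  shows "x = y"
proof -
  note h[simp] = pullback_hom[OF pb, unfolded hom_iff]
  have "f \<cdot> p \<cdot> y = g \<cdot> q \<cdot> y"
    using assms(2,3) el[OF h(3), of y] by simp
  then have "\<exists>!h. h \<in> hom C D P \<and> p \<cdot> h = p \<cdot> y \<and> q \<cdot> h = q \<cdot> y"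
    using pb assms(2,3) unfolding is_pullback_def by simp
  then show ?thesis using assms by blast
qed

text \<open>Makes the kernel pairs of \<open>d\<close> and \<open>c\<close> admissible for
  (SH).\<close>

lemma equivalence_relation_kernel_pair:
  assumes pb: "is_pullback C f f R r1 r2" and f: "f \<in> hom C X B"
  shows "equivalence_relation C X R r1 r2"
proof -
  note h = pullback_hom[OF pb]
  note e = el[OF h(3)]
  have X: "X \<in> Ob C" using f by auto
  have 1: "jointly_monic C R r1 r2"
    unfolding jointly_monic_def using pullback_eqI[OF pb] by blast
  obtain e1 where e1: "e1 \<in> hom C X R" "r1 \<cdot> e1 = \<one> X" "r2 \<cdot> e1 = \<one> X"
    using pullback_lift[OF pb, of "\<one> X" X "\<one> X"] f X by auto
  obtain s where s: "s \<in> hom C R R" "r1 \<cdot> s = r2" "r2 \<cdot> s = r1"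
    using pullback_lift[OF pb, of r2 R r1] h by metis
  have t: "\<exists>t\<in>hom C P R. r1 \<cdot> t = r1 \<cdot> p \<and> r2 \<cdot> t = r2 \<cdot> q" if pb2: "is_pullback C r2 r1 P p q" for P p q
  proof -
    note h2 = pullback_hom[OF pb2]
    have "f \<cdot> r1 \<cdot> p = f \<cdot> r2 \<cdot> q"
      using h h2 e[of p] e[of q] by simp
    then obtain w where "w \<in> hom C P R" "r1 \<cdot> w = r1 \<cdot> p" "r2 \<cdot> w = r2 \<cdot> q"
      using pullback_lift[OF pb, of "r1 \<cdot> p" P "r2 \<cdot> q"] h h2 by auto
    then show ?thesis by blast
  qed
  have "r1 \<in> hom C R X" "r2 \<in> hom C R X"
    using h(1,2) f by simp_all
  then show ?thesis
    unfolding equivalence_relation_def using 1 e1 s t by blast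
qed

end

section \<open>Zero morphisms, products, coproducts and kernels\<close>

context semi_abelian_category
begin

text \<open>Factorisations through two zero objects are compared by the unique arrow between these
  objects; hence the \<open>THE\<close> in \<open>zero\<close> denotes, whatever zero object is at
  hand.\<close>

lemma zero_eq:
  assumes Z: "is_zero_object C Z" "g \<in> hom C A Z" "h \<in> hom C Z B"
  shows "zero C A B = h \<cdot> g"
  unfolding zero_def
proof (rule the_equality)
  show "\<exists>Z g' h'. is_zero_object C Z \<and> g' \<in> hom C A Z \<and> h' \<in> hom C Z B \<and> h \<cdot> g = h' \<cdot> g'"
    using assms by blast
next
  fix f assume "\<exists>Z g h. is_zero_object C Z \<and> g \<in> hom C A Z \<and> h \<in> hom C Z B \<and> f = h \<cdot> g"
  then obtain Z' g' h' where Z': "is_zero_object C Z'" "g' \<in> hom C A Z'" "h' \<in> hom C Z' B" "f = h' \<cdot> g'"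
    by blast
  have Ob: "Z \<in> Ob C" "Z' \<in> Ob C" "A \<in> Ob C" "B \<in> Ob C" using hom_Ob assms Z' by blast+
  obtain i where i: "i \<in> hom C Z Z'"
    using Z(1) Ob unfolding is_zero_object_def is_initial_def by blast
  have "i \<cdot> g \<in> hom C A Z'" using i Z by simp
  then have 1: "i \<cdot> g = g'"
    using Z'(1,2) Ob unfolding is_zero_object_def is_terminal_def by blast
  have "h' \<cdot> i \<in> hom C Z B" using i Z'(3) by simp
  then have 2: "h' \<cdot> i = h"
    using Z(1,3) Ob unfolding is_zero_object_def is_initial_def by blast
  have "(h' \<cdot> i) \<cdot> g = h' \<cdot> i \<cdot> g" using i Z Z' by simp
  then show "f = h \<cdot> g" using Z'(4) 1 2 by simp
qed

lemma zero_factor: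
  assumes "A \<in> Ob C" "B \<in> Ob C"
  obtains Z g h where "is_zero_object C Z" "g \<in> hom C A Z" "h \<in> hom C Z B" "zero C A B = h \<cdot> g"
proof -
  obtain Z where Z: "is_zero_object C Z" using pointed by blast
  then obtain g h where "g \<in> hom C A Z" "h \<in> hom C Z B"
    using assms unfolding is_zero_object_def is_terminal_def is_initial_def by blast
  with Z that zero_eq show ?thesis by blast
qed

lemma zero_simps [simp]:
  assumes "A \<in> Ob C" "B \<in> Ob C"
  shows "zero C A B \<in> Arr C" "Dom C (zero C A B) = A" "Cod C (zero C A B) = B"
    "zero C A B \<in> elts C D \<longleftrightarrow> B = D"
proof -
  have "zero C A B \<in> hom C A B"
    using zero_factor[OF assms] comp_hom by metis
  then show "zero C A B \<in> Arr C" "Dom C (zero C A B) = A" "Cod C (zero C A B) = B"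
    "zero C A B \<in> elts C D \<longleftrightarrow> B = D" by (auto simp: elts_def)
qed

lemma zero_comp [simp]:
  assumes "x \<in> elts C A" "B \<in> Ob C"
  shows "zero C A B \<cdot> x = zero C (Dom C x) B"
proof -
  obtain Z g h where Z: "is_zero_object C Z" "g \<in> hom C A Z" "h \<in> hom C Z B" "zero C A B = h \<cdot> g"
    using zero_factor[of A B] eltsD(4) assms by blast
  have "zero C (Dom C x) B = h \<cdot> g \<cdot> x"
    by (rule zero_eq[of Z]) (use Z eltsD(3)[OF assms(1)] in simp_all)
  then show ?thesis using Z assms by simp
qed

lemma comp_zero [simp]:
  assumes "f \<in> Arr C" "Dom C f = B" "A \<in> Ob C"
  shows "f \<cdot> zero C A B = zero C A (Cod C f)"
proof -
  have "B \<in> Ob C" using assms by auto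
  then obtain Z g h where Z: "is_zero_object C Z" "g \<in> hom C A Z" "h \<in> hom C Z B" "zero C A B = h \<cdot> g"
    using zero_factor[OF assms(3)] by metis
  have "zero C A (Cod C f) = (f \<cdot> h) \<cdot> g"
    by (rule zero_eq[of Z]) (use Z assms in simp_all)
  then show ?thesis using Z assms by simp
qed

section \<open>Binary products, as pullbacks over a terminal object\<close>

lemma product_ex:
  assumes "A \<in> Ob C" "B \<in> Ob C"
  shows "\<exists>P p q. is_product C A B P p q"
proof -
  obtain T where T: "is_terminal C T" using terminal_ex by blast
  obtain f g where fg: "f \<in> hom C A T" "g \<in> hom C B T"
    using T assms unfolding is_terminal_def by blast
  obtain P p q where P: "is_pullback C f g P p q" using pullback_ex fg by blast
  have "\<exists>!h. h \<in> hom C D P \<and> p \<cdot> h = u \<and> q \<cdot> h = v" if uv: "u \<in> hom C D A" "v \<in> hom C D B" for D u v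
  proof -
    have "f \<cdot> u \<in> hom C D T" "g \<cdot> v \<in> hom C D T" using uv fg by simp_all
    then have "f \<cdot> u = g \<cdot> v" using T hom_Ob uv unfolding is_terminal_def by blast
    then show ?thesis using P uv fg unfolding is_pullback_def by simp
  qed
  moreover have "p \<in> hom C P A" "q \<in> hom C P B" using pullback_hom[OF P] fg by simp_all
  ultimately have "is_product C A B P p q"
    unfolding is_product_def by blast
  then show ?thesis by blast
qed

lemma product_is_product:
  assumes "A \<in> Ob C" "B \<in> Ob C"
  shows "is_product C A B (prod_ob C A B) (proj1 C A B) (proj2 C A B)"
proof -
  have "\<exists>x. case x of (P, p, q) \<Rightarrow> is_product C A B P p q"
    using product_ex[OF assms] by auto
  then have "case product C A B of (P, p, q) \<Rightarrow> is_product C A B P p q"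
    unfolding product_def by (rule someI_ex)
  then show ?thesis
    unfolding prod_ob_def proj1_def proj2_def by (simp split: prod.splits)
qed

lemma proj_simps [simp]:
  assumes "A \<in> Ob C" "B \<in> Ob C"
  shows "proj1 C A B \<in> Arr C" "Dom C (proj1 C A B) = prod_ob C A B" "Cod C (proj1 C A B) = A"
    "proj1 C A B \<in> elts C D \<longleftrightarrow> A = D"
    "proj2 C A B \<in> Arr C" "Dom C (proj2 C A B) = prod_ob C A B" "Cod C (proj2 C A B) = B"
    "proj2 C A B \<in> elts C D \<longleftrightarrow> B = D" "prod_ob C A B \<in> Ob C"
proof -
  have p: "proj1 C A B \<in> hom C (prod_ob C A B) A" "proj2 C A B \<in> hom C (prod_ob C A B) B"
    using product_is_product[OF assms] unfolding is_product_def by blast+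
  show "prod_ob C A B \<in> Ob C" using hom_Ob[OF p(1)] by simp
qed (use product_is_product[OF assms] in \<open>auto simp: is_product_def elts_def\<close>)

lemma pair_props:
  assumes "f \<in> hom C D A" "g \<in> hom C D B"
  shows "pair C f g \<in> hom C D (prod_ob C A B) \<and> proj1 C A B \<cdot> pair C f g = f \<and>
    proj2 C A B \<cdot> pair C f g = g"
proof -
  have "\<exists>!h. h \<in> hom C D (prod_ob C A B) \<and> proj1 C A B \<cdot> h = f \<and> proj2 C A B \<cdot> h = g"
    using assms product_is_product[OF hom_Ob(2)[OF assms(1)] hom_Ob(2)[OF assms(2)]]
    unfolding is_product_def by blast
  from theI'[OF this] show ?thesis
    using assms unfolding pair_def by simp
qed

lemma pair_simps [simp]:
  assumes "f \<in> Arr C" "g \<in> Arr C" "Dom C g = Dom C f"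
  shows "pair C f g \<in> Arr C" "Dom C (pair C f g) = Dom C f"
    "Cod C (pair C f g) = prod_ob C (Cod C f) (Cod C g)"
    "pair C f g \<in> elts C D \<longleftrightarrow> prod_ob C (Cod C f) (Cod C g) = D"
  using pair_props[of f "Dom C f" "Cod C f" g "Cod C g"] assms by (auto simp: elts_def)

lemma proj_pair [simp]:
  assumes "f \<in> Arr C" "g \<in> Arr C" "Dom C g = Dom C f" "Cod C f = A" "Cod C g = B"
  shows "proj1 C A B \<cdot> pair C f g = f" "proj2 C A B \<cdot> pair C f g = g"
  using pair_props[of f "Dom C f" A g B] assms by (auto simp: eltsI)

lemma prod_eqI:
  assumes "x \<in> hom C D (prod_ob C A B)" "y \<in> hom C D (prod_ob C A B)" "A \<in> Ob C" "B \<in> Ob C"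
    "proj1 C A B \<cdot> x = proj1 C A B \<cdot> y" "proj2 C A B \<cdot> x = proj2 C A B \<cdot> y"
  shows "x = y"
proof -
  have "proj1 C A B \<cdot> x \<in> hom C D A" "proj2 C A B \<cdot> x \<in> hom C D B"
    using assms by simp_all
  then have "\<exists>!h. h \<in> hom C D (prod_ob C A B) \<and> proj1 C A B \<cdot> h = proj1 C A B \<cdot> x \<and>
      proj2 C A B \<cdot> h = proj2 C A B \<cdot> x"
    using product_is_product[OF assms(3,4)] unfolding is_product_def by blast
  with assms show ?thesis by metis
qed

lemma pair_comp [simp]:
  assumes "f \<in> Arr C" "g \<in> Arr C" "Dom C g = Dom C f" "x \<in> elts C (Dom C f)"
  shows "pair C f g \<cdot> x = pair C (f \<cdot> x) (g \<cdot> x)"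
proof (rule prod_eqI[of _ "Dom C x" "Cod C f" "Cod C g"])
  have "proj1 C (Cod C f) (Cod C g) \<cdot> pair C f g \<cdot> x = f \<cdot> x"
    by (rule el[of _ "pair C f g"]) (use assms in simp_all)
  then show "proj1 C (Cod C f) (Cod C g) \<cdot> pair C f g \<cdot> x = proj1 C (Cod C f) (Cod C g) \<cdot> pair C (f \<cdot> x) (g \<cdot> x)"
    using assms by simp
  have "proj2 C (Cod C f) (Cod C g) \<cdot> pair C f g \<cdot> x = g \<cdot> x"
    by (rule el[of _ "pair C f g"]) (use assms in simp_all)
  then show "proj2 C (Cod C f) (Cod C g) \<cdot> pair C f g \<cdot> x = proj2 C (Cod C f) (Cod C g) \<cdot> pair C (f \<cdot> x) (g \<cdot> x)"
    using assms by simp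
qed (use assms in simp_all)

lemma pair_inject:
  assumes "pair C f g = pair C f' g'" "f \<in> hom C D A" "f' \<in> hom C D A" "g \<in> hom C D B" "g' \<in> hom C D B"
  shows "f = f'" "g = g'"
  by (metis pair_props[OF assms(2,4)] pair_props[OF assms(3,5)] assms(1))+

section \<open>Binary coproducts\<close>

lemma coproduct_is_coproduct:
  assumes "A \<in> Ob C" "B \<in> Ob C"
  shows "is_coproduct C A B (A \<oplus> B) (in1 C A B) (in2 C A B)"
proof -
  have "\<exists>x. case x of (P, p, q) \<Rightarrow> is_coproduct C A B P p q"
    using coproduct_ex[OF assms] by auto
  then have "case coproduct C A B of (P, p, q) \<Rightarrow> is_coproduct C A B P p q"
    unfolding coproduct_def by (rule someI_ex)
  then show ?thesis
    unfolding coprod_ob_def in1_def in2_def by (simp split: prod.splits)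
qed

lemma in_simps [simp]:
  assumes "A \<in> Ob C" "B \<in> Ob C"
  shows "in1 C A B \<in> Arr C" "Dom C (in1 C A B) = A" "Cod C (in1 C A B) = A \<oplus> B"
    "in1 C A B \<in> elts C D \<longleftrightarrow> A \<oplus> B = D"
    "in2 C A B \<in> Arr C" "Dom C (in2 C A B) = B" "Cod C (in2 C A B) = A \<oplus> B"
    "in2 C A B \<in> elts C D \<longleftrightarrow> A \<oplus> B = D" "A \<oplus> B \<in> Ob C"
proof -
  have p: "in1 C A B \<in> hom C A (A \<oplus> B)" "in2 C A B \<in> hom C B (A \<oplus> B)"
    using coproduct_is_coproduct[OF assms] unfolding is_coproduct_def by blast+
  show "A \<oplus> B \<in> Ob C" using hom_Ob[OF p(1)] by simp
qed (use coproduct_is_coproduct[OF assms] in \<open>auto simp: is_coproduct_def elts_def\<close>)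

lemma copair_props:
  assumes "f \<in> hom C A D" "g \<in> hom C B D"
  shows "copair C f g \<in> hom C (A \<oplus> B) D \<and> copair C f g \<cdot> in1 C A B = f \<and> copair C f g \<cdot> in2 C A B = g"
proof -
  have "\<exists>!h. h \<in> hom C (A \<oplus> B) D \<and> h \<cdot> in1 C A B = f \<and> h \<cdot> in2 C A B = g"
    using assms coproduct_is_coproduct[OF hom_Ob(1)[OF assms(1)] hom_Ob(1)[OF assms(2)]]
    unfolding is_coproduct_def by blast
  from theI'[OF this] show ?thesis
    using assms unfolding copair_def by simp
qed

lemma copair_simps [simp]:
  assumes "f \<in> Arr C" "g \<in> Arr C" "Cod C g = Cod C f"
  shows "copair C f g \<in> Arr C" "Dom C (copair C f g) = Dom C f \<oplus> Dom C g"
    "Cod C (copair C f g) = Cod C f" "copair C f g \<in> elts C D \<longleftrightarrow> Cod C f = D"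
  using copair_props[of f "Dom C f" "Cod C f" g "Dom C g"] assms by (auto simp: elts_def)

lemma copair_in [simp]:
  assumes "f \<in> Arr C" "g \<in> Arr C" "Cod C g = Cod C f" "Dom C f = A" "Dom C g = B"
  shows "copair C f g \<cdot> in1 C A B = f" "copair C f g \<cdot> in2 C A B = g"
    "x \<in> elts C A \<Longrightarrow> copair C f g \<cdot> in1 C A B \<cdot> x = f \<cdot> x"
    "y \<in> elts C B \<Longrightarrow> copair C f g \<cdot> in2 C A B \<cdot> y = g \<cdot> y"
proof -
  show 1: "copair C f g \<cdot> in1 C A B = f" and 2: "copair C f g \<cdot> in2 C A B = g"
    using copair_props[of f A "Cod C f" g B] assms by (auto simp: eltsI)
  show "x \<in> elts C A \<Longrightarrow> copair C f g \<cdot> in1 C A B \<cdot> x = f \<cdot> x"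
    by (rule el[OF 1]) (use assms in auto)
  show "y \<in> elts C B \<Longrightarrow> copair C f g \<cdot> in2 C A B \<cdot> y = g \<cdot> y"
    by (rule el[OF 2]) (use assms in auto)
qed

lemma coprod_eqI:
  assumes "f \<in> hom C (A \<oplus> B) D" "g \<in> hom C (A \<oplus> B) D" "A \<in> Ob C" "B \<in> Ob C"
    "f \<cdot> in1 C A B = g \<cdot> in1 C A B" "f \<cdot> in2 C A B = g \<cdot> in2 C A B"
  shows "f = g"
proof -
  have "f \<cdot> in1 C A B \<in> hom C A D" "f \<cdot> in2 C A B \<in> hom C B D"
    using assms by simp_all
  then have "\<exists>!h. h \<in> hom C (A \<oplus> B) D \<and> h \<cdot> in1 C A B = f \<cdot> in1 C A B \<and>
      h \<cdot> in2 C A B = f \<cdot> in2 C A B"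
    using coproduct_is_coproduct[OF assms(3,4)] unfolding is_coproduct_def by blast
  with assms show ?thesis by metis
qed

lemma comp_copair:
  assumes "f \<in> Arr C" "g \<in> Arr C" "Cod C g = Cod C f" "h \<in> Arr C" "Dom C h = Cod C f"
  shows "h \<cdot> copair C f g = copair C (h \<cdot> f) (h \<cdot> g)"
    "x \<in> elts C (Dom C f \<oplus> Dom C g) \<Longrightarrow> h \<cdot> copair C f g \<cdot> x = copair C (h \<cdot> f) (h \<cdot> g) \<cdot> x"
proof -
  have e: "f \<in> elts C (Dom C h)" "g \<in> elts C (Dom C h)" using assms by (simp_all add: eltsI)
  show 1: "h \<cdot> copair C f g = copair C (h \<cdot> f) (h \<cdot> g)"
    by (rule coprod_eqI[of _ "Dom C f" "Dom C g" "Cod C h"]) (use assms e in simp_all)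
  show "x \<in> elts C (Dom C f \<oplus> Dom C g) \<Longrightarrow> h \<cdot> copair C f g \<cdot> x = copair C (h \<cdot> f) (h \<cdot> g) \<cdot> x"
    by (rule el[OF 1]) (use assms in auto)
qed

lemma coprod_map_simps [simp]:
  assumes "f \<in> Arr C" "g \<in> Arr C"
  shows "coprod_map C f g \<in> Arr C" "Dom C (coprod_map C f g) = Dom C f \<oplus> Dom C g"
    "Cod C (coprod_map C f g) = Cod C f \<oplus> Cod C g"
    "coprod_map C f g \<in> elts C D \<longleftrightarrow> Cod C f \<oplus> Cod C g = D"
  using assms unfolding coprod_map_def by simp_all

lemma coprod_map_in [simp]:
  assumes "f \<in> Arr C" "g \<in> Arr C" "Dom C f = A" "Dom C g = B"
  shows "coprod_map C f g \<cdot> in1 C A B = in1 C (Cod C f) (Cod C g) \<cdot> f"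
    "coprod_map C f g \<cdot> in2 C A B = in2 C (Cod C f) (Cod C g) \<cdot> g"
    "x \<in> elts C A \<Longrightarrow> coprod_map C f g \<cdot> in1 C A B \<cdot> x = in1 C (Cod C f) (Cod C g) \<cdot> f \<cdot> x"
    "y \<in> elts C B \<Longrightarrow> coprod_map C f g \<cdot> in2 C A B \<cdot> y = in2 C (Cod C f) (Cod C g) \<cdot> g \<cdot> y"
  using assms unfolding coprod_map_def by simp_all

lemma copair_coprod_map [simp]:
  assumes "f \<in> Arr C" "g \<in> Arr C" "a \<in> Arr C" "b \<in> Arr C" "Cod C f = Dom C a" "Cod C g = Dom C b"
    "Cod C b = Cod C a"
  shows "copair C a b \<cdot> coprod_map C f g = copair C (a \<cdot> f) (b \<cdot> g)"
    "x \<in> elts C (Dom C f \<oplus> Dom C g) \<Longrightarrow>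
      copair C a b \<cdot> coprod_map C f g \<cdot> x = copair C (a \<cdot> f) (b \<cdot> g) \<cdot> x"
proof -
  have e: "f \<in> elts C (Dom C a)" "g \<in> elts C (Dom C b)" using assms by (simp_all add: eltsI)
  show 1: "copair C a b \<cdot> coprod_map C f g = copair C (a \<cdot> f) (b \<cdot> g)"
    by (rule coprod_eqI[of _ "Dom C f" "Dom C g" "Cod C a"]) (use assms e in simp_all)
  show "x \<in> elts C (Dom C f \<oplus> Dom C g) \<Longrightarrow>
      copair C a b \<cdot> coprod_map C f g \<cdot> x = copair C (a \<cdot> f) (b \<cdot> g) \<cdot> x"
    by (rule el[OF 1]) (use assms in auto)
qed

lemma coprod_map_comp [simp]:
  assumes "f \<in> Arr C" "g \<in> Arr C" "a \<in> Arr C" "b \<in> Arr C" "Cod C f = Dom C a" "Cod C g = Dom C b"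
  shows "coprod_map C a b \<cdot> coprod_map C f g = coprod_map C (a \<cdot> f) (b \<cdot> g)"
    "x \<in> elts C (Dom C f \<oplus> Dom C g) \<Longrightarrow>
      coprod_map C a b \<cdot> coprod_map C f g \<cdot> x = coprod_map C (a \<cdot> f) (b \<cdot> g) \<cdot> x"
proof -
  have e: "f \<in> elts C (Dom C a)" "g \<in> elts C (Dom C b)" using assms by (simp_all add: eltsI)
  show 1: "coprod_map C a b \<cdot> coprod_map C f g = coprod_map C (a \<cdot> f) (b \<cdot> g)"
    by (rule coprod_eqI[of _ "Dom C f" "Dom C g" "Cod C a \<oplus> Cod C b"]) (use assms e in simp_all)
  show "x \<in> elts C (Dom C f \<oplus> Dom C g) \<Longrightarrow>
      coprod_map C a b \<cdot> coprod_map C f g \<cdot> x = coprod_map C (a \<cdot> f) (b \<cdot> g) \<cdot> x"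
    by (rule el[OF 1]) (use assms in auto)
qed

lemma coprod_map_ident [simp]:
  "A \<in> Ob C \<Longrightarrow> B \<in> Ob C \<Longrightarrow> coprod_map C (\<one> A) (\<one> B) = \<one> (A \<oplus> B)"
  by (rule coprod_eqI[of _ A B "A \<oplus> B"]) simp_all

section \<open>Kernels\<close>

lemma kernel_ex:
  assumes f: "f \<in> hom C A B"
  shows "\<exists>K k. is_kernel C f K k"
proof -
  obtain Z where Z: "is_zero_object C Z" using pointed by blast
  have Ob: "A \<in> Ob C" "B \<in> Ob C" using hom_Ob f by auto
  obtain z where z: "z \<in> hom C Z B"
    using Z Ob unfolding is_zero_object_def is_initial_def by blast
  obtain K k t where K: "is_pullback C f z K k t" using pullback_ex f z by blast
  note h = pullback_hom[OF K]
  have e: "f \<cdot> k = zero C K B" using zero_eq[OF Z, of t K z B] h z by simp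
  have "\<exists>!v. v \<in> hom C D K \<and> k \<cdot> v = u" if u: "u \<in> hom C D A" "f \<cdot> u = zero C D B" for D u
  proof -
    have t: "\<exists>!f. f \<in> hom C D Z" using Z hom_Ob(1)[OF u(1)] unfolding is_zero_object_def is_terminal_def by blast
    then obtain v where v: "v \<in> hom C D Z" by blast
    then have "f \<cdot> u = z \<cdot> v" using u zero_eq[OF Z v z] by simp
    moreover have "u \<in> hom C D (Dom C f)" "v \<in> hom C D (Dom C z)" using u v f z by simp_all
    ultimately obtain w where w: "w \<in> hom C D K" "k \<cdot> w = u"
      using pullback_lift[OF K] by blast
    show ?thesis
    proof (rule ex1I[of _ w])
      fix w' assume w': "w' \<in> hom C D K \<and> k \<cdot> w' = u"
      have "t \<cdot> w' \<in> hom C D Z" "t \<cdot> w \<in> hom C D Z" using w' w h z by simp_all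
      then have "t \<cdot> w' = t \<cdot> w" using t by blast
      then show "w' = w" using pullback_eqI[OF K] w w' by metis
    qed (use w in auto)
  qed
  moreover have "Dom C f = A" "Cod C f = B" "f \<in> Arr C" using f by simp_all
  ultimately have "is_kernel C f K k" unfolding is_kernel_def using e h by blast
  then show ?thesis by blast
qed

lemma ker_is_kernel:
  assumes "f \<in> Arr C"
  shows "is_kernel C f (ker_ob C f) (ker C f)"
proof -
  have "\<exists>x. case x of (K, k) \<Rightarrow> is_kernel C f K k"
    using kernel_ex[of f "Dom C f" "Cod C f"] assms by auto
  then have "case kernel C f of (K, k) \<Rightarrow> is_kernel C f K k"
    unfolding kernel_def by (rule someI_ex)
  then show ?thesis
    unfolding ker_ob_def ker_def by (simp split: prod.splits)
qed

lemma is_kernelD: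
  assumes "is_kernel C f K k"
  shows "k \<in> hom C K (Dom C f)" "monic C k"
    "\<And>x. x \<in> elts C K \<Longrightarrow> f \<cdot> k \<cdot> x = zero C (Dom C x) (Cod C f)"
    "\<And>D u. u \<in> hom C D (Dom C f) \<Longrightarrow> f \<cdot> u = zero C D (Cod C f) \<Longrightarrow> \<exists>v \<in> hom C D K. k \<cdot> v = u"
proof -
  have f[simp]: "f \<in> Arr C" and e: "f \<cdot> k = zero C K (Cod C f)" using assms unfolding is_kernel_def by auto
  show k: "k \<in> hom C K (Dom C f)" using assms unfolding is_kernel_def by auto
  show 3: "f \<cdot> k \<cdot> x = zero C (Dom C x) (Cod C f)" if "x \<in> elts C K" for x
    using el[OF e, of x] k that by simp
  show 4: "\<exists>v \<in> hom C D K. k \<cdot> v = u" if "u \<in> hom C D (Dom C f)" "f \<cdot> u = zero C D (Cod C f)" for D u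
    using assms that unfolding is_kernel_def by blast
  show "monic C k"
  proof (rule monicI[OF k])
    fix D x y assume xy: "x \<in> hom C D K" "y \<in> hom C D K" "k \<cdot> x = k \<cdot> y"
    have "k \<cdot> x \<in> hom C D (Dom C f)" "f \<cdot> k \<cdot> x = zero C D (Cod C f)"
      using k xy(1) 3[of x] by simp_all
    then have "\<exists>!v. v \<in> hom C D K \<and> k \<cdot> v = k \<cdot> x"
      using assms unfolding is_kernel_def by blast
    with xy show "x = y" by metis
  qed
qed

lemma ker_simps [simp]:
  assumes "f \<in> Arr C"
  shows "ker C f \<in> Arr C" "Dom C (ker C f) = ker_ob C f" "Cod C (ker C f) = Dom C f"
    "ker C f \<in> elts C D \<longleftrightarrow> Dom C f = D" "ker_ob C f \<in> Ob C" "monic C (ker C f)"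
    "f \<cdot> ker C f = zero C (ker_ob C f) (Cod C f)"
    "x \<in> elts C (ker_ob C f) \<Longrightarrow> f \<cdot> ker C f \<cdot> x = zero C (Dom C x) (Cod C f)"
proof -
  note k = is_kernelD[OF ker_is_kernel[OF assms]]
  show 1: "ker C f \<in> Arr C" and 2: "Dom C (ker C f) = ker_ob C f" and "Cod C (ker C f) = Dom C f"
    "ker C f \<in> elts C D \<longleftrightarrow> Dom C f = D" "monic C (ker C f)"
    using k(1,2) by (auto simp: elts_def)
  show "ker_ob C f \<in> Ob C" using dom_cod_Ob(1)[OF 1] 2 by simp
  show "f \<cdot> ker C f = zero C (ker_ob C f) (Cod C f)"
    using ker_is_kernel[OF assms] unfolding is_kernel_def by blast
  show "x \<in> elts C (ker_ob C f) \<Longrightarrow> f \<cdot> ker C f \<cdot> x = zero C (Dom C x) (Cod C f)"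
    using k(3) by blast
qed

lemma ker_lift:
  assumes "f \<in> Arr C" "u \<in> hom C D (Dom C f)" "f \<cdot> u = zero C D (Cod C f)"
  obtains v where "v \<in> hom C D (ker_ob C f)" "ker C f \<cdot> v = u"
  using is_kernelD(4)[OF ker_is_kernel[OF assms(1)] assms(2,3)] by blast

text \<open>The arrows from \<open>flat_map\<close> to the two foldings are all \<open>THE\<close>
  lifts along a kernel. Monicity settles uniqueness once, so each of them only needs an existence
  proof.\<close>

lemma the_lift:
  assumes "monic C m" "Dom C m = K" "\<exists>w. w \<in> hom C D K \<and> m \<cdot> w = u"
  shows "(THE h. h \<in> hom C D K \<and> m \<cdot> h = u) \<in> hom C D K"
    "m \<cdot> (THE h. h \<in> hom C D K \<and> m \<cdot> h = u) = u"
proof -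
  have "\<exists>!w. w \<in> hom C D K \<and> m \<cdot> w = u"
    using assms monicD[OF assms(1)] by metis
  from theI'[OF this] show "(THE h. h \<in> hom C D K \<and> m \<cdot> h = u) \<in> hom C D K"
    "m \<cdot> (THE h. h \<in> hom C D K \<and> m \<cdot> h = u) = u" by blast+
qed

lemma is_kernelI:
  assumes "f \<in> hom C A B" "k \<in> hom C K A" "monic C k" "f \<cdot> k = zero C K B"
    "\<And>D u. u \<in> hom C D A \<Longrightarrow> f \<cdot> u = zero C D B \<Longrightarrow> \<exists>v \<in> hom C D K. k \<cdot> v = u"
  shows "is_kernel C f K k"
proof -
  have "\<exists>!v. v \<in> hom C D K \<and> k \<cdot> v = u" if u: "u \<in> hom C D A" "f \<cdot> u = zero C D B" for D u
  proof -
    obtain v where "v \<in> hom C D K" "k \<cdot> v = u" using assms(5)[OF u] by blast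
    moreover have "w = v" if "w \<in> hom C D K \<and> k \<cdot> w = u" for w
      using monicD[OF assms(3), of w D v] that calculation assms(2) by simp
    ultimately show ?thesis by blast
  qed
  moreover have "f \<in> Arr C" "Dom C f = A" "Cod C f = B" using assms by simp_all
  ultimately show ?thesis using assms(2,4) unfolding is_kernel_def by blast
qed

section \<open>The functor flat, and protomodularity\<close>

lemma flat_retraction_simps [simp]:
  assumes "A \<in> Ob C" "B \<in> Ob C"
  shows "flat_retraction C A B \<in> Arr C" "Dom C (flat_retraction C A B) = A \<oplus> B"
    "Cod C (flat_retraction C A B) = A" "flat_retraction C A B \<in> elts C D \<longleftrightarrow> A = D"
  using assms unfolding flat_retraction_def by simp_all

lemma flat_ker_simps [simp]:
  assumes "A \<in> Ob C" "B \<in> Ob C"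
  shows "flat_ker C A B \<in> Arr C" "Dom C (flat_ker C A B) = A \<flat> B" "Cod C (flat_ker C A B) = A \<oplus> B"
    "flat_ker C A B \<in> elts C D \<longleftrightarrow> A \<oplus> B = D" "A \<flat> B \<in> Ob C" "monic C (flat_ker C A B)"
  using assms unfolding flat_ker_def flat_def by simp_all

text \<open>\<open>[f, 0]\<close> factors through \<open>[1, 0]\<close>, whose kernel is
  \<open>A \<flat> B\<close>. Stated for arbitrary \<open>f\<close>, it lets the simplifier
  discharge vanishing conditions of lifts.\<close>

lemma copair_zero_flat_ker [simp]:
  assumes "f \<in> Arr C" "Dom C f = A" "Cod C f = D" "B \<in> Ob C"
  shows "copair C f (zero C B D) \<cdot> flat_ker C A B = zero C (A \<flat> B) D"
    "x \<in> elts C (A \<flat> B) \<Longrightarrow> copair C f (zero C B D) \<cdot> flat_ker C A B \<cdot> x = zero C (Dom C x) D"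
proof -
  have Ob: "A \<in> Ob C" "D \<in> Ob C" using assms by auto
  have 0: "flat_retraction C A B \<cdot> flat_ker C A B = zero C (A \<flat> B) A"
    using assms Ob unfolding flat_ker_def flat_def by simp
  have "copair C f (zero C B D) = f \<cdot> flat_retraction C A B"
    using assms Ob unfolding flat_retraction_def by (simp add: comp_copair)
  then show 1: "copair C f (zero C B D) \<cdot> flat_ker C A B = zero C (A \<flat> B) D"
    using assms Ob 0 by simp
  show "x \<in> elts C (A \<flat> B) \<Longrightarrow> copair C f (zero C B D) \<cdot> flat_ker C A B \<cdot> x = zero C (Dom C x) D"
    using el[OF 1, of x] assms Ob by simp
qed

lemma flat_lift:
  assumes "u \<in> hom C D (A \<oplus> B)" "copair C (\<one> A) (zero C B A) \<cdot> u = zero C D A" "A \<in> Ob C" "B \<in> Ob C"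
  shows "\<exists>v \<in> hom C D (A \<flat> B). flat_ker C A B \<cdot> v = u"
proof -
  have "u \<in> hom C D (Dom C (flat_retraction C A B))"
    "flat_retraction C A B \<cdot> u = zero C D (Cod C (flat_retraction C A B))"
    using assms(1,3,4) assms(2)[folded flat_retraction_def] by simp_all
  then show ?thesis
    using ker_lift[OF flat_retraction_simps(1)[OF assms(3,4)]] unfolding flat_ker_def flat_def by metis
qed

lemma flat_eqI:
  assumes "x \<in> hom C D (A \<flat> B)" "y \<in> hom C D (A \<flat> B)" "A \<in> Ob C" "B \<in> Ob C"
    "flat_ker C A B \<cdot> x = flat_ker C A B \<cdot> y"
  shows "x = y"
  using monicD[OF flat_ker_simps(6)[OF assms(3,4)], of x D y] assms by simp

lemma flat_map_props:
  assumes "f \<in> hom C A A'" "g \<in> hom C B B'"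
  shows "flat_map C f g \<in> hom C (A \<flat> B) (A' \<flat> B') \<and>
    flat_ker C A' B' \<cdot> flat_map C f g = coprod_map C f g \<cdot> flat_ker C A B"
proof -
  have h: "f \<in> Arr C" "Dom C f = A" "Cod C f = A'" "g \<in> Arr C" "Dom C g = B" "Cod C g = B'"
    "f \<in> elts C A'" "g \<in> elts C B'" "A \<in> Ob C" "A' \<in> Ob C" "B \<in> Ob C" "B' \<in> Ob C"
    using assms by auto
  have "\<exists>w \<in> hom C (A \<flat> B) (A' \<flat> B'). flat_ker C A' B' \<cdot> w = coprod_map C f g \<cdot> flat_ker C A B"
    using h by (intro flat_lift) simp_all
  then have *: "\<exists>w. w \<in> hom C (A \<flat> B) (A' \<flat> B') \<and> flat_ker C A' B' \<cdot> w = coprod_map C f g \<cdot> flat_ker C A B"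
    by blast
  show ?thesis
    using the_lift[OF _ _ *] h unfolding flat_map_def by simp
qed

lemma flat_map_simps [simp]:
  assumes "f \<in> Arr C" "g \<in> Arr C"
  shows "flat_map C f g \<in> Arr C" "Dom C (flat_map C f g) = Dom C f \<flat> Dom C g"
    "Cod C (flat_map C f g) = Cod C f \<flat> Cod C g"
    "flat_map C f g \<in> elts C D \<longleftrightarrow> Cod C f \<flat> Cod C g = D"
  using flat_map_props[of f "Dom C f" "Cod C f" g "Dom C g" "Cod C g"] assms by (auto simp: elts_def)

lemma flat_ker_flat_map [simp]:
  assumes "f \<in> Arr C" "g \<in> Arr C" "Cod C f = A" "Cod C g = B"
  shows "flat_ker C A B \<cdot> flat_map C f g = coprod_map C f g \<cdot> flat_ker C (Dom C f) (Dom C g)"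
    "x \<in> elts C (Dom C f \<flat> Dom C g) \<Longrightarrow>
      flat_ker C A B \<cdot> flat_map C f g \<cdot> x = coprod_map C f g \<cdot> flat_ker C (Dom C f) (Dom C g) \<cdot> x"
proof -
  have Ob: "A \<in> Ob C" "B \<in> Ob C" using assms by auto
  show 1: "flat_ker C A B \<cdot> flat_map C f g = coprod_map C f g \<cdot> flat_ker C (Dom C f) (Dom C g)"
    using flat_map_props[of f "Dom C f" A g "Dom C g" B] assms by (simp add: eltsI)
  show "x \<in> elts C (Dom C f \<flat> Dom C g) \<Longrightarrow>
      flat_ker C A B \<cdot> flat_map C f g \<cdot> x = coprod_map C f g \<cdot> flat_ker C (Dom C f) (Dom C g) \<cdot> x"
    using el[OF 1, of x] assms Ob by simp
qed

lemma flat_map_comp [simp]: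
  assumes "f \<in> Arr C" "g \<in> Arr C" "a \<in> Arr C" "b \<in> Arr C" "Cod C f = Dom C a" "Cod C g = Dom C b"
  shows "flat_map C a b \<cdot> flat_map C f g = flat_map C (a \<cdot> f) (b \<cdot> g)"
    "x \<in> elts C (Dom C f \<flat> Dom C g) \<Longrightarrow>
      flat_map C a b \<cdot> flat_map C f g \<cdot> x = flat_map C (a \<cdot> f) (b \<cdot> g) \<cdot> x"
proof -
  have e: "f \<in> elts C (Dom C a)" "g \<in> elts C (Dom C b)" using assms by (simp_all add: eltsI)
  show 1: "flat_map C a b \<cdot> flat_map C f g = flat_map C (a \<cdot> f) (b \<cdot> g)"
    by (rule flat_eqI[of _ "Dom C f \<flat> Dom C g" "Cod C a" "Cod C b"]) (use assms e in simp_all)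
  show "x \<in> elts C (Dom C f \<flat> Dom C g) \<Longrightarrow>
      flat_map C a b \<cdot> flat_map C f g \<cdot> x = flat_map C (a \<cdot> f) (b \<cdot> g) \<cdot> x"
    using el[OF 1, of x] assms by simp
qed

section \<open>Unit and multiplication of the monad\<close>

lemma flat_unit_props:
  assumes "A \<in> Ob C" "B \<in> Ob C"
  shows "flat_unit C A B \<in> hom C B (A \<flat> B) \<and> flat_ker C A B \<cdot> flat_unit C A B = in2 C A B"
proof -
  have "\<exists>w \<in> hom C B (A \<flat> B). flat_ker C A B \<cdot> w = in2 C A B"
    using assms by (intro flat_lift) simp_all
  then have *: "\<exists>w. w \<in> hom C B (A \<flat> B) \<and> flat_ker C A B \<cdot> w = in2 C A B"
    by blast
  show ?thesis
    using the_lift[OF _ _ *] assms unfolding flat_unit_def by simp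
qed

lemma flat_unit_simps [simp]:
  assumes "A \<in> Ob C" "B \<in> Ob C"
  shows "flat_unit C A B \<in> Arr C" "Dom C (flat_unit C A B) = B" "Cod C (flat_unit C A B) = A \<flat> B"
    "flat_unit C A B \<in> elts C D \<longleftrightarrow> A \<flat> B = D"
    "flat_ker C A B \<cdot> flat_unit C A B = in2 C A B"
    "x \<in> elts C B \<Longrightarrow> flat_ker C A B \<cdot> flat_unit C A B \<cdot> x = in2 C A B \<cdot> x"
proof -
  note * = flat_unit_props[OF assms]
  then show "flat_unit C A B \<in> Arr C" "Dom C (flat_unit C A B) = B" "Cod C (flat_unit C A B) = A \<flat> B"
    "flat_unit C A B \<in> elts C D \<longleftrightarrow> A \<flat> B = D" and 1: "flat_ker C A B \<cdot> flat_unit C A B = in2 C A B"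
    by (auto simp: elts_def)
  show "x \<in> elts C B \<Longrightarrow> flat_ker C A B \<cdot> flat_unit C A B \<cdot> x = in2 C A B \<cdot> x"
    using el[OF 1, of x] assms * by simp
qed

lemma flat_mult_props:
  assumes "A \<in> Ob C" "B \<in> Ob C"
  shows "flat_mult C A B \<in> hom C (A \<flat> A \<flat> B) (A \<flat> B) \<and>
    flat_ker C A B \<cdot> flat_mult C A B = copair C (in1 C A B) (flat_ker C A B) \<cdot> flat_ker C A (A \<flat> B)"
proof -
  have "\<exists>w \<in> hom C (A \<flat> A \<flat> B) (A \<flat> B).
      flat_ker C A B \<cdot> w = copair C (in1 C A B) (flat_ker C A B) \<cdot> flat_ker C A (A \<flat> B)"
    using assms by (intro flat_lift) (simp_all add: comp_copair)
  then have *: "\<exists>w. w \<in> hom C (A \<flat> A \<flat> B) (A \<flat> B) \<and>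
      flat_ker C A B \<cdot> w = copair C (in1 C A B) (flat_ker C A B) \<cdot> flat_ker C A (A \<flat> B)"
    by blast
  show ?thesis
    using the_lift[OF _ _ *] assms unfolding flat_mult_def by simp
qed

lemma flat_mult_simps [simp]:
  assumes "A \<in> Ob C" "B \<in> Ob C"
  shows "flat_mult C A B \<in> Arr C" "Dom C (flat_mult C A B) = A \<flat> A \<flat> B"
    "Cod C (flat_mult C A B) = A \<flat> B" "flat_mult C A B \<in> elts C D \<longleftrightarrow> A \<flat> B = D"
    "flat_ker C A B \<cdot> flat_mult C A B = copair C (in1 C A B) (flat_ker C A B) \<cdot> flat_ker C A (A \<flat> B)"
    "x \<in> elts C (A \<flat> A \<flat> B) \<Longrightarrow> flat_ker C A B \<cdot> flat_mult C A B \<cdot> x =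
      copair C (in1 C A B) (flat_ker C A B) \<cdot> flat_ker C A (A \<flat> B) \<cdot> x"
proof -
  note * = flat_mult_props[OF assms]
  then show "flat_mult C A B \<in> Arr C" "Dom C (flat_mult C A B) = A \<flat> A \<flat> B"
    "Cod C (flat_mult C A B) = A \<flat> B" "flat_mult C A B \<in> elts C D \<longleftrightarrow> A \<flat> B = D"
    and 1: "flat_ker C A B \<cdot> flat_mult C A B =
      copair C (in1 C A B) (flat_ker C A B) \<cdot> flat_ker C A (A \<flat> B)"
    by (auto simp: elts_def)
  show "x \<in> elts C (A \<flat> A \<flat> B) \<Longrightarrow> flat_ker C A B \<cdot> flat_mult C A B \<cdot> x =
      copair C (in1 C A B) (flat_ker C A B) \<cdot> flat_ker C A (A \<flat> B) \<cdot> x"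
    using el[OF 1, of x] assms * by simp
qed

lemma flat_mult_natural:
  assumes "f \<in> hom C A A'" "g \<in> hom C B B'"
  shows "flat_map C f g \<cdot> flat_mult C A B = flat_mult C A' B' \<cdot> flat_map C f (flat_map C f g)"
proof -
  have h: "f \<in> Arr C" "Dom C f = A" "Cod C f = A'" "g \<in> Arr C" "Dom C g = B" "Cod C g = B'"
    "f \<in> elts C A'" "g \<in> elts C B'" "A \<in> Ob C" "A' \<in> Ob C" "B \<in> Ob C" "B' \<in> Ob C"
    using assms by auto
  show ?thesis
    by (rule flat_eqI[of _ "A \<flat> A \<flat> B" A' B']) (use h in \<open>simp_all add: comp_copair\<close>)
qed

lemma flat_unit_natural:
  assumes "f \<in> hom C A A'" "g \<in> hom C B B'"
  shows "flat_map C f g \<cdot> flat_unit C A B = flat_unit C A' B' \<cdot> g"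
proof -
  have h: "f \<in> Arr C" "Dom C f = A" "Cod C f = A'" "g \<in> Arr C" "Dom C g = B" "Cod C g = B'"
    "f \<in> elts C A'" "g \<in> elts C B'" "A \<in> Ob C" "A' \<in> Ob C" "B \<in> Ob C" "B' \<in> Ob C"
    using assms by auto
  show ?thesis
    by (rule flat_eqI[of _ "B" A' B']) (use h in \<open>simp_all\<close>)
qed

text \<open>
  Protomodularity on elements: a morphism of points is an isomorphism if it is bijective on the
  elements lying over the image of some \<open>a : A \<rightarrow> B\<close>.  Hence a point is generated by its section and
  these elements (\<open>point_factor\<close>); for \<open>a = 0\<close> they form the kernel.
\<close>

lemma point_iso:
  assumes pt: "is_point C B E p s" "is_point C B E' p' s'"
    and h: "h \<in> hom C E E'" "p' \<cdot> h = p" "h \<cdot> s = s'" and a: "a \<in> hom C A B"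
    and ex: "\<And>D x' y. x' \<in> hom C D E' \<Longrightarrow> y \<in> hom C D A \<Longrightarrow> p' \<cdot> x' = a \<cdot> y \<Longrightarrow> \<exists>x \<in> hom C D E. h \<cdot> x = x'"
    and uniq: "\<And>D x y z. x \<in> hom C D E \<Longrightarrow> y \<in> hom C D E \<Longrightarrow> z \<in> hom C D A \<Longrightarrow> p \<cdot> x = a \<cdot> z \<Longrightarrow>
      h \<cdot> x = h \<cdot> y \<Longrightarrow> x = y"
  shows "is_iso C E E' h"
proof -
  have ps: "p \<in> hom C E B" "p' \<in> hom C E' B" using pt unfolding is_point_def by auto
  obtain P a1 b1 where P: "is_pullback C p a P a1 b1" using pullback_ex ps a by blast
  obtain P' a2 b2 where P': "is_pullback C p' a P' a2 b2" using pullback_ex ps a by blast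
  note hs = h(1) a ps pullback_hom[OF P] pullback_hom[OF P']
  note eh = el[OF h(2)]
  have t: "a1 \<in> hom C P E" "b1 \<in> hom C P A" "a2 \<in> hom C P' E'" "b2 \<in> hom C P' A" using hs by simp_all
  have "p' \<cdot> h \<cdot> a1 = a \<cdot> b1" using hs eh[of a1] by simp
  moreover have "h \<cdot> a1 \<in> hom C P (Dom C p')" "b1 \<in> hom C P (Dom C a)" using hs by simp_all
  ultimately obtain k where k: "k \<in> hom C P P'" "a2 \<cdot> k = h \<cdot> a1" "b2 \<cdot> k = b1"
    using pullback_lift[OF P'] by metis
  \<comment> \<open>\<open>a2\<close> is the generic element of \<open>E'\<close> lying over
    \<open>a\<close>; its preimage under \<open>h\<close> induces the inverse of
    \<open>k\<close>.\<close>
  obtain x0 where x0: "x0 \<in> hom C P' E" "h \<cdot> x0 = a2"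
    using ex[OF t(3,4) pullback_hom(3)[OF P']] by blast
  have "p \<cdot> x0 = a \<cdot> b2" using eh[of x0] x0 hs by simp
  moreover have "x0 \<in> hom C P' (Dom C p)" "b2 \<in> hom C P' (Dom C a)" using hs x0 by simp_all
  ultimately obtain j where j: "j \<in> hom C P' P" "a1 \<cdot> j = x0" "b1 \<cdot> j = b2"
    using pullback_lift[OF P] by metis
  have kj: "k \<cdot> j = \<one> P'"
  proof (rule pullback_eqI[OF P', of _ P'])
    show "k \<cdot> j \<in> hom C P' P'" "\<one> P' \<in> hom C P' P'" using k j hs ident_hom[of P'] by auto
    have "a2 \<cdot> k \<cdot> j = (h \<cdot> a1) \<cdot> j" using el[OF k(2), of j] k j hs by simp
    then show "a2 \<cdot> k \<cdot> j = a2 \<cdot> \<one> P'" using x0 j t h(1) by simp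
    show "b2 \<cdot> k \<cdot> j = b2 \<cdot> \<one> P'" using el[OF k(3), of j] k j t by simp
  qed
  have "x0 \<cdot> k = a1"
  proof (rule uniq[of _ P _ b1])
    show "x0 \<cdot> k \<in> hom C P E" "a1 \<in> hom C P E" "b1 \<in> hom C P A" using x0 k t by simp_all
    show 1: "h \<cdot> x0 \<cdot> k = h \<cdot> a1" using el[OF x0(2), of k] k x0 h by simp
    show "p \<cdot> x0 \<cdot> k = a \<cdot> b1" using eh[of "x0 \<cdot> k"] 1 eh[of a1] x0 k hs by simp
  qed
  have jk: "j \<cdot> k = \<one> P"
  proof (rule pullback_eqI[OF P, of _ P])
    show "j \<cdot> k \<in> hom C P P" "\<one> P \<in> hom C P P" using k j hs ident_hom[of P] by auto
    show "a1 \<cdot> j \<cdot> k = a1 \<cdot> \<one> P" using el[OF j(2), of k] k j t \<open>x0 \<cdot> k = a1\<close> by simp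
    show "b1 \<cdot> j \<cdot> k = b1 \<cdot> \<one> P" using el[OF j(3), of k] k j t by simp
  qed
  have "is_iso C P P' k" unfolding is_iso_def using k(1) j(1) kj jk by blast
  with protomodular pt h a P P' k show ?thesis unfolding protomodular_def by blast
qed

lemma point_factor:
  assumes pt: "is_point C B E p s" and a: "a \<in> hom C A B" and t: "t \<in> hom C E Z"
    and j: "j \<in> hom C J Z" "monic C j" and s0: "s0 \<in> hom C B J" "j \<cdot> s0 = t \<cdot> s"
    and lift: "\<And>D x y. x \<in> hom C D E \<Longrightarrow> y \<in> hom C D A \<Longrightarrow> p \<cdot> x = a \<cdot> y \<Longrightarrow> \<exists>w \<in> hom C D J. j \<cdot> w = t \<cdot> x"
  shows "\<exists>w \<in> hom C E J. j \<cdot> w = t"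
proof -
  have ps: "p \<in> hom C E B" "s \<in> hom C B E" "p \<cdot> s = \<one> B" using pt unfolding is_point_def by auto
  \<comment> \<open>The inverse image of \<open>J\<close> along \<open>t\<close> contains the
    section, by \<open>s0\<close>, and all elements over \<open>a\<close>, by \<open>lift\<close>;
    \<open>point_iso\<close> shows that it is all of \<open>E\<close>.\<close>
  obtain T m n where T: "is_pullback C t j T m n" using pullback_ex t j by blast
  note hs = pullback_hom[OF T]
  have mn: "m \<in> hom C T E" "n \<in> hom C T J" using hs t j by simp_all
  have "s \<in> hom C B (Dom C t)" "s0 \<in> hom C B (Dom C j)" using ps t j s0 by simp_all
  then obtain s' where s': "s' \<in> hom C B T" "m \<cdot> s' = s" "n \<cdot> s' = s0"
    using pullback_lift[OF T _ _ s0(2)[symmetric]] by metis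
  have pt': "is_point C B T (p \<cdot> m) s'"
    unfolding is_point_def using ps mn s' by simp
  have "is_iso C T E m"
  proof (rule point_iso[OF pt' pt mn(1) refl s'(2) a])
    fix D x y assume x: "x \<in> hom C D E" "y \<in> hom C D A" "p \<cdot> x = a \<cdot> y"
    obtain w where w: "w \<in> hom C D J" "j \<cdot> w = t \<cdot> x" using lift[OF x] by blast
    have "x \<in> hom C D (Dom C t)" "w \<in> hom C D (Dom C j)" using x w j t by simp_all
    then show "\<exists>z \<in> hom C D T. m \<cdot> z = x"
      using pullback_lift[OF T _ _ w(2)[symmetric]] by metis
  next
    fix D x y z assume xy: "x \<in> hom C D T" "y \<in> hom C D T" and m: "m \<cdot> x = m \<cdot> y"
    have "j \<cdot> n \<cdot> x = j \<cdot> n \<cdot> y"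
      using el[OF hs(3), of x] el[OF hs(3), of y] xy mn t j m by simp
    then have "n \<cdot> x = n \<cdot> y"
      using monicD[OF j(2), of "n \<cdot> x" D "n \<cdot> y"] xy mn j by simp
    then show "x = y" using pullback_eqI[OF T xy m] by blast
  qed
  then obtain i where i: "i \<in> hom C E T" "m \<cdot> i = \<one> E" unfolding is_iso_def by blast
  have "j \<cdot> n \<cdot> i = t"
    using el[OF hs(3), of i] i mn t j by simp
  moreover have "n \<cdot> i \<in> hom C E J" using mn i by simp
  ultimately show ?thesis by blast
qed

lemma point_iso_kernel:
  assumes pt: "is_point C B E p s" "is_point C B E' p' s'"
    and h: "h \<in> hom C E E'" "p' \<cdot> h = p" "h \<cdot> s = s'"
    and ex: "\<And>D x'. x' \<in> hom C D E' \<Longrightarrow> p' \<cdot> x' = zero C D B \<Longrightarrow> \<exists>x \<in> hom C D E. h \<cdot> x = x'"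
    and uniq: "\<And>D x y. x \<in> hom C D E \<Longrightarrow> y \<in> hom C D E \<Longrightarrow> p \<cdot> x = zero C D B \<Longrightarrow>
      p \<cdot> y = zero C D B \<Longrightarrow> h \<cdot> x = h \<cdot> y \<Longrightarrow> x = y"
  shows "is_iso C E E' h"
proof -
  have ps: "p \<in> hom C E B" "p' \<in> hom C E' B" using pt unfolding is_point_def by auto
  obtain Z where "is_zero_object C Z" using pointed by blast
  then have Z: "Z \<in> Ob C" unfolding is_zero_object_def is_initial_def by blast
  have B: "B \<in> Ob C" using hom_Ob ps by blast
  have a: "zero C Z B \<in> hom C Z B" using Z B by simp
  have az: "zero C Z B \<cdot> z = zero C D B" if "z \<in> hom C D Z" for D z
    using that B by simp
  note eh = el[OF h(2)]
  show ?thesis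
  proof (rule point_iso[OF pt h a])
    fix D x y assume "x \<in> hom C D E'" "y \<in> hom C D Z" "p' \<cdot> x = zero C Z B \<cdot> y"
    then show "\<exists>x' \<in> hom C D E. h \<cdot> x' = x" using ex az by metis
  next
    fix D x y z assume x: "x \<in> hom C D E" "y \<in> hom C D E" "z \<in> hom C D Z"
      "p \<cdot> x = zero C Z B \<cdot> z" "h \<cdot> x = h \<cdot> y"
    moreover have "p \<cdot> y = p \<cdot> x" using eh[of x] eh[of y] x ps h by simp
    ultimately show "x = y" using uniq[of x D y] az[of z D] by metis
  qed
qed

lemma point_factor_kernel:
  assumes pt: "is_point C B E p s" and t: "t \<in> hom C E Z"
    and j: "j \<in> hom C J Z" "monic C j" and s0: "s0 \<in> hom C B J" "j \<cdot> s0 = t \<cdot> s"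
    and lift: "\<And>D x. x \<in> hom C D E \<Longrightarrow> p \<cdot> x = zero C D B \<Longrightarrow> \<exists>w \<in> hom C D J. j \<cdot> w = t \<cdot> x"
  shows "\<exists>w \<in> hom C E J. j \<cdot> w = t"
proof -
  have ps: "p \<in> hom C E B" using pt unfolding is_point_def by auto
  obtain Z where "is_zero_object C Z" using pointed by blast
  then have Z: "Z \<in> Ob C" unfolding is_zero_object_def is_initial_def by blast
  have B: "B \<in> Ob C" using hom_Ob ps by blast
  have a: "zero C Z B \<in> hom C Z B" using Z B by simp
  show ?thesis
  proof (rule point_factor[OF pt a t j s0])
    fix D x y assume x: "x \<in> hom C D E" "y \<in> hom C D Z" "p \<cdot> x = zero C Z B \<cdot> y"
    then have "p \<cdot> x = zero C D B" using B by simp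
    then show "\<exists>w \<in> hom C D J. j \<cdot> w = t \<cdot> x" using lift x by blast
  qed
qed

text \<open>\<open>f = g\<close> means that \<open>(f, g)\<close> factors through the diagonal of
  \<open>Z\<close>. The diagonal is monic, so \<open>point_factor_kernel\<close> applies: section
  and kernel of a point are jointly epic.\<close>

lemma point_eqI:
  assumes pt: "is_point C B E p s" and fg: "f \<in> hom C E Z" "g \<in> hom C E Z" "f \<cdot> s = g \<cdot> s"
    and ker: "\<And>D x. x \<in> hom C D E \<Longrightarrow> p \<cdot> x = zero C D B \<Longrightarrow> f \<cdot> x = g \<cdot> x"
  shows "f = g"
proof -
  have ps: "p \<in> hom C E B" "s \<in> hom C B E" using pt unfolding is_point_def by auto
  have Z: "Z \<in> Ob C" using hom_Ob fg by blast
  let ?d = "pair C (\<one> Z) (\<one> Z)"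
  have d: "?d \<in> hom C Z (prod_ob C Z Z)" "monic C ?d"
  proof -
    show d: "?d \<in> hom C Z (prod_ob C Z Z)" using Z by simp
    show "monic C ?d"
    proof (rule monicI[OF d])
      fix D x y assume xy: "x \<in> hom C D Z" "y \<in> hom C D Z" "?d \<cdot> x = ?d \<cdot> y"
      then have "pair C x x = pair C y y" using Z by simp
      then show "x = y" using pair_inject(1) xy by blast
    qed
  qed
  have "pair C f g \<in> hom C E (prod_ob C Z Z)" using fg by simp
  moreover have "f \<cdot> s \<in> hom C B Z" using fg ps by simp
  moreover have "?d \<cdot> f \<cdot> s = pair C f g \<cdot> s" using fg ps Z by simp
  moreover have "\<exists>w \<in> hom C D Z. ?d \<cdot> w = pair C f g \<cdot> x" if x: "x \<in> hom C D E" "p \<cdot> x = zero C D B" for D x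
  proof
    show "f \<cdot> x \<in> hom C D Z" using x fg by simp
    show "?d \<cdot> f \<cdot> x = pair C f g \<cdot> x" using ker[OF x] fg x Z by simp
  qed
  ultimately obtain w where w: "w \<in> hom C E Z" "?d \<cdot> w = pair C f g"
    using point_factor_kernel[OF pt _ d] by metis
  then have "pair C w w = pair C f g" using Z by simp
  then show "f = g" using pair_inject w fg by metis
qed

text \<open>The kernel pair of \<open>f\<close> is a point over \<open>A\<close> by
  \<open>r1\<close>, with the diagonal as section, and the kernel of \<open>r1\<close> consists of
  the pairs \<open>(0, x)\<close> with \<open>f x = 0\<close>. So \<open>r1\<close> and
  \<open>r2\<close> agree on section and kernel.\<close>

lemma monic_if_trivial_kernel:
  assumes f: "f \<in> hom C A B"
    and ker: "\<And>D x. x \<in> hom C D A \<Longrightarrow> f \<cdot> x = zero C D B \<Longrightarrow> x = zero C D A"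
  shows "monic C f"
proof (rule monicI[OF f])
  obtain R r1 r2 where R: "is_pullback C f f R r1 r2" using pullback_ex f by blast
  note hs = pullback_hom[OF R]
  have A: "A \<in> Ob C" "B \<in> Ob C" using hom_Ob f by auto
  have r: "r1 \<in> hom C R A" "r2 \<in> hom C R A" using hs f by simp_all
  have "\<one> A \<in> hom C A (Dom C f)" using f A by simp
  then obtain e where e: "e \<in> hom C A R" "r1 \<cdot> e = \<one> A" "r2 \<cdot> e = \<one> A"
    using pullback_lift[OF R] by blast
  have pt: "is_point C A R r1 e" unfolding is_point_def using r e by blast
  have "r1 = r2"
  proof (rule point_eqI[OF pt r])
    show "r1 \<cdot> e = r2 \<cdot> e" using e by simp
    fix D x assume x: "x \<in> hom C D R" "r1 \<cdot> x = zero C D A"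
    have D: "D \<in> Ob C" using hom_Ob x by blast
    have "f \<cdot> r2 \<cdot> x = zero C D B" using el[OF hs(3), of x] x r f D by simp
    then show "r1 \<cdot> x = r2 \<cdot> x" using ker[of "r2 \<cdot> x" D] x r by simp
  qed
  fix D x y assume xy: "x \<in> hom C D A" "y \<in> hom C D A" "f \<cdot> x = f \<cdot> y"
  have "x \<in> hom C D (Dom C f)" "y \<in> hom C D (Dom C f)" using xy f by simp_all
  then obtain z where "r1 \<cdot> z = x" "r2 \<cdot> z = y"
    using pullback_lift[OF R _ _ xy(3)] by metis
  then show "x = y" using \<open>r1 = r2\<close> by simp
qed

section \<open>Regular epimorphisms and reflexive coequalizers\<close>

lemma coequalizer_simps:
  assumes "is_coequalizer C f g Q q"
  shows "q \<in> hom C (Cod C f) Q" "q \<cdot> f = q \<cdot> g" "f \<in> Arr C" "g \<in> Arr C" "Dom C g = Dom C f"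
    "Cod C g = Cod C f"
  using assms unfolding is_coequalizer_def by auto

lemma coequalizer_lift:
  assumes "is_coequalizer C f g Q q" "h \<in> hom C (Cod C f) D" "h \<cdot> f = h \<cdot> g"
  obtains u where "u \<in> hom C Q D" "u \<cdot> q = h"
  using assms unfolding is_coequalizer_def by blast

lemma coequalizer_epi:
  assumes co: "is_coequalizer C f g Q q" and u: "u \<in> hom C Q D" "v \<in> hom C Q D" "u \<cdot> q = v \<cdot> q"
  shows "u = v"
proof -
  note q = coequalizer_simps[OF co]
  have "u \<cdot> q \<in> hom C (Cod C f) D" "(u \<cdot> q) \<cdot> f = (u \<cdot> q) \<cdot> g" using u(1) q by (simp_all add: eltsI)
  then have "\<exists>!w. w \<in> hom C Q D \<and> w \<cdot> q = u \<cdot> q" using co unfolding is_coequalizer_def by blast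
  then show ?thesis using u by metis
qed

lemma is_coequalizerI:
  assumes "f \<in> hom C A B" "g \<in> hom C A B" "q \<in> hom C B Q" "q \<cdot> f = q \<cdot> g"
    and ex: "\<And>D h. h \<in> hom C B D \<Longrightarrow> h \<cdot> f = h \<cdot> g \<Longrightarrow> \<exists>u \<in> hom C Q D. u \<cdot> q = h"
    and uniq: "\<And>D u v. u \<in> hom C Q D \<Longrightarrow> v \<in> hom C Q D \<Longrightarrow> u \<cdot> q = v \<cdot> q \<Longrightarrow> u = v"
  shows "is_coequalizer C f g Q q"
proof -
  have "\<exists>!u. u \<in> hom C Q D \<and> u \<cdot> q = h" if "h \<in> hom C B D" "h \<cdot> f = h \<cdot> g" for D h
    using ex[OF that] uniq by metis
  moreover have "f \<in> Arr C" "g \<in> Arr C" "Dom C f = A" "Dom C g = A" "Cod C f = B" "Cod C g = B"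
    using assms by simp_all
  ultimately show ?thesis unfolding is_coequalizer_def using assms(3,4) by metis
qed

lemma coequalizer_regular_epi: "is_coequalizer C f g Q q \<Longrightarrow> regular_epi C q"
  unfolding regular_epi_def using coequalizer_simps(1) by fastforce

lemma regular_epi_cancel:
  assumes "regular_epi C q" "u \<in> hom C (Cod C q) D" "v \<in> hom C (Cod C q) D" "u \<cdot> q = v \<cdot> q"
  shows "u = v"
  using assms coequalizer_epi unfolding regular_epi_def by blast

text \<open>The pair coequalized by \<open>q\<close> is itself a pair of elements identified by
  \<open>q\<close>; respecting all identifications is therefore enough, without naming the
  pair.\<close>

lemma regular_epi_factor:
  assumes q: "regular_epi C q" "q \<in> hom C A B" and h: "h \<in> hom C A Z"
    and eq: "\<And>D u v. u \<in> hom C D A \<Longrightarrow> v \<in> hom C D A \<Longrightarrow> q \<cdot> u = q \<cdot> v \<Longrightarrow> h \<cdot> u = h \<cdot> v"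
  shows "\<exists>w \<in> hom C B Z. w \<cdot> q = h"
proof -
  obtain f g where co: "is_coequalizer C f g (Cod C q) q" using q unfolding regular_epi_def by blast
  note s = coequalizer_simps[OF co]
  have fg: "f \<in> hom C (Dom C f) A" "g \<in> hom C (Dom C f) A" using s q by (auto simp: elts_def)
  have "h \<cdot> f = h \<cdot> g" using eq[OF fg s(2)] .
  moreover have "h \<in> hom C (Cod C f) Z" using fg h by simp
  ultimately show ?thesis using coequalizer_lift[OF co] q by (metis hom_iff)
qed

text \<open>Regular epimorphisms are strong. This is descent for subobjects: an element lies in
  \<open>J\<close> as soon as it does so after a cover.\<close>

lemma regular_epi_lift:
  assumes q: "regular_epi C q" "q \<in> hom C A B" and m: "monic C m" "m \<in> hom C J Z"
    and b: "b \<in> hom C B Z" and a: "a \<in> hom C A J" and eq: "m \<cdot> a = b \<cdot> q"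
  shows "\<exists>w \<in> hom C B J. m \<cdot> w = b"
proof -
  note e = el[OF eq]
  have "\<exists>w \<in> hom C B J. w \<cdot> q = a"
  proof (rule regular_epi_factor[OF q a])
    fix D u v assume uv: "u \<in> hom C D A" "v \<in> hom C D A" "q \<cdot> u = q \<cdot> v"
    have "m \<cdot> a \<cdot> u = m \<cdot> a \<cdot> v" using e[of u] e[of v] uv m(2) a b q by simp
    then show "a \<cdot> u = a \<cdot> v" using monicD[OF m(1), of "a \<cdot> u" D "a \<cdot> v"] uv a m(2) by simp
  qed
  then obtain w where w: "w \<in> hom C B J" "w \<cdot> q = a" by blast
  have "m \<cdot> w = b"
  proof (rule regular_epi_cancel[OF q(1)])
    show "(m \<cdot> w) \<cdot> q = b \<cdot> q" using w q m eq by simp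
    show "m \<cdot> w \<in> hom C (Cod C q) Z" "b \<in> hom C (Cod C q) Z" using w q(2) m b by simp_all
  qed
  with w show ?thesis by blast
qed

lemma regular_epi_cover:
  assumes "regular_epi C q" "q \<in> hom C A B" "u \<in> hom C D B"
  obtains D' r w where "regular_epi C r" "r \<in> hom C D' D" "w \<in> hom C D' A" "q \<cdot> w = u \<cdot> r"
proof -
  obtain P p r where P: "is_pullback C q u P p r" using pullback_ex assms by blast
  then show ?thesis
    using that[of r P p] regular_epi_stable[OF P assms(1)] pullback_hom[OF P] assms by simp
qed

text \<open>\<open>e\<close> is the coequalizer of the kernel pair of \<open>f\<close>. Elements of
  \<open>I\<close> with equal value under \<open>m\<close> lift along \<open>e\<close> locally; the
  lifts form an element of the kernel pair, so \<open>e\<close> identifies them, and the covers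
  cancel.\<close>

lemma image_ex:
  assumes f: "f \<in> hom C A B"
  obtains I e m where "regular_epi C e" "e \<in> hom C A I" "monic C m" "m \<in> hom C I B" "m \<cdot> e = f"
proof -
  obtain R r1 r2 where R: "is_pullback C f f R r1 r2" using pullback_ex f by blast
  obtain I e where co: "is_coequalizer C r1 r2 I e" using kernel_pair_coequalizer[OF R] by blast
  note hs = pullback_hom[OF R]
  have e: "e \<in> hom C A I" using coequalizer_simps[OF co] hs f by simp
  have re: "regular_epi C e" using coequalizer_regular_epi[OF co] .
  obtain m where m: "m \<in> hom C I B" "m \<cdot> e = f"
    using coequalizer_lift[OF co, of f B] hs f by auto
  have "monic C m"
  proof (rule monicI[OF m(1)])
    fix D x y assume xy: "x \<in> hom C D I" "y \<in> hom C D I" "m \<cdot> x = m \<cdot> y"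
    obtain D1 r a where r: "regular_epi C r" "r \<in> hom C D1 D" "a \<in> hom C D1 A" "e \<cdot> a = x \<cdot> r"
      using regular_epi_cover[OF re e xy(1)] .
    \<comment> \<open>\<open>y\<close> is lifted over the cover already used for \<open>x\<close>,
      so that both lifts get a common domain.\<close>
    have "y \<cdot> r \<in> hom C D1 I" using xy r by simp
    then obtain D2 r' b where r': "regular_epi C r'" "r' \<in> hom C D2 D1" "b \<in> hom C D2 A" "e \<cdot> b = (y \<cdot> r) \<cdot> r'"
      using regular_epi_cover[OF re e] by metis
    note me = el[OF m(2)]
    have "f \<cdot> a \<cdot> r' = m \<cdot> e \<cdot> a \<cdot> r'" using me[of "a \<cdot> r'"] r r' e m by simp
    also have "\<dots> = m \<cdot> x \<cdot> r \<cdot> r'" using el[OF r(4), of r'] r r' e xy by simp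
    also have "\<dots> = m \<cdot> y \<cdot> r \<cdot> r'" using el[OF xy(3), of "r \<cdot> r'"] r r' xy m el[OF refl, of m y "r \<cdot> r'"] by simp
    also have "\<dots> = f \<cdot> b" using me[of b] r r' e xy m by simp
    finally have fe: "f \<cdot> a \<cdot> r' = f \<cdot> b" .
    have ab: "a \<cdot> r' \<in> hom C D2 (Dom C f)" "b \<in> hom C D2 (Dom C f)" using r r' f by simp_all
    obtain w where w: "w \<in> hom C D2 R" "r1 \<cdot> w = a \<cdot> r'" "r2 \<cdot> w = b"
      using pullback_lift[OF R ab fe] by blast
    have e': "e \<cdot> r1 \<cdot> w = e \<cdot> r2 \<cdot> w"
      using el[OF coequalizer_simps(2)[OF co], of w] w hs f e by simp
    have "(x \<cdot> r) \<cdot> r' = (y \<cdot> r) \<cdot> r'"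
      using e' w r'(4) el[OF r(4), of r'] r r' e by simp
    then have "x \<cdot> r = y \<cdot> r"
      using regular_epi_cancel[OF r'(1), of "x \<cdot> r" I "y \<cdot> r"] r r' xy by simp
    then show "x = y"
      using regular_epi_cancel[OF r(1), of x I y] r xy by simp
  qed
  with that re e m show ?thesis by blast
qed

text \<open>The image of \<open>h\<close> contains that of the cover \<open>r\<close>, hence is all
  of \<open>B\<close>, and the monic part of the factorisation is invertible. Applied to generic
  elements, this turns local existence of preimages into regularity.\<close>

lemma regular_epi_if_covers:
  assumes h: "h \<in> hom C A B" and r: "regular_epi C r" "r \<in> hom C D B" "w \<in> hom C D A" "h \<cdot> w = r"
  shows "regular_epi C h"
proof -
  obtain I e m where m: "regular_epi C e" "e \<in> hom C A I" "monic C m" "m \<in> hom C I B" "m \<cdot> e = h"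
    using image_ex[OF h] .
  have B: "B \<in> Ob C" using hom_Ob h by blast
  have "m \<cdot> e \<cdot> w = \<one> B \<cdot> r" using el[OF m(5), of w] m r B by simp
  moreover have "e \<cdot> w \<in> hom C D I" using m r by simp
  moreover have "\<one> B \<in> hom C B B" using ident_hom B by blast
  ultimately obtain n where n: "n \<in> hom C B I" "m \<cdot> n = \<one> B"
    using regular_epi_lift[OF r(1,2) m(3,4)] by blast
  have nm: "n \<cdot> m = \<one> I"
    using monicD[OF m(3), of "n \<cdot> m" I "\<one> I"] n m(4) el[OF n(2), of m] by auto
  obtain f g where co: "is_coequalizer C f g I e"
    using m(1,2) unfolding regular_epi_def by auto
  note s = coequalizer_simps[OF co]
  have ns: "e \<cdot> a = n \<cdot> h \<cdot> a" if "a \<in> hom C D A" for a D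
    using el[OF m(5), of a] el[OF nm, of "e \<cdot> a"] that m n hom_Ob(2)[OF m(2)] by simp
  have "e \<cdot> \<one> A = n \<cdot> h \<cdot> \<one> A" using ns hom_Ob[OF h] ident_hom by blast
  then have nh: "n \<cdot> h = e" using m(2) h by auto
  have "is_coequalizer C f g B h"
  proof (rule is_coequalizerI[of _ "Dom C f" A])
    show fg: "f \<in> hom C (Dom C f) A" "g \<in> hom C (Dom C f) A" using s m(2) by (auto simp: elts_def)
    show "h \<in> hom C A B" by fact
    show "h \<cdot> f = h \<cdot> g" using el[OF m(5), of f] el[OF m(5), of g] s(2) fg m by simp
    fix D k assume k: "k \<in> hom C A D" "k \<cdot> f = k \<cdot> g"
    have "k \<in> hom C (Cod C f) D" using k(1) fg by simp
    then obtain u where u: "u \<in> hom C I D" "u \<cdot> e = k" using coequalizer_lift[OF co _ k(2)] by blast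
    have "(u \<cdot> n) \<cdot> h = k" using u n h nh by simp
    moreover have "u \<cdot> n \<in> hom C B D" using u n by simp
    ultimately show "\<exists>u \<in> hom C B D. u \<cdot> h = k" by blast
  next
    fix D u v assume u: "u \<in> hom C B D" "v \<in> hom C B D" "u \<cdot> h = v \<cdot> h"
    have "(u \<cdot> m) \<cdot> e = (v \<cdot> m) \<cdot> e" using u m by simp
    then have "u \<cdot> m = v \<cdot> m"
      using coequalizer_epi[OF co, of "u \<cdot> m" D "v \<cdot> m"] u m by simp
    then have "(u \<cdot> m) \<cdot> n = (v \<cdot> m) \<cdot> n" by simp
    then show "u = v" using u m n by simp
  qed
  then show ?thesis by (rule coequalizer_regular_epi)
qed

lemma monic_pair:
  assumes "jointly_monic C R r1 r2" "r1 \<in> hom C R X" "r2 \<in> hom C R Y"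
  shows "monic C (pair C r1 r2)"
proof (rule monicI)
  show "pair C r1 r2 \<in> hom C R (prod_ob C X Y)" using assms by simp
  fix D x y assume xy: "x \<in> hom C D R" "y \<in> hom C D R" "pair C r1 r2 \<cdot> x = pair C r1 r2 \<cdot> y"
  have "pair C (r1 \<cdot> x) (r2 \<cdot> x) = pair C (r1 \<cdot> y) (r2 \<cdot> y)" using xy assms by simp
  moreover have "r1 \<cdot> x \<in> hom C D X" "r1 \<cdot> y \<in> hom C D X" "r2 \<cdot> x \<in> hom C D Y" "r2 \<cdot> y \<in> hom C D Y"
    using xy assms by simp_all
  ultimately have "r1 \<cdot> x = r1 \<cdot> y" "r2 \<cdot> x = r2 \<cdot> y" using pair_inject by metis+
  then show "x = y" using assms(1) xy unfolding jointly_monic_def by blast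
qed

text \<open>
  The object of triples \<open>(x, y, z)\<close> is a point over that of pairs \<open>(y, z)\<close>, with section
  \<open>(y, z) \<mapsto> (y, y, z)\<close>; the claim holds on the section and on the triples \<open>(x, y, y)\<close>, which
  generate.
\<close>

lemma difunctional:
  assumes jm: "jointly_monic C R r1 r2" and r: "r1 \<in> hom C R X" "r2 \<in> hom C R Y"
    and xyz: "x \<in> hom C D R" "y \<in> hom C D R" "z \<in> hom C D R" "r2 \<cdot> x = r2 \<cdot> y" "r1 \<cdot> y = r1 \<cdot> z"
  shows "\<exists>w \<in> hom C D R. r1 \<cdot> w = r1 \<cdot> x \<and> r2 \<cdot> w = r2 \<cdot> z"
proof -
  have R: "R \<in> Ob C" using hom_Ob r by blast
  \<comment> \<open>\<open>U\<close> consists of the pairs \<open>(x, y)\<close> with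
    \<open>r2 x = r2 y\<close>, \<open>V\<close> of the pairs \<open>(y, z)\<close> with
    \<open>r1 y = r1 z\<close>, and \<open>T\<close> of the triples.\<close>
  obtain U u1 u2 where U: "is_pullback C r2 r2 U u1 u2" using pullback_ex r by blast
  obtain V v1 v2 where V: "is_pullback C r1 r1 V v1 v2" using pullback_ex r by blast
  note hU = pullback_hom[OF U] and hV = pullback_hom[OF V]
  have u: "u1 \<in> hom C U R" "u2 \<in> hom C U R" and v: "v1 \<in> hom C V R" "v2 \<in> hom C V R"
    using hU hV r by simp_all
  obtain T t1 t2 where T: "is_pullback C u2 v1 T t1 t2" using pullback_ex u v by blast
  note hT = pullback_hom[OF T]
  have t: "t1 \<in> hom C T U" "t2 \<in> hom C T V" using hT u v by simp_all
  note eU = el[OF hU(3)] and eV = el[OF hV(3)] and eT = el[OF hT(3)]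
  have "\<one> R \<in> hom C R (Dom C r2)" "\<one> R \<in> hom C R (Dom C r1)" using r R by simp_all
  then obtain dU dV where dU: "dU \<in> hom C R U" "u1 \<cdot> dU = \<one> R" "u2 \<cdot> dU = \<one> R"
    and dV: "dV \<in> hom C R V" "v1 \<cdot> dV = \<one> R" "v2 \<cdot> dV = \<one> R"
    using pullback_lift[OF U] pullback_lift[OF V] by metis
  have V': "V \<in> Ob C" using hom_Ob v by blast
  have "dU \<cdot> v1 \<in> hom C V (Dom C u2)" "\<one> V \<in> hom C V (Dom C v1)" "u2 \<cdot> dU \<cdot> v1 = v1 \<cdot> \<one> V"
    using el[OF dU(3), of v1] dU(1) u v V' R by simp_all
  then obtain s where s: "s \<in> hom C V T" "t1 \<cdot> s = dU \<cdot> v1" "t2 \<cdot> s = \<one> V"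
    using pullback_lift[OF T] by metis
  have pt: "is_point C V T t2 s" unfolding is_point_def using t s by blast
  \<comment> \<open>\<open>?t\<close> sends a triple to \<open>(r1 x, r2 z)\<close>, which has to
    lie in \<open>R\<close>. On \<open>(y, y, z)\<close> the witness is \<open>z\<close>, because
    \<open>r1 y = r1 z\<close>; on \<open>(x, y, y)\<close>, the elements over \<open>dV\<close>, it
    is \<open>x\<close>, because \<open>r2 x = r2 y\<close>.\<close>
  let ?t = "pair C (r1 \<cdot> u1 \<cdot> t1) (r2 \<cdot> v2 \<cdot> t2)" and ?j = "pair C r1 r2"
  have "\<exists>w \<in> hom C T R. ?j \<cdot> w = ?t"
  proof (rule point_factor[OF pt dV(1)])
    show "?t \<in> hom C T (prod_ob C X Y)" using t u v r by simp
    show "?j \<in> hom C R (prod_ob C X Y)" using r by simp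
    show "monic C ?j" using monic_pair jm r by blast
    show "v2 \<in> hom C V R" by fact
    show "?j \<cdot> v2 = ?t \<cdot> s"
      using el[OF dU(2), of v1] hV(3) t u v r s V' R dU(1) by simp
    fix D x y assume x: "x \<in> hom C D T" "y \<in> hom C D R" "t2 \<cdot> x = dV \<cdot> y"
    have "r2 \<cdot> u1 \<cdot> t1 \<cdot> x = r2 \<cdot> u2 \<cdot> t1 \<cdot> x" using eU[of "t1 \<cdot> x"] t u x r by simp
    also have "\<dots> = r2 \<cdot> v1 \<cdot> dV \<cdot> y" using eT[of x] t u v x r by simp
    also have "\<dots> = r2 \<cdot> y" using el[OF dV(2), of y] dV(1) v x R by simp
    finally have "?j \<cdot> u1 \<cdot> t1 \<cdot> x = ?t \<cdot> x"
      using el[OF dV(3), of y] t u v x r R dV(1) by simp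
    moreover have "u1 \<cdot> t1 \<cdot> x \<in> hom C D R" using t u x by simp
    ultimately show "\<exists>w \<in> hom C D R. ?j \<cdot> w = ?t \<cdot> x" by blast
  qed
  then obtain w where w: "w \<in> hom C T R" "pair C (r1 \<cdot> w) (r2 \<cdot> w) = ?t" using r by auto
  have w': "r1 \<cdot> w = r1 \<cdot> u1 \<cdot> t1" "r2 \<cdot> w = r2 \<cdot> v2 \<cdot> t2"
    using pair_inject[OF w(2), of T X Y] w(1) t u v r by simp_all
  have "x \<in> hom C D (Dom C r2)" "y \<in> hom C D (Dom C r2)" "y \<in> hom C D (Dom C r1)" "z \<in> hom C D (Dom C r1)"
    using xyz r by simp_all
  then obtain a b where a: "a \<in> hom C D U" "u1 \<cdot> a = x" "u2 \<cdot> a = y"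
    and b: "b \<in> hom C D V" "v1 \<cdot> b = y" "v2 \<cdot> b = z"
    using pullback_lift[OF U] pullback_lift[OF V] xyz(4,5) by metis
  have "a \<in> hom C D (Dom C u2)" "b \<in> hom C D (Dom C v1)" "u2 \<cdot> a = v1 \<cdot> b" using a b u v by simp_all
  then obtain c where c: "c \<in> hom C D T" "t1 \<cdot> c = a" "t2 \<cdot> c = b" using pullback_lift[OF T] by metis
  have "r1 \<cdot> w \<cdot> c = r1 \<cdot> x" "r2 \<cdot> w \<cdot> c = r2 \<cdot> z"
    using el[OF w'(1), of c] el[OF w'(2), of c] w(1) c a b t u v r by simp_all
  moreover have "w \<cdot> c \<in> hom C D R" using w c by simp
  ultimately show ?thesis by blast
qed

text \<open>Symmetry is difunctionality at \<open>(b, b)\<close>, \<open>(a, b)\<close>,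
  \<open>(a, a)\<close>; transitivity is difunctionality at \<open>(a, b)\<close>,
  \<open>(b, b)\<close>, \<open>(b, c)\<close>.\<close>

lemma reflexive_relation_equivalence:
  assumes jm: "jointly_monic C R r1 r2" and r: "r1 \<in> hom C R X" "r2 \<in> hom C R X"
    and e: "e \<in> hom C X R" "r1 \<cdot> e = \<one> X" "r2 \<cdot> e = \<one> X"
  shows "equivalence_relation C X R r1 r2"
proof -
  have Ob: "X \<in> Ob C" "R \<in> Ob C" using hom_Ob r by auto
  note e1 = el[OF e(2)] and e2 = el[OF e(3)]
  have "\<exists>s \<in> hom C R R. r1 \<cdot> s = r1 \<cdot> e \<cdot> r2 \<and> r2 \<cdot> s = r2 \<cdot> e \<cdot> r1"
    by (rule difunctional[OF jm r, of _ _ "\<one> R"])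
      (use e1[of r1] e1[of r2] e2[of r1] e2[of r2] e(1) r Ob in simp_all)
  then have s: "\<exists>s \<in> hom C R R. r1 \<cdot> s = r2 \<and> r2 \<cdot> s = r1"
    using e1[of r2] e2[of r1] e(1) r Ob by simp
  have t: "\<exists>t \<in> hom C P R. r1 \<cdot> t = r1 \<cdot> p \<and> r2 \<cdot> t = r2 \<cdot> q" if pb: "is_pullback C r2 r1 P p q" for P p q
  proof -
    note h = pullback_hom[OF pb]
    have pq: "p \<in> hom C P R" "q \<in> hom C P R" using h r by simp_all
    show ?thesis
      by (rule difunctional[OF jm r, of _ _ "e \<cdot> r2 \<cdot> p"])
        (use e1[of "r2 \<cdot> p"] e2[of "r2 \<cdot> p"] e(1) r pq h(3) Ob in simp_all)
  qed
  show ?thesis unfolding equivalence_relation_def using jm r e s t by blast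
qed

text \<open>The image of \<open>(f, g)\<close> in \<open>B \<times> B\<close> is a relation,
  reflexive by \<open>e \<cdot> \<sigma>\<close>, hence an equivalence relation by the Mal'tsev
  property, hence a kernel pair by exactness.\<close>

lemma reflexive_pair_image:
  assumes fg: "f \<in> hom C S B" "g \<in> hom C S B" and \<sigma>: "\<sigma> \<in> hom C B S" "f \<cdot> \<sigma> = \<one> B" "g \<cdot> \<sigma> = \<one> B"
  obtains R e r1 r2 k where "regular_epi C e" "e \<in> hom C S R" "r1 \<in> hom C R B" "r2 \<in> hom C R B"
    "r1 \<cdot> e = f" "r2 \<cdot> e = g" "is_pullback C k k R r1 r2"
proof -
  have B: "B \<in> Ob C" using hom_Ob fg by blast
  have "pair C f g \<in> hom C S (prod_ob C B B)" using fg by simp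
  then obtain R e m where e: "regular_epi C e" "e \<in> hom C S R" and m: "monic C m"
    "m \<in> hom C R (prod_ob C B B)" "m \<cdot> e = pair C f g" using image_ex by metis
  define r1 r2 where r12: "r1 = proj1 C B B \<cdot> m" "r2 = proj2 C B B \<cdot> m"
  have r: "r1 \<in> hom C R B" "r2 \<in> hom C R B" using r12 m B by simp_all
  have re: "r1 \<cdot> e = f" "r2 \<cdot> e = g" using r12 m e B fg by simp_all
  have jm: "jointly_monic C R r1 r2"
    unfolding jointly_monic_def
  proof (intro allI ballI impI)
    fix D u v assume uv: "u \<in> hom C D R" "v \<in> hom C D R" "r1 \<cdot> u = r1 \<cdot> v \<and> r2 \<cdot> u = r2 \<cdot> v"
    have "m \<cdot> u = m \<cdot> v"
      by (rule prod_eqI[of _ D B B]) (use uv m(2) r12 B in simp_all)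
    then show "u = v" using monicD[OF m(1), of u D v] uv m(2) by simp
  qed
  have "r1 \<cdot> e \<cdot> \<sigma> = \<one> B" "r2 \<cdot> e \<cdot> \<sigma> = \<one> B"
    using el[OF re(1), of \<sigma>] el[OF re(2), of \<sigma>] r e \<sigma> by simp_all
  moreover have "e \<cdot> \<sigma> \<in> hom C B R" using e \<sigma> by simp
  ultimately have "equivalence_relation C B R r1 r2"
    using reflexive_relation_equivalence[OF jm r] by blast
  then obtain k where "is_pullback C k k R r1 r2"
    using equivalence_effective unfolding effective_def by blast
  with that e r re show ?thesis by blast
qed

text \<open>Regularity supplies coequalizers of kernel pairs. As \<open>e\<close> is epic,
  \<open>(f, g)\<close> and its image \<open>(r1, r2)\<close> are coequalized by the same
  arrows.\<close>

lemma reflexive_coequalizer_ex: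
  assumes fg: "f \<in> hom C S B" "g \<in> hom C S B" and \<sigma>: "\<sigma> \<in> hom C B S" "f \<cdot> \<sigma> = \<one> B" "g \<cdot> \<sigma> = \<one> B"
  obtains Q q where "is_coequalizer C f g Q q" "q \<in> hom C B Q"
proof -
  obtain R e r1 r2 k where e: "regular_epi C e" "e \<in> hom C S R" and r: "r1 \<in> hom C R B" "r2 \<in> hom C R B"
    and re: "r1 \<cdot> e = f" "r2 \<cdot> e = g" and k: "is_pullback C k k R r1 r2"
    using reflexive_pair_image[OF assms] .
  obtain Q q where co: "is_coequalizer C r1 r2 Q q" using kernel_pair_coequalizer[OF k] by blast
  note s = coequalizer_simps[OF co]
  have q: "q \<in> hom C B Q" using s(1) r by simp
  have "is_coequalizer C f g Q q"
  proof (rule is_coequalizerI[OF fg q])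
    have "(q \<cdot> r1) \<cdot> e = (q \<cdot> r2) \<cdot> e" using s(2) by simp
    then show "q \<cdot> f = q \<cdot> g" using re q r e by simp
    fix D h assume h: "h \<in> hom C B D" "h \<cdot> f = h \<cdot> g"
    have "(h \<cdot> r1) \<cdot> e = (h \<cdot> r2) \<cdot> e" using h re r e by simp
    then have "h \<cdot> r1 = h \<cdot> r2"
      using regular_epi_cancel[OF e(1), of "h \<cdot> r1" D "h \<cdot> r2"] h(1) r e by simp
    moreover have "h \<in> hom C (Cod C r1) D" using h r by simp
    ultimately show "\<exists>u \<in> hom C Q D. u \<cdot> q = h" using coequalizer_lift[OF co] by metis
  next
    fix D u v assume "u \<in> hom C Q D" "v \<in> hom C Q D" "u \<cdot> q = v \<cdot> q"
    then show "u = v" using coequalizer_epi[OF co] by blast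
  qed
  with that q show ?thesis by blast
qed

text \<open>The image of \<open>(f, g)\<close> is the kernel pair of some \<open>k\<close>, which
  factors through \<open>q\<close>. So elements identified by \<open>q\<close> are identified by
  \<open>k\<close>, lie in the image, and come from \<open>S\<close> after one cover: no zigzags
  occur.\<close>

lemma reflexive_coequalizer_kernel_pair:
  assumes fg: "f \<in> hom C S B" "g \<in> hom C S B" and \<sigma>: "\<sigma> \<in> hom C B S" "f \<cdot> \<sigma> = \<one> B" "g \<cdot> \<sigma> = \<one> B"
    and co: "is_coequalizer C f g Q q" and uv: "u \<in> hom C D B" "v \<in> hom C D B" "q \<cdot> u = q \<cdot> v"
  obtains D' r w where "regular_epi C r" "r \<in> hom C D' D" "w \<in> hom C D' S" "f \<cdot> w = u \<cdot> r" "g \<cdot> w = v \<cdot> r"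
proof -
  obtain R e r1 r2 k where e: "regular_epi C e" "e \<in> hom C S R" and r: "r1 \<in> hom C R B" "r2 \<in> hom C R B"
    and re: "r1 \<cdot> e = f" "r2 \<cdot> e = g" and k: "is_pullback C k k R r1 r2"
    using reflexive_pair_image[OF fg \<sigma>] .
  note hk = pullback_hom[OF k]
  have q: "q \<in> hom C B Q" using coequalizer_simps(1)[OF co] fg by simp
  have "k \<cdot> f = k \<cdot> g" using el[OF hk(3), of e] re hk r e by simp
  moreover have "k \<in> hom C (Cod C f) (Cod C k)" using hk(1,4) r fg by simp
  ultimately obtain t where t: "t \<in> hom C Q (Cod C k)" "t \<cdot> q = k" using coequalizer_lift[OF co] by metis
  have "k \<cdot> u = k \<cdot> v" using el[OF t(2), of u] el[OF t(2), of v] t(1) q uv by simp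
  moreover have "u \<in> hom C D (Dom C k)" "v \<in> hom C D (Dom C k)" using uv hk(1) r by simp_all
  ultimately obtain w0 where w0: "w0 \<in> hom C D R" "r1 \<cdot> w0 = u" "r2 \<cdot> w0 = v"
    using pullback_lift[OF k] by metis
  obtain D' r w where w: "regular_epi C r" "r \<in> hom C D' D" "w \<in> hom C D' S" "e \<cdot> w = w0 \<cdot> r"
    using regular_epi_cover[OF e w0(1)] .
  have "f \<cdot> w = u \<cdot> r" using el[OF re(1), of w] el[OF w0(2), of r] w w0(1) e r by simp
  moreover have "g \<cdot> w = v \<cdot> r" using el[OF re(2), of w] el[OF w0(3), of r] w w0(1) e r by simp
  ultimately show ?thesis using that w by blast
qed

section \<open>Flat preserves reflexive coequalizers\<close>

text \<open>A lift \<open>a\<close> of \<open>z\<close> along \<open>h\<close> lies only over the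
  kernel \<open>B0\<close> of \<open>q\<close>. For groups one would divide by \<open>s p a\<close>,
  which \<open>h\<close> sends to zero. Without division: the restriction \<open>E0\<close> of the
  point to \<open>B0\<close> is generated by its section, which \<open>h\<close> annihilates since
  \<open>h s b0 = s' q b0\<close>, and by the kernel of \<open>p\<close>. So \<open>h\<close> maps
  \<open>E0\<close> into the image \<open>J\<close> of \<open>K\<close>, and \<open>z\<close> lies
  in \<open>J\<close> by descent.\<close>

lemma regular_epi_point_kernel:
  assumes pt: "is_point C B E p s" and k: "k \<in> hom C K E"
    and kl: "\<And>D x. x \<in> hom C D E \<Longrightarrow> p \<cdot> x = zero C D B \<Longrightarrow> \<exists>y \<in> hom C D K. k \<cdot> y = x"
    and h: "h \<in> hom C E E'" "regular_epi C h" and q: "q \<in> hom C B B'"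
    and p': "p' \<in> hom C E' B'" "p' \<cdot> h = q \<cdot> p" and s': "s' \<in> hom C B' E'" "h \<cdot> s = s' \<cdot> q"
    and z: "z \<in> hom C D E'" "p' \<cdot> z = zero C D B'"
  obtains D' r y where "regular_epi C r" "r \<in> hom C D' D" "y \<in> hom C D' K" "h \<cdot> k \<cdot> y = z \<cdot> r"
proof -
  have ps: "p \<in> hom C E B" "s \<in> hom C B E" "p \<cdot> s = \<one> B" using pt unfolding is_point_def by auto
  have Ob: "B \<in> Ob C" "B' \<in> Ob C" "E' \<in> Ob C" using hom_Ob q p' by auto
  have "h \<cdot> k \<in> hom C K E'" using h k by simp
  then obtain J e m where e: "regular_epi C e" "e \<in> hom C K J"
    and m: "monic C m" "m \<in> hom C J E'" "m \<cdot> e = h \<cdot> k"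
    using image_ex by metis
  have J: "J \<in> Ob C" using hom_Ob m by blast
  obtain D1 r a where r: "regular_epi C r" "r \<in> hom C D1 D" and a: "a \<in> hom C D1 E" "h \<cdot> a = z \<cdot> r"
    using regular_epi_cover[OF h(2,1) z(1)] .
  define B0 b0 where "B0 = ker_ob C q" and "b0 = ker C q"
  have b0: "b0 \<in> hom C B0 B" "q \<cdot> b0 = zero C B0 B'" and B0: "B0 \<in> Ob C"
    unfolding b0_def B0_def using q by simp_all
  obtain E0 c1 c2 where E0: "is_pullback C p b0 E0 c1 c2" using pullback_ex ps b0 by blast
  note hE = pullback_hom[OF E0]
  have c: "c1 \<in> hom C E0 E" "c2 \<in> hom C E0 B0" using hE ps b0 by simp_all
  note eE = el[OF hE(3)] and eh = el[OF s'(2)]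
  have "s \<cdot> b0 \<in> hom C B0 (Dom C p)" "\<one> B0 \<in> hom C B0 (Dom C b0)" "p \<cdot> s \<cdot> b0 = b0 \<cdot> \<one> B0"
    using el[OF ps(3), of b0] ps(1,2) b0 B0 Ob by simp_all
  then obtain s1 where s1: "s1 \<in> hom C B0 E0" "c1 \<cdot> s1 = s \<cdot> b0" "c2 \<cdot> s1 = \<one> B0"
    using pullback_lift[OF E0] by metis
  have "\<exists>w \<in> hom C E0 J. m \<cdot> w = h \<cdot> c1"
  proof (rule point_factor_kernel[of B0 E0 c2 s1])
    show "is_point C B0 E0 c2 s1" unfolding is_point_def using c s1 by blast
    show "h \<cdot> c1 \<in> hom C E0 E'" using c h by simp
    show "m \<in> hom C J E'" "monic C m" by fact+
    show "zero C B0 J \<in> hom C B0 J" using B0 J by simp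
    show "m \<cdot> zero C B0 J = (h \<cdot> c1) \<cdot> s1"
      using eh[of b0] c s1 ps s' q b0 B0 h m by simp
    fix D x assume x: "x \<in> hom C D E0" "c2 \<cdot> x = zero C D B0"
    have "p \<cdot> c1 \<cdot> x = zero C D B" using eE[of x] c x ps b0 hom_Ob(1)[OF x(1)] by simp
    moreover have "c1 \<cdot> x \<in> hom C D E" using c x by simp
    ultimately obtain y where y: "y \<in> hom C D K" "k \<cdot> y = c1 \<cdot> x" using kl by metis
    have "m \<cdot> e \<cdot> y = (h \<cdot> c1) \<cdot> x" using el[OF m(3), of y] e m y h k c x by simp
    moreover have "e \<cdot> y \<in> hom C D J" using e y by simp
    ultimately show "\<exists>w \<in> hom C D J. m \<cdot> w = (h \<cdot> c1) \<cdot> x" by blast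
  qed
  then obtain w where w: "w \<in> hom C E0 J" "m \<cdot> w = h \<cdot> c1" by blast
  have "q \<cdot> p \<cdot> a = zero C D1 B'"
    using el[OF p'(2), of a] el[OF z(2), of r] a ps q p'(1) h r(2) z(1) Ob by simp
  moreover have "p \<cdot> a \<in> hom C D1 B" using ps a by simp
  ultimately obtain b where b: "b \<in> hom C D1 B0" "b0 \<cdot> b = p \<cdot> a"
    using ker_lift[of q "p \<cdot> a" D1] q unfolding B0_def b0_def by (metis hom_iff)
  have "a \<in> hom C D1 (Dom C p)" "b \<in> hom C D1 (Dom C b0)" using a b ps b0 by simp_all
  then obtain c0 where c0: "c0 \<in> hom C D1 E0" "c1 \<cdot> c0 = a"
    using pullback_lift[OF E0 _ _ b(2)[symmetric]] by metis
  have "m \<cdot> w \<cdot> c0 = z \<cdot> r" using el[OF w(2), of c0] w(1) m c0 c h a by simp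
  moreover have "w \<cdot> c0 \<in> hom C D1 J" using w c0 by simp
  ultimately obtain z' where z': "z' \<in> hom C D J" "m \<cdot> z' = z"
    using regular_epi_lift[OF r m(1,2) z(1)] by blast
  obtain D' r' y where y: "regular_epi C r'" "r' \<in> hom C D' D" "y \<in> hom C D' K" "e \<cdot> y = z' \<cdot> r'"
    using regular_epi_cover[OF e z'(1)] .
  have "h \<cdot> k \<cdot> y = z \<cdot> r'"
    using el[OF m(3), of y] el[OF z'(2), of r'] y z'(1) m(2) e k h by simp
  then show ?thesis using that y by blast
qed

lemma coprod_map_coequalizer:
  assumes co: "is_coequalizer C f g Q q" and co': "is_coequalizer C f' g' Q' q'"
  shows "is_coequalizer C (coprod_map C f f') (coprod_map C g g') (Q \<oplus> Q') (coprod_map C q q')"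
proof -
  note s = coequalizer_simps[OF co] and s' = coequalizer_simps[OF co']
  define A B A' B' where AB: "A = Dom C f" "B = Cod C f" "A' = Dom C f'" "B' = Cod C f'"
  have fg: "f \<in> hom C A B" "g \<in> hom C A B" "q \<in> hom C B Q"
    "f' \<in> hom C A' B'" "g' \<in> hom C A' B'" "q' \<in> hom C B' Q'"
    using s s' AB by (simp_all add: eltsI)
  have Ob: "A \<in> Ob C" "B \<in> Ob C" "Q \<in> Ob C" "A' \<in> Ob C" "B' \<in> Ob C" "Q' \<in> Ob C"
    using fg hom_Ob by blast+
  show ?thesis
  proof (rule is_coequalizerI)
    show "coprod_map C f f' \<in> hom C (A \<oplus> A') (B \<oplus> B')" "coprod_map C g g' \<in> hom C (A \<oplus> A') (B \<oplus> B')"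
      "coprod_map C q q' \<in> hom C (B \<oplus> B') (Q \<oplus> Q')" using fg by simp_all
    show "coprod_map C q q' \<cdot> coprod_map C f f' = coprod_map C q q' \<cdot> coprod_map C g g'"
      using fg s(2) s'(2) by simp
    fix D h assume h: "h \<in> hom C (B \<oplus> B') D" "h \<cdot> coprod_map C f f' = h \<cdot> coprod_map C g g'"
    note e = el[OF h(2)]
    let ?a = "h \<cdot> in1 C B B'" and ?b = "h \<cdot> in2 C B B'"
    have "?a \<cdot> f = ?a \<cdot> g" using e[of "in1 C A A'"] h(1) fg Ob by simp
    moreover have "?a \<in> hom C (Cod C f) D" using h Ob fg by simp
    ultimately obtain u where u: "u \<in> hom C Q D" "u \<cdot> q = ?a" using coequalizer_lift[OF co] by metis
    have "?b \<cdot> f' = ?b \<cdot> g'" using e[of "in2 C A A'"] h(1) fg Ob by simp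
    moreover have "?b \<in> hom C (Cod C f') D" using h Ob fg by simp
    ultimately obtain v where v: "v \<in> hom C Q' D" "v \<cdot> q' = ?b" using coequalizer_lift[OF co'] by metis
    have "copair C u v \<cdot> coprod_map C q q' = h"
      by (rule coprod_eqI[of _ B B' D]) (use u v h(1) fg Ob in simp_all)
    moreover have "copair C u v \<in> hom C (Q \<oplus> Q') D" using u v by simp
    ultimately show "\<exists>u \<in> hom C (Q \<oplus> Q') D. u \<cdot> coprod_map C q q' = h" by blast
  next
    fix D u v assume uv: "u \<in> hom C (Q \<oplus> Q') D" "v \<in> hom C (Q \<oplus> Q') D"
      "u \<cdot> coprod_map C q q' = v \<cdot> coprod_map C q q'"
    note e = el[OF uv(3)]
    have "(u \<cdot> in1 C Q Q') \<cdot> q = (v \<cdot> in1 C Q Q') \<cdot> q"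
      using e[of "in1 C B B'"] uv(1,2) fg Ob by simp
    then have 1: "u \<cdot> in1 C Q Q' = v \<cdot> in1 C Q Q'"
      using coequalizer_epi[OF co, of "u \<cdot> in1 C Q Q'" D "v \<cdot> in1 C Q Q'"] uv Ob by simp
    have "(u \<cdot> in2 C Q Q') \<cdot> q' = (v \<cdot> in2 C Q Q') \<cdot> q'"
      using e[of "in2 C B B'"] uv(1,2) fg Ob by simp
    then have 2: "u \<cdot> in2 C Q Q' = v \<cdot> in2 C Q Q'"
      using coequalizer_epi[OF co', of "u \<cdot> in2 C Q Q'" D "v \<cdot> in2 C Q Q'"] uv Ob by simp
    show "u = v" by (rule coprod_eqI[OF uv(1,2) Ob(3,6) 1 2])
  qed
qed

lemma ident_coequalizer: "A \<in> Ob C \<Longrightarrow> is_coequalizer C (\<one> A) (\<one> A) A (\<one> A)"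
  by (rule is_coequalizerI[of _ A A]) (auto simp: elts_def)

lemma regular_epi_ident: "A \<in> Ob C \<Longrightarrow> regular_epi C (\<one> A)"
  using ident_coequalizer coequalizer_regular_epi by blast

text \<open>Coproducts preserve coequalizers, so \<open>q + g\<close> is a regular epimorphism,
  compatible with the points \<open>[1, 0]\<close>. Hence the generic element
  \<open>flat_ker C L Y\<close> of the kernel lifts locally, which is regularity of
  \<open>q \<flat> g\<close>.\<close>

lemma flat_map_regular_epi:
  assumes q: "regular_epi C q" "q \<in> hom C B L" and g: "regular_epi C g" "g \<in> hom C X Y"
  shows "regular_epi C (flat_map C q g)"
proof -
  obtain a b a' b' where co: "is_coequalizer C a b L q" "is_coequalizer C a' b' Y g"
    using q g unfolding regular_epi_def by auto
  have reg: "regular_epi C (coprod_map C q g)"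
    using coequalizer_regular_epi[OF coprod_map_coequalizer[OF co]] .
  have Ob: "B \<in> Ob C" "L \<in> Ob C" "X \<in> Ob C" "Y \<in> Ob C" using hom_Ob q g by blast+
  let ?p = "copair C (\<one> B) (zero C X B)" and ?p' = "copair C (\<one> L) (zero C Y L)"
  have pt: "is_point C B (B \<oplus> X) ?p (in1 C B X)" unfolding is_point_def using Ob by simp
  obtain D r y where r: "regular_epi C r" "r \<in> hom C D (L \<flat> Y)" "y \<in> hom C D (B \<flat> X)"
    "coprod_map C q g \<cdot> flat_ker C B X \<cdot> y = flat_ker C L Y \<cdot> r"
  proof (rule regular_epi_point_kernel[OF pt, where h = "coprod_map C q g" and E' = "L \<oplus> Y"
        and k = "flat_ker C B X" and K = "B \<flat> X" and q = q and p' = ?p' and s' = "in1 C L Y"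
        and z = "flat_ker C L Y" and D = "L \<flat> Y"])
    show "\<And>D x. x \<in> hom C D (B \<oplus> X) \<Longrightarrow> ?p \<cdot> x = zero C D B \<Longrightarrow> \<exists>y \<in> hom C D (B \<flat> X). flat_ker C B X \<cdot> y = x"
      using flat_lift Ob by blast
    show "regular_epi C (coprod_map C q g)" by fact
    show "q \<in> hom C B L" by fact
    show "?p' \<cdot> coprod_map C q g = q \<cdot> ?p"
      using q(2) g(2) Ob by (simp add: comp_copair)
  qed (use q(2) g(2) Ob in \<open>simp_all\<close>)
  have "flat_map C q g \<cdot> y = r"
    by (rule flat_eqI[of _ D L Y]) (use r q(2) g(2) Ob in simp_all)
  moreover have "flat_map C q g \<in> hom C (B \<flat> X) (L \<flat> Y)" using q g by simp
  ultimately show ?thesis using regular_epi_if_covers r by blast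
qed

text \<open>Elements \<open>u\<close>, \<open>v\<close> of \<open>B \<flat> X\<close> identified by
  \<open>q \<flat> 1\<close> must be shown to be locally \<open>(f \<flat> 1) y\<close> and
  \<open>(g \<flat> 1) y\<close>. The theory of reflexive pairs, applied in \<open>B + X\<close>,
  gives a connecting element of \<open>S + X\<close> only. The comparison \<open>h\<close> from
  \<open>S + X\<close> to the kernel pair \<open>R\<close> of \<open>q + 1\<close> lies over the
  comparison \<open>qs\<close> from \<open>S\<close> to the kernel pair \<open>T\<close> of
  \<open>q\<close>; since \<open>h\<close> is a regular epimorphism,
  \<open>regular_epi_point_kernel\<close> finds such a \<open>y\<close> in
  \<open>S \<flat> X\<close>.\<close>

lemma flat_map_coequalizer_factor:
  assumes fg: "f \<in> hom C S B" "g \<in> hom C S B" and \<sigma>: "\<sigma> \<in> hom C B S" "f \<cdot> \<sigma> = \<one> B" "g \<cdot> \<sigma> = \<one> B"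
    and co: "is_coequalizer C f g L q" and X: "X \<in> Ob C" and \<zeta>: "\<zeta> \<in> hom C (B \<flat> X) Y"
    "\<zeta> \<cdot> flat_map C f (\<one> X) = \<zeta> \<cdot> flat_map C g (\<one> X)"
  shows "\<exists>\<xi> \<in> hom C (L \<flat> X) Y. \<xi> \<cdot> flat_map C q (\<one> X) = \<zeta>"
proof -
  have q: "q \<in> hom C B L" using coequalizer_simps(1)[OF co] fg by simp
  have qfg: "q \<cdot> f = q \<cdot> g" using coequalizer_simps(2)[OF co] .
  have Ob: "S \<in> Ob C" "B \<in> Ob C" "L \<in> Ob C" using hom_Ob fg q by blast+
  have rq: "regular_epi C q" using coequalizer_regular_epi[OF co] .
  let ?f = "coprod_map C f (\<one> X)" and ?g = "coprod_map C g (\<one> X)" and ?q = "coprod_map C q (\<one> X)"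
  have co1: "is_coequalizer C ?f ?g (L \<oplus> X) ?q"
    using coprod_map_coequalizer[OF co ident_coequalizer[OF X]] .
  have fg1: "?f \<in> hom C (S \<oplus> X) (B \<oplus> X)" "?g \<in> hom C (S \<oplus> X) (B \<oplus> X)" "?q \<in> hom C (B \<oplus> X) (L \<oplus> X)"
    using fg q X by simp_all
  have \<sigma>1: "coprod_map C \<sigma> (\<one> X) \<in> hom C (B \<oplus> X) (S \<oplus> X)" "?f \<cdot> coprod_map C \<sigma> (\<one> X) = \<one> (B \<oplus> X)"
    "?g \<cdot> coprod_map C \<sigma> (\<one> X) = \<one> (B \<oplus> X)" using \<sigma> X fg Ob by simp_all
  obtain R p1 p2 where R: "is_pullback C ?q ?q R p1 p2" using pullback_ex fg1(3) by blast
  obtain T t1 t2 where T: "is_pullback C q q T t1 t2" using pullback_ex q by blast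
  note hR = pullback_hom[OF R] and hT = pullback_hom[OF T]
  have p: "p1 \<in> hom C R (B \<oplus> X)" "p2 \<in> hom C R (B \<oplus> X)" and t: "t1 \<in> hom C T B" "t2 \<in> hom C T B"
    using hR hT q X by simp_all
  have Dq: "Dom C ?q = B \<oplus> X" "Dom C q = B" using q X by simp_all
  note RL = pullback_lift[OF R, unfolded Dq] and TL = pullback_lift[OF T, unfolded Dq]
  note eR = el[OF hR(3)] and eT = el[OF hT(3)]
  have "?q \<cdot> ?f = ?q \<cdot> ?g" using coequalizer_simps(2)[OF co1] .
  then obtain h where h: "h \<in> hom C (S \<oplus> X) R" "p1 \<cdot> h = ?f" "p2 \<cdot> h = ?g"
    using RL[OF fg1(1,2)] by blast
  obtain qs where qs: "qs \<in> hom C S T" "t1 \<cdot> qs = f" "t2 \<cdot> qs = g"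
    using TL[OF fg qfg] by blast
  let ?p = "copair C (\<one> B) (zero C X B)" and ?pl = "copair C (\<one> L) (zero C X L)"
    and ?ps = "copair C (\<one> S) (zero C X S)"
  have qp: "q \<cdot> ?p \<cdot> x = ?pl \<cdot> ?q \<cdot> x" if "x \<in> elts C (B \<oplus> X)" for x
    using that q X Ob by (simp add: comp_copair)
  have "q \<cdot> ?p \<cdot> p1 = q \<cdot> ?p \<cdot> p2" using qp[of p1] qp[of p2] p hR(3) by simp
  moreover have "?p \<cdot> p1 \<in> hom C R B" "?p \<cdot> p2 \<in> hom C R B" using p Ob X by simp_all
  ultimately obtain p' where p': "p' \<in> hom C R T" "t1 \<cdot> p' = ?p \<cdot> p1" "t2 \<cdot> p' = ?p \<cdot> p2"
    using TL by metis
  have "?q \<cdot> in1 C B X \<cdot> t1 = ?q \<cdot> in1 C B X \<cdot> t2" using t q hT(3) X by simp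
  moreover have "in1 C B X \<cdot> t1 \<in> hom C T (B \<oplus> X)" "in1 C B X \<cdot> t2 \<in> hom C T (B \<oplus> X)" using t Ob X by simp_all
  ultimately obtain s' where s': "s' \<in> hom C T R" "p1 \<cdot> s' = in1 C B X \<cdot> t1" "p2 \<cdot> s' = in1 C B X \<cdot> t2"
    using RL by metis
  \<comment> \<open>The generic pair \<open>(p1, p2)\<close> in \<open>R\<close> is related by an
    element of \<open>S + X\<close> after one cover.\<close>
  have rh: "regular_epi C h"
  proof -
    obtain D r w where r: "regular_epi C r" "r \<in> hom C D R" "w \<in> hom C D (S \<oplus> X)"
      "?f \<cdot> w = p1 \<cdot> r" "?g \<cdot> w = p2 \<cdot> r"
      using reflexive_coequalizer_kernel_pair[OF fg1(1,2) \<sigma>1 co1 p hR(3)] .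
    have "h \<cdot> w = r"
    proof (rule pullback_eqI[OF R, of _ D])
      show "p1 \<cdot> h \<cdot> w = p1 \<cdot> r" using el[OF h(2), of w] r h(1) p by simp
      show "p2 \<cdot> h \<cdot> w = p2 \<cdot> r" using el[OF h(3), of w] r h(1) p by simp
    qed (use h r in simp_all)
    then show ?thesis using regular_epi_if_covers[OF h(1)] r by blast
  qed
  have pt: "is_point C S (S \<oplus> X) ?ps (in1 C S X)" unfolding is_point_def using Ob X by simp
  have ph: "p' \<cdot> h = qs \<cdot> ?ps"
  proof (rule pullback_eqI[OF T, of _ "S \<oplus> X"])
    show "p' \<cdot> h \<in> hom C (S \<oplus> X) T" "qs \<cdot> ?ps \<in> hom C (S \<oplus> X) T" using p' h qs Ob X by simp_all
    show "t1 \<cdot> p' \<cdot> h = t1 \<cdot> qs \<cdot> ?ps"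
      using el[OF p'(2), of h] el[OF qs(2), of ?ps] p'(1) p h(1,2) qs(1) t fg Ob X by (simp add: comp_copair)
    show "t2 \<cdot> p' \<cdot> h = t2 \<cdot> qs \<cdot> ?ps"
      using el[OF p'(3), of h] el[OF qs(3), of ?ps] p'(1) p h(1,3) qs(1) t fg Ob X by (simp add: comp_copair)
  qed
  have hs: "h \<cdot> in1 C S X = s' \<cdot> qs"
  proof (rule pullback_eqI[OF R, of _ S])
    show "h \<cdot> in1 C S X \<in> hom C S R" "s' \<cdot> qs \<in> hom C S R" using s' h qs Ob X by simp_all
    show "p1 \<cdot> h \<cdot> in1 C S X = p1 \<cdot> s' \<cdot> qs"
      using el[OF h(2), of "in1 C S X"] el[OF s'(2), of qs] s'(1) p h(1) qs(1,2) t fg Ob X by simp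
    show "p2 \<cdot> h \<cdot> in1 C S X = p2 \<cdot> s' \<cdot> qs"
      using el[OF h(3), of "in1 C S X"] el[OF s'(3), of qs] s'(1) p h(1) qs(1,3) t fg Ob X by simp
  qed
  show ?thesis
  proof (rule regular_epi_factor[of "flat_map C q (\<one> X)" "B \<flat> X"])
    show "regular_epi C (flat_map C q (\<one> X))"
      using flat_map_regular_epi[OF rq q regular_epi_ident[OF X]] ident_hom[OF X] by blast
    show "flat_map C q (\<one> X) \<in> hom C (B \<flat> X) (L \<flat> X)" using q X by simp
    show "\<zeta> \<in> hom C (B \<flat> X) Y" by fact
    fix D u v assume uv: "u \<in> hom C D (B \<flat> X)" "v \<in> hom C D (B \<flat> X)"
      "flat_map C q (\<one> X) \<cdot> u = flat_map C q (\<one> X) \<cdot> v"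
    have D: "D \<in> Ob C" using hom_Ob uv by blast
    let ?k = "flat_ker C B X"
    have "flat_ker C L X \<cdot> flat_map C q (\<one> X) \<cdot> u = flat_ker C L X \<cdot> flat_map C q (\<one> X) \<cdot> v"
      using uv(3) by simp
    then have "?q \<cdot> ?k \<cdot> u = ?q \<cdot> ?k \<cdot> v" using uv(1,2) q X by simp
    moreover have "?k \<cdot> u \<in> hom C D (B \<oplus> X)" "?k \<cdot> v \<in> hom C D (B \<oplus> X)" using uv Ob X by simp_all
    ultimately obtain z where z: "z \<in> hom C D R" "p1 \<cdot> z = ?k \<cdot> u" "p2 \<cdot> z = ?k \<cdot> v"
      using RL by metis
    have TO: "T \<in> Ob C" using hom_Ob t by blast
    \<comment> \<open>The pair formed by \<open>u\<close> and \<open>v\<close> lies in the kernel of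
      \<open>p'\<close>, because both entries vanish in \<open>B\<close>.\<close>
    have pz: "p' \<cdot> z = zero C D T"
    proof (rule pullback_eqI[OF T, of _ D])
      show "p' \<cdot> z \<in> hom C D T" "zero C D T \<in> hom C D T" using p' z TO D by simp_all
      show "t1 \<cdot> p' \<cdot> z = t1 \<cdot> zero C D T"
        using el[OF p'(2), of z] p'(1) z t p uv Ob X D by simp
      show "t2 \<cdot> p' \<cdot> z = t2 \<cdot> zero C D T"
        using el[OF p'(3), of z] p'(1) z t p uv Ob X D by simp
    qed
    obtain D' r y where y: "regular_epi C r" "r \<in> hom C D' D" "y \<in> hom C D' (S \<flat> X)"
      "h \<cdot> flat_ker C S X \<cdot> y = z \<cdot> r"
    proof (rule regular_epi_point_kernel[OF pt _ _ h(1) rh qs(1) p'(1) ph s'(1) hs z(1) pz])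
      show "flat_ker C S X \<in> hom C (S \<flat> X) (S \<oplus> X)" using Ob X by simp
      show "\<And>D x. x \<in> hom C D (S \<oplus> X) \<Longrightarrow> ?ps \<cdot> x = zero C D S \<Longrightarrow> \<exists>y \<in> hom C D (S \<flat> X). flat_ker C S X \<cdot> y = x"
        using flat_lift Ob X by blast
    qed
    have "p1 \<cdot> h \<cdot> flat_ker C S X \<cdot> y = ?k \<cdot> u \<cdot> r"
      using y(4) el[OF z(2), of r] z(1) p y(2) uv Ob X by simp
    then have "?k \<cdot> flat_map C f (\<one> X) \<cdot> y = ?k \<cdot> u \<cdot> r"
      using el[OF h(2), of "flat_ker C S X \<cdot> y"] h(1) p y(3) fg Ob X by simp
    then have 1: "flat_map C f (\<one> X) \<cdot> y = u \<cdot> r"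
      using flat_eqI[of "flat_map C f (\<one> X) \<cdot> y" D' B X "u \<cdot> r"] y(2,3) fg uv Ob X by simp
    have "p2 \<cdot> h \<cdot> flat_ker C S X \<cdot> y = ?k \<cdot> v \<cdot> r"
      using y(4) el[OF z(3), of r] z(1) p y(2) uv Ob X by simp
    then have "?k \<cdot> flat_map C g (\<one> X) \<cdot> y = ?k \<cdot> v \<cdot> r"
      using el[OF h(3), of "flat_ker C S X \<cdot> y"] h(1) p y(3) fg Ob X by simp
    then have 2: "flat_map C g (\<one> X) \<cdot> y = v \<cdot> r"
      using flat_eqI[of "flat_map C g (\<one> X) \<cdot> y" D' B X "v \<cdot> r"] y(2,3) fg uv Ob X by simp
    have "(\<zeta> \<cdot> u) \<cdot> r = (\<zeta> \<cdot> v) \<cdot> r"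
      using el[OF \<zeta>(2), of y] 1 2 \<zeta>(1) fg uv y X by simp
    then show "\<zeta> \<cdot> u = \<zeta> \<cdot> v"
      using regular_epi_cancel[OF y(1), of "\<zeta> \<cdot> u" Y "\<zeta> \<cdot> v"] \<zeta>(1) uv y(2) by simp
  qed
qed

section \<open>Actions and cosmash products\<close>

lemma internal_actionD:
  assumes "internal_action C A X \<xi>"
  shows "A \<in> Ob C" "X \<in> Ob C" "\<xi> \<in> hom C (A \<flat> X) X" "\<xi> \<cdot> flat_unit C A X = \<one> X"
    "\<xi> \<cdot> flat_mult C A X = \<xi> \<cdot> flat_map C (\<one> A) \<xi>"
  using assms unfolding internal_action_def by blast+

lemma internal_action_pullback:
  assumes \<xi>: "internal_action C A X \<xi>" and f: "f \<in> hom C B A"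
  shows "internal_action C B X (\<xi> \<cdot> flat_map C f (\<one> X))"
proof -
  note a = internal_actionD[OF \<xi>]
  have B: "B \<in> Ob C" using hom_Ob f by blast
  have X: "\<one> X \<in> hom C X X" using ident_hom a(2) .
  have "(\<xi> \<cdot> flat_map C f (\<one> X)) \<cdot> flat_unit C B X = \<one> X"
    using flat_unit_natural[OF f X] a f B by simp
  moreover have "(\<xi> \<cdot> flat_map C f (\<one> X)) \<cdot> flat_mult C B X =
      (\<xi> \<cdot> flat_map C f (\<one> X)) \<cdot> flat_map C (\<one> B) (\<xi> \<cdot> flat_map C f (\<one> X))"
    using flat_mult_natural[OF f X] el[OF a(5), of "flat_map C f (flat_map C f (\<one> X))"] a(1,2,3) f B
    by simp
  moreover have "\<xi> \<cdot> flat_map C f (\<one> X) \<in> hom C (B \<flat> X) X" using a f by simp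
  ultimately show ?thesis unfolding internal_action_def using a B by blast
qed

text \<open>Associativity is an equation on \<open>L \<flat> (L \<flat> X)\<close>; it is tested
  after the regular epimorphism \<open>q \<flat> (q \<flat> 1)\<close>, where naturality reduces it
  to the law for \<open>\<zeta>\<close>.\<close>

lemma internal_action_descent:
  assumes \<zeta>: "internal_action C B X \<zeta>" and q: "regular_epi C q" "q \<in> hom C B L"
    and \<xi>: "\<xi> \<in> hom C (L \<flat> X) X" "\<xi> \<cdot> flat_map C q (\<one> X) = \<zeta>"
  shows "internal_action C L X \<xi>"
proof -
  note a = internal_actionD[OF \<zeta>]
  have L: "L \<in> Ob C" using hom_Ob q by blast
  have X: "\<one> X \<in> hom C X X" "regular_epi C (\<one> X)" using ident_hom regular_epi_ident a(2) by auto
  let ?q = "flat_map C q (\<one> X)"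
  have q1: "regular_epi C ?q" "?q \<in> hom C (B \<flat> X) (L \<flat> X)"
    using flat_map_regular_epi[OF q X(2,1)] q(2) X by simp_all
  have q2: "regular_epi C (flat_map C q ?q)" using flat_map_regular_epi[OF q q1] .
  note e = el[OF \<xi>(2)]
  have 1: "\<xi> \<cdot> flat_unit C L X = \<one> X"
    using e[of "flat_unit C B X"] flat_unit_natural[OF q(2) X(1)] a(4) \<xi>(1) q(2) a(1,2) L by simp
  have 2: "\<xi> \<cdot> flat_mult C L X = \<xi> \<cdot> flat_map C (\<one> L) \<xi>"
  proof (rule regular_epi_cancel[OF q2])
    show "\<xi> \<cdot> flat_mult C L X \<in> hom C (Cod C (flat_map C q ?q)) X"
      "\<xi> \<cdot> flat_map C (\<one> L) \<xi> \<in> hom C (Cod C (flat_map C q ?q)) X"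
      using \<xi>(1) q(2) a(1,2) L by simp_all
    have "(\<xi> \<cdot> flat_mult C L X) \<cdot> flat_map C q ?q = \<xi> \<cdot> ?q \<cdot> flat_mult C B X"
      using flat_mult_natural[OF q(2) X(1)] \<xi>(1) q(2) a(1,2) L by simp
    also have "\<dots> = \<zeta> \<cdot> flat_map C (\<one> B) \<zeta>"
      using e[of "flat_mult C B X"] a \<xi>(1) q(2) by simp
    also have "\<dots> = \<xi> \<cdot> ?q \<cdot> flat_map C (\<one> B) \<zeta>"
      using e[of "flat_map C (\<one> B) \<zeta>"] a(1,2,3) \<xi>(1) q(2) by simp
    also have "\<dots> = (\<xi> \<cdot> flat_map C (\<one> L) \<xi>) \<cdot> flat_map C q ?q"
      using \<xi> a(1,2,3) q(2) L by simp
    finally show "(\<xi> \<cdot> flat_mult C L X) \<cdot> flat_map C q ?q = (\<xi> \<cdot> flat_map C (\<one> L) \<xi>) \<cdot> flat_map C q ?q" .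
  qed
  show ?thesis unfolding internal_action_def using L a(2) \<xi>(1) 1 2 by blast
qed

lemma conjugation_simps [simp]:
  assumes "A \<in> Ob C"
  shows "conjugation C A \<in> Arr C" "Dom C (conjugation C A) = A \<flat> A" "Cod C (conjugation C A) = A"
    "conjugation C A \<in> elts C D \<longleftrightarrow> A = D"
  using assms unfolding conjugation_def by simp_all

text \<open>With \<open>f = 1\<close> and \<open>g = \<delta>\<close>, the second crossed module
  axiom takes the form \<open>\<delta> \<xi> = [1, \<delta>] k\<close>, in which equivariance is
  compared and extended.\<close>

lemma conjugation_flat_map:
  assumes "f \<in> hom C A L" "g \<in> hom C B L"
  shows "conjugation C L \<cdot> flat_map C f g = copair C f g \<cdot> flat_ker C A B"
  using assms hom_Ob[OF assms(1)] hom_Ob[OF assms(2)] unfolding conjugation_def by simp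

section \<open>Binary and ternary cosmash products\<close>

lemma pair_zero [simp]:
  assumes "A \<in> Ob C" "B \<in> Ob C" "D \<in> Ob C"
  shows "pair C (zero C D A) (zero C D B) = zero C D (prod_ob C A B)"
  by (rule prod_eqI[of _ D A B]) (use assms in simp_all)

lemma cosmash_comparison_simps [simp]:
  assumes "A \<in> Ob C" "B \<in> Ob C"
  shows "cosmash_comparison C A B \<in> Arr C" "Dom C (cosmash_comparison C A B) = A \<oplus> B"
    "Cod C (cosmash_comparison C A B) = prod_ob C A B"
  using assms unfolding cosmash_comparison_def by simp_all

lemma cosmash_ker_simps [simp]:
  assumes "A \<in> Ob C" "B \<in> Ob C"
  shows "cosmash_ker C A B \<in> Arr C" "Dom C (cosmash_ker C A B) = A \<diamond> B"
    "Cod C (cosmash_ker C A B) = A \<oplus> B" "cosmash_ker C A B \<in> elts C D \<longleftrightarrow> A \<oplus> B = D"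
    "A \<diamond> B \<in> Ob C" "monic C (cosmash_ker C A B)"
  using assms unfolding cosmash_ker_def cosmash_def by simp_all

lemma cosmash_ker_zero [simp]:
  assumes Ob: "A \<in> Ob C" "B \<in> Ob C"
  shows "copair C (\<one> A) (zero C B A) \<cdot> cosmash_ker C A B = zero C (A \<diamond> B) A"
    "copair C (zero C A B) (\<one> B) \<cdot> cosmash_ker C A B = zero C (A \<diamond> B) B"
proof -
  have "cosmash_comparison C A B \<cdot> cosmash_ker C A B = zero C (A \<diamond> B) (prod_ob C A B)"
    using Ob unfolding cosmash_ker_def cosmash_def by simp
  then have e: "pair C (copair C (\<one> A) (zero C B A) \<cdot> cosmash_ker C A B)
      (copair C (zero C A B) (\<one> B) \<cdot> cosmash_ker C A B) = pair C (zero C (A \<diamond> B) A) (zero C (A \<diamond> B) B)"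
    using Ob unfolding cosmash_comparison_def by simp
  show "copair C (\<one> A) (zero C B A) \<cdot> cosmash_ker C A B = zero C (A \<diamond> B) A"
    "copair C (zero C A B) (\<one> B) \<cdot> cosmash_ker C A B = zero C (A \<diamond> B) B"
    using pair_inject[OF e, of "A \<diamond> B" A B] Ob by simp_all
qed

lemma cosmash_lift:
  assumes u: "u \<in> hom C D (A \<oplus> B)" "copair C (\<one> A) (zero C B A) \<cdot> u = zero C D A"
    "copair C (zero C A B) (\<one> B) \<cdot> u = zero C D B" and Ob: "A \<in> Ob C" "B \<in> Ob C"
  shows "\<exists>v \<in> hom C D (A \<diamond> B). cosmash_ker C A B \<cdot> v = u"
proof -
  have "cosmash_comparison C A B \<cdot> u = zero C D (prod_ob C A B)"
    using u Ob hom_Ob(1)[OF u(1)] unfolding cosmash_comparison_def by simp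
  then show ?thesis
    using ker_lift[of "cosmash_comparison C A B" u D] u(1) Ob
    unfolding cosmash_ker_def cosmash_def by (metis cosmash_comparison_simps)
qed

lemma cosmash_to_flat_props:
  assumes "A \<in> Ob C" "B \<in> Ob C"
  shows "cosmash_to_flat C A B \<in> hom C (A \<diamond> B) (A \<flat> B)"
    "flat_ker C A B \<cdot> cosmash_to_flat C A B = cosmash_ker C A B"
proof -
  have "\<exists>w \<in> hom C (A \<diamond> B) (A \<flat> B). flat_ker C A B \<cdot> w = cosmash_ker C A B"
    by (rule flat_lift) (use assms in simp_all)
  then have *: "\<exists>w. w \<in> hom C (A \<diamond> B) (A \<flat> B) \<and> flat_ker C A B \<cdot> w = cosmash_ker C A B" by blast
  show "cosmash_to_flat C A B \<in> hom C (A \<diamond> B) (A \<flat> B)"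
    "flat_ker C A B \<cdot> cosmash_to_flat C A B = cosmash_ker C A B"
    using the_lift[OF _ _ *] assms unfolding cosmash_to_flat_def by simp_all
qed

lemma cosmash3_comparison_simps [simp]:
  assumes "A \<in> Ob C" "B \<in> Ob C" "X \<in> Ob C"
  shows "cosmash3_comparison C A B X \<in> Arr C" "Dom C (cosmash3_comparison C A B X) = A \<oplus> B \<oplus> X"
    "Cod C (cosmash3_comparison C A B X) = prod_ob C (prod_ob C (A \<oplus> B) (A \<oplus> X)) (B \<oplus> X)"
  using assms unfolding cosmash3_comparison_def by simp_all

lemma cosmash3_ker_simps [simp]:
  assumes "A \<in> Ob C" "B \<in> Ob C" "X \<in> Ob C"
  shows "cosmash3_ker C A B X \<in> Arr C" "Dom C (cosmash3_ker C A B X) = cosmash3 C A B X"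
    "Cod C (cosmash3_ker C A B X) = A \<oplus> B \<oplus> X" "cosmash3_ker C A B X \<in> elts C D \<longleftrightarrow> A \<oplus> B \<oplus> X = D"
    "cosmash3 C A B X \<in> Ob C"
  using assms unfolding cosmash3_ker_def cosmash3_def by simp_all

lemma copair_in12 [simp]: "A \<in> Ob C \<Longrightarrow> B \<in> Ob C \<Longrightarrow> copair C (in1 C A B) (in2 C A B) = \<one> (A \<oplus> B)"
  by (rule coprod_eqI[of _ A B "A \<oplus> B"]) simp_all

lemma cosmash3_ker_zero:
  assumes Ob: "A \<in> Ob C" "B \<in> Ob C" "X \<in> Ob C"
  shows "copair C (\<one> (A \<oplus> B)) (zero C X (A \<oplus> B)) \<cdot> cosmash3_ker C A B X = zero C (cosmash3 C A B X) (A \<oplus> B)"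
    "copair C (copair C (in1 C A X) (zero C B (A \<oplus> X))) (in2 C A X) \<cdot> cosmash3_ker C A B X =
      zero C (cosmash3 C A B X) (A \<oplus> X)"
    "copair C (copair C (zero C A (B \<oplus> X)) (in1 C B X)) (in2 C B X) \<cdot> cosmash3_ker C A B X =
      zero C (cosmash3 C A B X) (B \<oplus> X)"
proof -
  let ?K = "cosmash3 C A B X" and ?k = "cosmash3_ker C A B X"
  let ?a = "copair C (\<one> (A \<oplus> B)) (zero C X (A \<oplus> B))"
    and ?b = "copair C (copair C (in1 C A X) (zero C B (A \<oplus> X))) (in2 C A X)"
    and ?c = "copair C (copair C (zero C A (B \<oplus> X)) (in1 C B X)) (in2 C B X)"
  have "cosmash3_comparison C A B X \<cdot> ?k = zero C ?K (prod_ob C (prod_ob C (A \<oplus> B) (A \<oplus> X)) (B \<oplus> X))"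
    using Ob unfolding cosmash3_ker_def cosmash3_def by simp
  then have e: "pair C (pair C (?a \<cdot> ?k) (?b \<cdot> ?k)) (?c \<cdot> ?k) =
      pair C (pair C (zero C ?K (A \<oplus> B)) (zero C ?K (A \<oplus> X))) (zero C ?K (B \<oplus> X))"
    using Ob unfolding cosmash3_comparison_def by simp
  have 1: "pair C (?a \<cdot> ?k) (?b \<cdot> ?k) = pair C (zero C ?K (A \<oplus> B)) (zero C ?K (A \<oplus> X))"
    by (rule pair_inject(1)[OF e, of ?K]) (use Ob in simp_all)
  show "?c \<cdot> ?k = zero C ?K (B \<oplus> X)"
    by (rule pair_inject(2)[OF e, of ?K "prod_ob C (A \<oplus> B) (A \<oplus> X)"]) (use Ob in simp_all)
  show "?a \<cdot> ?k = zero C ?K (A \<oplus> B)"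
    by (rule pair_inject(1)[OF 1, of ?K]) (use Ob in simp_all)
  show "?b \<cdot> ?k = zero C ?K (A \<oplus> X)"
    by (rule pair_inject(2)[OF 1, of ?K "A \<oplus> B"]) (use Ob in simp_all)
qed

lemma cosmash3_lift:
  assumes u: "u \<in> hom C D (A \<oplus> B \<oplus> X)" "copair C (\<one> (A \<oplus> B)) (zero C X (A \<oplus> B)) \<cdot> u = zero C D (A \<oplus> B)"
    "copair C (copair C (in1 C A X) (zero C B (A \<oplus> X))) (in2 C A X) \<cdot> u = zero C D (A \<oplus> X)"
    "copair C (copair C (zero C A (B \<oplus> X)) (in1 C B X)) (in2 C B X) \<cdot> u = zero C D (B \<oplus> X)"
    and Ob: "A \<in> Ob C" "B \<in> Ob C" "X \<in> Ob C"
  shows "\<exists>v \<in> hom C D (cosmash3 C A B X). cosmash3_ker C A B X \<cdot> v = u"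
proof -
  have "cosmash3_comparison C A B X \<cdot> u = zero C D (prod_ob C (prod_ob C (A \<oplus> B) (A \<oplus> X)) (B \<oplus> X))"
    using u Ob hom_Ob(1)[OF u(1)] unfolding cosmash3_comparison_def by simp
  then show ?thesis
    using ker_lift[of "cosmash3_comparison C A B X" u D] u(1) Ob
    unfolding cosmash3_ker_def cosmash3_def by (metis cosmash3_comparison_simps)
qed

lemma cosmash3_to_flat_props:
  assumes "A \<in> Ob C" "B \<in> Ob C" "X \<in> Ob C"
  shows "cosmash3_to_flat C A B X \<in> hom C (cosmash3 C A B X) ((A \<oplus> B) \<flat> X)"
    "flat_ker C (A \<oplus> B) X \<cdot> cosmash3_to_flat C A B X = cosmash3_ker C A B X"
proof -
  have "\<exists>w \<in> hom C (cosmash3 C A B X) ((A \<oplus> B) \<flat> X). flat_ker C (A \<oplus> B) X \<cdot> w = cosmash3_ker C A B X"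
    by (rule flat_lift) (use assms cosmash3_ker_zero in simp_all)
  then have *: "\<exists>w. w \<in> hom C (cosmash3 C A B X) ((A \<oplus> B) \<flat> X) \<and> flat_ker C (A \<oplus> B) X \<cdot> w = cosmash3_ker C A B X"
    by blast
  show "cosmash3_to_flat C A B X \<in> hom C (cosmash3 C A B X) ((A \<oplus> B) \<flat> X)"
    "flat_ker C (A \<oplus> B) X \<cdot> cosmash3_to_flat C A B X = cosmash3_ker C A B X"
    using the_lift[OF _ _ *] assms unfolding cosmash3_to_flat_def by simp_all
qed

text \<open>Each component of the folding factors through a component of the ternary comparison:
  projecting to \<open>N\<close> also kills the last summand \<open>M\<close>, so it passes through
  \<open>M + N\<close>; projecting to \<open>M\<close> kills \<open>N\<close>, so it passes through
  \<open>M + M\<close>. The ternary cosmash product vanishes in both.\<close>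

lemma fold_outer_props:
  assumes Ob: "M \<in> Ob C" "N \<in> Ob C"
  shows "fold_outer C N M \<in> hom C (cosmash3 C M N M) (N \<diamond> M)"
    "cosmash_ker C N M \<cdot> fold_outer C N M =
      copair C (copair C (in2 C N M) (in1 C N M)) (in2 C N M) \<cdot> cosmash3_ker C M N M"
proof -
  let ?h = "cosmash3_ker C M N M" and ?fold = "copair C (copair C (in2 C N M) (in1 C N M)) (in2 C N M)"
  note z = cosmash3_ker_zero[OF Ob(1) Ob(2) Ob(1)]
  have "\<exists>w \<in> hom C (cosmash3 C M N M) (N \<diamond> M). cosmash_ker C N M \<cdot> w = ?fold \<cdot> ?h"
  proof (rule cosmash_lift)
    show "?fold \<cdot> ?h \<in> hom C (cosmash3 C M N M) (N \<oplus> M)" using Ob by simp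
    have "copair C (\<one> N) (zero C M N) \<cdot> ?fold \<cdot> ?h =
        copair C (zero C M N) (\<one> N) \<cdot> copair C (\<one> (M \<oplus> N)) (zero C M (M \<oplus> N)) \<cdot> ?h"
      using Ob by (simp add: comp_copair)
    then show "copair C (\<one> N) (zero C M N) \<cdot> ?fold \<cdot> ?h = zero C (cosmash3 C M N M) N"
      using z(1) Ob by simp
    have "copair C (zero C N M) (\<one> M) \<cdot> ?fold \<cdot> ?h =
        copair C (\<one> M) (\<one> M) \<cdot> copair C (copair C (in1 C M M) (zero C N (M \<oplus> M))) (in2 C M M) \<cdot> ?h"
      using Ob by (simp add: comp_copair)
    then show "copair C (zero C N M) (\<one> M) \<cdot> ?fold \<cdot> ?h = zero C (cosmash3 C M N M) M"
      using z(2) Ob by simp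
  qed (use Ob in auto)
  then have *: "\<exists>w. w \<in> hom C (cosmash3 C M N M) (N \<diamond> M) \<and> cosmash_ker C N M \<cdot> w = ?fold \<cdot> ?h" by blast
  show "fold_outer C N M \<in> hom C (cosmash3 C M N M) (N \<diamond> M)"
    "cosmash_ker C N M \<cdot> fold_outer C N M = ?fold \<cdot> ?h"
    using the_lift[OF _ _ *] Ob unfolding fold_outer_def by simp_all
qed

lemma fold_right_props:
  assumes Ob: "M \<in> Ob C" "N \<in> Ob C"
  shows "fold_right C M N \<in> hom C (cosmash3 C M N N) (M \<diamond> N)"
    "cosmash_ker C M N \<cdot> fold_right C M N =
      copair C (copair C (in1 C M N) (in2 C M N)) (in2 C M N) \<cdot> cosmash3_ker C M N N"
proof -
  let ?h = "cosmash3_ker C M N N" and ?fold = "copair C (copair C (in1 C M N) (in2 C M N)) (in2 C M N)"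
  note z = cosmash3_ker_zero[OF Ob(1) Ob(2) Ob(2)]
  have "\<exists>w \<in> hom C (cosmash3 C M N N) (M \<diamond> N). cosmash_ker C M N \<cdot> w = ?fold \<cdot> ?h"
  proof (rule cosmash_lift)
    show "?fold \<cdot> ?h \<in> hom C (cosmash3 C M N N) (M \<oplus> N)" using Ob by simp
    have "copair C (\<one> M) (zero C N M) \<cdot> ?fold \<cdot> ?h =
        copair C (\<one> M) (zero C N M) \<cdot> copair C (\<one> (M \<oplus> N)) (zero C N (M \<oplus> N)) \<cdot> ?h"
      using Ob by (simp add: comp_copair)
    then show "copair C (\<one> M) (zero C N M) \<cdot> ?fold \<cdot> ?h = zero C (cosmash3 C M N N) M"
      using z(1) Ob by simp
    have "copair C (zero C M N) (\<one> N) \<cdot> ?fold \<cdot> ?h =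
        copair C (\<one> N) (\<one> N) \<cdot> copair C (copair C (zero C M (N \<oplus> N)) (in1 C N N)) (in2 C N N) \<cdot> ?h"
      using Ob by (simp add: comp_copair)
    then show "copair C (zero C M N) (\<one> N) \<cdot> ?fold \<cdot> ?h = zero C (cosmash3 C M N N) N"
      using z(3) Ob by simp
  qed (use Ob in auto)
  then have *: "\<exists>w. w \<in> hom C (cosmash3 C M N N) (M \<diamond> N) \<and> cosmash_ker C M N \<cdot> w = ?fold \<cdot> ?h" by blast
  show "fold_right C M N \<in> hom C (cosmash3 C M N N) (M \<diamond> N)"
    "cosmash_ker C M N \<cdot> fold_right C M N = ?fold \<cdot> ?h"
    using the_lift[OF _ _ *] Ob unfolding fold_right_def by simp_all
qed

text \<open>Two nested points: \<open>(A + B) \<flat> X\<close> lies over \<open>A \<flat> X\<close>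
  by \<open>[1, 0] \<flat> 1\<close>; its kernel \<open>K1\<close> lies over
  \<open>B \<diamond> X\<close> by the restriction of \<open>[0, 1] \<flat> 1\<close>; and elements
  of the kernel of the latter come from \<open>A \<diamond> B \<diamond> X\<close>. On each level
  \<open>point_eqI\<close> reduces the claim to section and kernel.\<close>

lemma flat_coprod_eqI:
  assumes Ob: "A \<in> Ob C" "B \<in> Ob C" "X \<in> Ob C"
    and fg: "f \<in> hom C ((A \<oplus> B) \<flat> X) Z" "g \<in> hom C ((A \<oplus> B) \<flat> X) Z"
    and 1: "f \<cdot> flat_map C (in1 C A B) (\<one> X) = g \<cdot> flat_map C (in1 C A B) (\<one> X)"
    and 2: "f \<cdot> flat_map C (in2 C A B) (\<one> X) = g \<cdot> flat_map C (in2 C A B) (\<one> X)"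
    and 3: "f \<cdot> cosmash3_to_flat C A B X = g \<cdot> cosmash3_to_flat C A B X"
  shows "f = g"
proof -
  let ?pA = "copair C (\<one> A) (zero C B A)" and ?pB = "copair C (zero C A B) (\<one> B)"
  let ?p = "flat_map C ?pA (\<one> X)" and ?E = "(A \<oplus> B) \<flat> X" and ?k = "flat_ker C (A \<oplus> B) X"
  let ?i2 = "flat_map C (in2 C A B) (\<one> X)" and ?c = "cosmash_to_flat C B X"
  define K1 k1 where "K1 = ker_ob C ?p" and "k1 = ker C ?p"
  have p: "?p \<in> hom C ?E (A \<flat> X)" using Ob by simp
  have k1: "k1 \<in> hom C K1 ?E" "?p \<cdot> k1 = zero C K1 (A \<flat> X)" and K1: "K1 \<in> Ob C"
    unfolding k1_def K1_def using p Ob by simp_all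
  have kk: "?k \<cdot> k1 \<in> hom C K1 ((A \<oplus> B) \<oplus> X)" using k1 Ob by simp
  have pk: "coprod_map C ?pA (\<one> X) \<cdot> ?k \<cdot> k1 = zero C K1 (A \<oplus> X)"
  proof -
    have "flat_ker C A X \<cdot> ?p \<cdot> k1 = zero C K1 (A \<oplus> X)" unfolding k1(2) using Ob K1 by simp
    then show ?thesis using k1(1) Ob by simp
  qed
  have c: "?c \<in> hom C (B \<diamond> X) (B \<flat> X)" "flat_ker C B X \<cdot> ?c = cosmash_ker C B X"
    using cosmash_to_flat_props Ob by blast+
  have "\<exists>w \<in> hom C K1 (B \<diamond> X). cosmash_ker C B X \<cdot> w = coprod_map C ?pB (\<one> X) \<cdot> ?k \<cdot> k1"
  \<comment> \<open>\<open>[0, 1] \<flat> 1\<close> maps \<open>K1\<close> into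
    \<open>B \<diamond> X\<close>, not merely \<open>B \<flat> X\<close>: the component in
    \<open>X\<close> can be computed through \<open>A + X\<close>, where \<open>K1\<close>
    vanishes.\<close>
  proof (rule cosmash_lift)
    show "coprod_map C ?pB (\<one> X) \<cdot> ?k \<cdot> k1 \<in> hom C K1 (B \<oplus> X)" using kk Ob by simp
    show "copair C (\<one> B) (zero C X B) \<cdot> coprod_map C ?pB (\<one> X) \<cdot> ?k \<cdot> k1 = zero C K1 B"
      using k1 kk Ob by simp
    have "copair C (zero C A X) (\<one> X) \<cdot> coprod_map C ?pA (\<one> X) \<cdot> ?k \<cdot> k1 = zero C K1 X"
      unfolding pk using Ob K1 by simp
    then show "copair C (zero C B X) (\<one> X) \<cdot> coprod_map C ?pB (\<one> X) \<cdot> ?k \<cdot> k1 = zero C K1 X"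
      using k1 Ob by simp
  qed (use Ob in auto)
  then obtain p2 where p2: "p2 \<in> hom C K1 (B \<diamond> X)" "cosmash_ker C B X \<cdot> p2 = coprod_map C ?pB (\<one> X) \<cdot> ?k \<cdot> k1"
    by blast
  \<comment> \<open>The inclusion of \<open>B\<close> induces the section: under
    \<open>[1, 0]\<close> only the component in \<open>X\<close> survives, and it vanishes on
    \<open>B \<diamond> X\<close>.\<close>
  have "?p \<cdot> ?i2 \<cdot> ?c = zero C (B \<diamond> X) (A \<flat> X)"
  proof (rule flat_eqI[of _ "B \<diamond> X" A X])
    have z: "in2 C A X \<cdot> copair C (zero C B X) (\<one> X) \<cdot> cosmash_ker C B X = zero C (B \<diamond> X) (A \<oplus> X)"
      using Ob by simp
    have "coprod_map C (zero C B A) (\<one> X) = in2 C A X \<cdot> copair C (zero C B X) (\<one> X)"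
      by (rule coprod_eqI[of _ B X "A \<oplus> X"]) (use Ob in simp_all)
    then have "coprod_map C (zero C B A) (\<one> X) \<cdot> cosmash_ker C B X = zero C (B \<diamond> X) (A \<oplus> X)"
      using z Ob by simp
    then show "flat_ker C A X \<cdot> ?p \<cdot> ?i2 \<cdot> ?c = flat_ker C A X \<cdot> zero C (B \<diamond> X) (A \<flat> X)"
      using c Ob by simp
  qed (use c(1) Ob in simp_all)
  moreover have "?i2 \<cdot> ?c \<in> hom C (B \<diamond> X) ?E" using c Ob by simp
  ultimately obtain s2 where s2: "s2 \<in> hom C (B \<diamond> X) K1" "k1 \<cdot> s2 = ?i2 \<cdot> ?c"
    unfolding k1_def K1_def using ker_lift[of ?p] p by (metis hom_iff)
  have "p2 \<cdot> s2 = \<one> (B \<diamond> X)"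
  proof (rule monicD[of "cosmash_ker C B X" _ "B \<diamond> X"])
    show "cosmash_ker C B X \<cdot> p2 \<cdot> s2 = cosmash_ker C B X \<cdot> \<one> (B \<diamond> X)"
      using el[OF p2(2), of s2] p2(1) s2 k1(1) c Ob by simp
  qed (use p2 s2 Ob in simp_all)
  then have pt2: "is_point C (B \<diamond> X) K1 p2 s2" unfolding is_point_def using p2 s2 by blast
  have "f \<cdot> k1 = g \<cdot> k1"
  proof (rule point_eqI[OF pt2])
    show "f \<cdot> k1 \<in> hom C K1 Z" "g \<cdot> k1 \<in> hom C K1 Z" using fg k1 by simp_all
    show "(f \<cdot> k1) \<cdot> s2 = (g \<cdot> k1) \<cdot> s2"
      using s2 k1(1) fg el[OF 2, of ?c] c(1) Ob by simp
    fix D x assume x: "x \<in> hom C D K1" "p2 \<cdot> x = zero C D (B \<diamond> X)"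
    have D: "D \<in> Ob C" using hom_Ob x by blast
    \<comment> \<open>Such an \<open>x\<close> vanishes in \<open>A + B\<close>,
      \<open>A + X\<close> and \<open>B + X\<close>: by the kernel defining \<open>\<flat>\<close>,
      by membership in \<open>K1\<close>, and by the assumption on \<open>p2\<close>.\<close>
    have "\<exists>v \<in> hom C D (cosmash3 C A B X). cosmash3_ker C A B X \<cdot> v = ?k \<cdot> k1 \<cdot> x"
    proof (rule cosmash3_lift)
      show "?k \<cdot> k1 \<cdot> x \<in> hom C D (A \<oplus> B \<oplus> X)" using x k1 Ob by simp
      show "copair C (\<one> (A \<oplus> B)) (zero C X (A \<oplus> B)) \<cdot> ?k \<cdot> k1 \<cdot> x = zero C D (A \<oplus> B)"
        using x k1 Ob by simp
      have "coprod_map C ?pA (\<one> X) \<cdot> ?k \<cdot> k1 \<cdot> x = zero C D (A \<oplus> X)"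
        using el3[OF pk, of x] x(1) k1(1) Ob by simp
      then show "copair C (copair C (in1 C A X) (zero C B (A \<oplus> X))) (in2 C A X) \<cdot> ?k \<cdot> k1 \<cdot> x = zero C D (A \<oplus> X)"
        using Ob unfolding coprod_map_def by (simp add: comp_copair)
      have "coprod_map C ?pB (\<one> X) \<cdot> ?k \<cdot> k1 \<cdot> x = cosmash_ker C B X \<cdot> p2 \<cdot> x"
        using el[OF p2(2), of x] p2(1) x(1) k1(1) Ob by simp
      then have "coprod_map C ?pB (\<one> X) \<cdot> ?k \<cdot> k1 \<cdot> x = zero C D (B \<oplus> X)"
        using x D Ob by simp
      then show "copair C (copair C (zero C A (B \<oplus> X)) (in1 C B X)) (in2 C B X) \<cdot> ?k \<cdot> k1 \<cdot> x = zero C D (B \<oplus> X)"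
        using Ob unfolding coprod_map_def by (simp add: comp_copair)
    qed (use Ob in auto)
    then obtain v where v: "v \<in> hom C D (cosmash3 C A B X)" "cosmash3_ker C A B X \<cdot> v = ?k \<cdot> k1 \<cdot> x"
      by blast
    note j = cosmash3_to_flat_props[OF Ob]
    have "k1 \<cdot> x = cosmash3_to_flat C A B X \<cdot> v"
      by (rule flat_eqI[of _ D "A \<oplus> B" X]) (use el[OF j(2), of v] j(1) v x k1(1) Ob in simp_all)
    then show "(f \<cdot> k1) \<cdot> x = (g \<cdot> k1) \<cdot> x"
      using el[OF 3, of v] v(1) x k1(1) fg j(1) by simp
  qed
  note fk = el[OF this]
  have pt: "is_point C (A \<flat> X) ?E ?p (flat_map C (in1 C A B) (\<one> X))"
  proof -
    have e: "flat_ker C A X \<cdot> flat_map C (\<one> A) (\<one> X) = flat_ker C A X \<cdot> \<one> (A \<flat> X)"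
      using Ob by simp
    have "flat_map C (\<one> A) (\<one> X) = \<one> (A \<flat> X)"
      by (rule flat_eqI[OF _ _ Ob(1,3) e]) (use Ob in simp_all)
    then show ?thesis unfolding is_point_def using Ob by simp
  qed
  show ?thesis
  proof (rule point_eqI[OF pt fg 1])
    fix D x assume x: "x \<in> hom C D ?E" "?p \<cdot> x = zero C D (A \<flat> X)"
    then obtain y where "y \<in> hom C D K1" "k1 \<cdot> y = x"
      unfolding k1_def K1_def using ker_lift[of ?p] p by (metis hom_iff)
    then show "f \<cdot> x = g \<cdot> x" using fk[of y] fg k1 by auto
  qed
qed

section \<open>From compatible actions to crossed modules\<close>

lemma coprod_swap_eq [simp]: "coprod_swap C A B = copair C (in2 C B A) (in1 C B A)"
  unfolding coprod_swap_def ..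

text \<open>\<open>i\<close> satisfies the Peiffer identity over \<open>B\<close>, while its
  equivariance is known only after \<open>q\<close>; passing to \<open>L\<close> is what repairs
  this. The resulting identity on \<open>L \<flat> X\<close> is tested on the regular epimorphism
  \<open>q \<flat> 1\<close>.\<close>

lemma crossed_module_descent:
  assumes \<zeta>: "internal_action C B X \<zeta>" and q: "regular_epi C q" "q \<in> hom C B L"
    and \<xi>: "\<xi> \<in> hom C (L \<flat> X) X" "\<xi> \<cdot> flat_map C q (\<one> X) = \<zeta>" and i: "i \<in> hom C X B"
    and peiffer: "\<zeta> \<cdot> flat_map C i (\<one> X) = conjugation C X"
    and equiv: "q \<cdot> i \<cdot> \<zeta> = q \<cdot> copair C (\<one> B) i \<cdot> flat_ker C B X"
  shows "crossed_module C X L (q \<cdot> i) \<xi>"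
proof -
  note a = internal_actionD[OF \<zeta>]
  have L: "L \<in> Ob C" using hom_Ob q by blast
  have X: "\<one> X \<in> hom C X X" "regular_epi C (\<one> X)" using ident_hom regular_epi_ident a(2) by auto
  have qX: "regular_epi C (flat_map C q (\<one> X))" using flat_map_regular_epi[OF q X(2,1)] .
  have qi: "q \<cdot> i \<in> hom C X L" using q i by simp
  have act: "internal_action C L X \<xi>" using internal_action_descent[OF \<zeta> q \<xi>] .
  have "flat_map C (q \<cdot> i) (\<one> X) = flat_map C q (\<one> X) \<cdot> flat_map C i (\<one> X)"
    using q(2) i a(2) by simp
  then have 1: "\<xi> \<cdot> flat_map C (q \<cdot> i) (\<one> X) = conjugation C X"
    using el[OF \<xi>(2), of "flat_map C i (\<one> X)"] peiffer \<xi>(1) q(2) i a(2) by simp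
  have 2: "(q \<cdot> i) \<cdot> \<xi> = conjugation C L \<cdot> flat_map C (\<one> L) (q \<cdot> i)"
  proof (rule regular_epi_cancel[OF qX])
    show "(q \<cdot> i) \<cdot> \<xi> \<in> hom C (Cod C (flat_map C q (\<one> X))) L"
      "conjugation C L \<cdot> flat_map C (\<one> L) (q \<cdot> i) \<in> hom C (Cod C (flat_map C q (\<one> X))) L"
      using q(2) i \<xi>(1) L a(2) by simp_all
    have "((q \<cdot> i) \<cdot> \<xi>) \<cdot> flat_map C q (\<one> X) = q \<cdot> i \<cdot> \<zeta>"
      using \<xi> q(2) i a(2) by simp
    also have "\<dots> = copair C q (q \<cdot> i) \<cdot> flat_ker C B X"
      using equiv q(2) i a(1,2) by (simp add: comp_copair)
    also have "\<dots> = (conjugation C L \<cdot> flat_map C (\<one> L) (q \<cdot> i)) \<cdot> flat_map C q (\<one> X)"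
      using conjugation_flat_map[OF q(2) qi] q(2) i L a(2) by simp
    finally show "((q \<cdot> i) \<cdot> \<xi>) \<cdot> flat_map C q (\<one> X) =
      (conjugation C L \<cdot> flat_map C (\<one> L) (q \<cdot> i)) \<cdot> flat_map C q (\<one> X)" .
  qed
  show ?thesis unfolding crossed_module_def using qi act 1 2 by blast
qed

lemma compatible_imp_crossed_modules:
  assumes \<xi>MN: "internal_action C M N \<xi>MN" and \<xi>NM: "internal_action C N M \<xi>NM"
    and comp: "compatible C M N \<xi>MN \<xi>NM"
  shows "\<exists>L \<in> Ob C. \<exists>\<mu> \<nu> \<xi>LM \<xi>LN. crossed_module C M L \<mu> \<xi>LM \<and> crossed_module C N L \<nu> \<xi>LN \<and>
    \<xi>MN = \<xi>LN \<cdot> flat_map C \<mu> (\<one> N) \<and> \<xi>NM = \<xi>LM \<cdot> flat_map C \<nu> (\<one> M)"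
proof -
  obtain \<zeta>M \<zeta>N where \<zeta>M: "internal_action C (M \<oplus> N) M \<zeta>M" and \<zeta>N: "internal_action C (M \<oplus> N) N \<zeta>N"
    and CM: "CA0_M C M N \<xi>NM \<zeta>M" and CN: "CA0_N C M N \<xi>MN \<zeta>N"
    and CAM: "CA_on C M N \<xi>MN \<xi>NM M \<zeta>M" and CAN: "CA_on C M N \<xi>MN \<xi>NM N \<zeta>N"
    using comp unfolding compatible_def by blast
  note a = internal_actionD[OF \<xi>MN] and b = internal_actionD[OF \<xi>NM]
    and z = internal_actionD(3)[OF \<zeta>M] internal_actionD(3)[OF \<zeta>N]
  note Ob = a(1,2)
  note CM = CM[unfolded CA0_M_def] and CN = CN[unfolded CA0_N_def]
  let ?kN = "flat_ker C N M" and ?kM = "flat_ker C M N" and ?B = "M \<oplus> N" and ?S = "(N \<flat> M) \<oplus> (M \<flat> N)"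
  let ?f = "coprod_map C \<xi>NM \<xi>MN" and ?g = "copair C (coprod_swap C N M \<cdot> ?kN) ?kM"
    and ?\<sigma> = "coprod_map C (flat_unit C N M) (flat_unit C M N)"
  have fg: "?f \<in> hom C ?S ?B" "?g \<in> hom C ?S ?B" and \<sigma>: "?\<sigma> \<in> hom C ?B ?S"
    using a(3) b(3) Ob by simp_all
  \<comment> \<open>The monad units give the common section: by the unit law of the actions for
    \<open>?f\<close>, and by \<open>k \<eta> = i\<close> for \<open>?g\<close>.\<close>
  have f\<sigma>: "?f \<cdot> ?\<sigma> = \<one> ?B"
    by (rule coprod_eqI[of _ M N ?B]) (use a b in simp_all)
  have g\<sigma>: "?g \<cdot> ?\<sigma> = \<one> ?B"
    using Ob by simp
  obtain L q where co: "is_coequalizer C ?f ?g L q" and q: "q \<in> hom C ?B L"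
    using reflexive_coequalizer_ex[OF fg \<sigma> f\<sigma> g\<sigma>] .
  have rq: "regular_epi C q" using coequalizer_regular_epi[OF co] .
  have L: "L \<in> Ob C" using hom_Ob q by blast
  note e = el[OF coequalizer_simps(2)[OF co]]
  \<comment> \<open>The relations defining \<open>L\<close>: acting, and conjugating inside
    \<open>M + N\<close>, become equal under \<open>q\<close>.\<close>
  have qM: "q \<cdot> in1 C M N \<cdot> \<xi>NM = q \<cdot> copair C (in2 C M N) (in1 C M N) \<cdot> ?kN"
    using e[of "in1 C (N \<flat> M) (M \<flat> N)"] q fg(1) a(3) b(3) Ob by simp
  have qN: "q \<cdot> in2 C M N \<cdot> \<xi>MN = q \<cdot> ?kM"
    using e[of "in2 C (N \<flat> M) (M \<flat> N)"] q fg(1) a(3) b(3) Ob by simp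
  \<comment> \<open>(CA.M) is literally the condition for \<open>\<zeta>M\<close> to descend along
    \<open>q \<flat> 1\<close>, and (CA.N) that for \<open>\<zeta>N\<close>.\<close>
  obtain \<xi>LM where \<xi>LM: "\<xi>LM \<in> hom C (L \<flat> M) M" "\<xi>LM \<cdot> flat_map C q (\<one> M) = \<zeta>M"
    using flat_map_coequalizer_factor[OF fg \<sigma> f\<sigma> g\<sigma> co Ob(1) z(1)] CAM[unfolded CA_on_def] by blast
  obtain \<xi>LN where \<xi>LN: "\<xi>LN \<in> hom C (L \<flat> N) N" "\<xi>LN \<cdot> flat_map C q (\<one> N) = \<zeta>N"
    using flat_map_coequalizer_factor[OF fg \<sigma> f\<sigma> g\<sigma> co Ob(2) z(2)] CAN[unfolded CA_on_def] by blast
  have equivM: "q \<cdot> in1 C M N \<cdot> \<zeta>M = q \<cdot> copair C (\<one> ?B) (in1 C M N) \<cdot> flat_ker C ?B M"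
  proof (rule flat_coprod_eqI[OF Ob Ob(1), of _ L])
    show "q \<cdot> in1 C M N \<cdot> \<zeta>M \<in> hom C (?B \<flat> M) L"
      "q \<cdot> copair C (\<one> ?B) (in1 C M N) \<cdot> flat_ker C ?B M \<in> hom C (?B \<flat> M) L"
      using q z Ob by simp_all
    have "(q \<cdot> in1 C M N \<cdot> \<zeta>M) \<cdot> flat_map C (in1 C M N) (\<one> M) = q \<cdot> in1 C M N \<cdot> conjugation C M"
      using CM q z(1) Ob by simp
    then show "(q \<cdot> in1 C M N \<cdot> \<zeta>M) \<cdot> flat_map C (in1 C M N) (\<one> M) =
      (q \<cdot> copair C (\<one> ?B) (in1 C M N) \<cdot> flat_ker C ?B M) \<cdot> flat_map C (in1 C M N) (\<one> M)"
      using q Ob unfolding conjugation_def by (simp add: comp_copair)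
    have "(q \<cdot> in1 C M N \<cdot> \<zeta>M) \<cdot> flat_map C (in2 C M N) (\<one> M) = q \<cdot> in1 C M N \<cdot> \<xi>NM"
      using CM q z(1) Ob by simp
    then show "(q \<cdot> in1 C M N \<cdot> \<zeta>M) \<cdot> flat_map C (in2 C M N) (\<one> M) =
      (q \<cdot> copair C (\<one> ?B) (in1 C M N) \<cdot> flat_ker C ?B M) \<cdot> flat_map C (in2 C M N) (\<one> M)"
      using qM q Ob by (simp add: comp_copair)
    \<comment> \<open>On the ternary part, (CA.0) expresses \<open>\<zeta>M\<close> by
      \<open>\<xi>NM\<close> after folding; \<open>qM\<close> turns this into conjugation, and
      \<open>[1, i]\<close> on \<open>M + N + M\<close> is the folding up to the swap.\<close>
    note c = cosmash_to_flat_props[OF Ob(2,1)] and j = cosmash3_to_flat_props[OF Ob Ob(1)]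
      and f = fold_outer_props[OF Ob]
    have "(q \<cdot> in1 C M N \<cdot> \<zeta>M) \<cdot> cosmash3_to_flat C M N M =
        q \<cdot> in1 C M N \<cdot> \<xi>NM \<cdot> cosmash_to_flat C N M \<cdot> fold_outer C N M"
      using CM q z(1) j(1) Ob by simp
    also have "\<dots> = q \<cdot> copair C (in2 C M N) (in1 C M N) \<cdot> cosmash_ker C N M \<cdot> fold_outer C N M"
      using el3[OF qM, of "cosmash_to_flat C N M \<cdot> fold_outer C N M"] el[OF c(2), of "fold_outer C N M"]
        q b(3) c(1) f(1) Ob by simp
    also have "\<dots> = (q \<cdot> copair C (\<one> ?B) (in1 C M N) \<cdot> flat_ker C ?B M) \<cdot> cosmash3_to_flat C M N M"
      using f(2) q j Ob by (simp add: comp_copair)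
    finally show "(q \<cdot> in1 C M N \<cdot> \<zeta>M) \<cdot> cosmash3_to_flat C M N M =
      (q \<cdot> copair C (\<one> ?B) (in1 C M N) \<cdot> flat_ker C ?B M) \<cdot> cosmash3_to_flat C M N M" .
  qed
  have equivN: "q \<cdot> in2 C M N \<cdot> \<zeta>N = q \<cdot> copair C (\<one> ?B) (in2 C M N) \<cdot> flat_ker C ?B N"
  proof (rule flat_coprod_eqI[OF Ob Ob(2), of _ L])
    show "q \<cdot> in2 C M N \<cdot> \<zeta>N \<in> hom C (?B \<flat> N) L"
      "q \<cdot> copair C (\<one> ?B) (in2 C M N) \<cdot> flat_ker C ?B N \<in> hom C (?B \<flat> N) L"
      using q z Ob by simp_all
    have "(q \<cdot> in2 C M N \<cdot> \<zeta>N) \<cdot> flat_map C (in2 C M N) (\<one> N) = q \<cdot> in2 C M N \<cdot> conjugation C N"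
      using CN q z(2) Ob by simp
    then show "(q \<cdot> in2 C M N \<cdot> \<zeta>N) \<cdot> flat_map C (in2 C M N) (\<one> N) =
      (q \<cdot> copair C (\<one> ?B) (in2 C M N) \<cdot> flat_ker C ?B N) \<cdot> flat_map C (in2 C M N) (\<one> N)"
      using q Ob unfolding conjugation_def by (simp add: comp_copair)
    have "(q \<cdot> in2 C M N \<cdot> \<zeta>N) \<cdot> flat_map C (in1 C M N) (\<one> N) = q \<cdot> in2 C M N \<cdot> \<xi>MN"
      using CN q z(2) Ob by simp
    then show "(q \<cdot> in2 C M N \<cdot> \<zeta>N) \<cdot> flat_map C (in1 C M N) (\<one> N) =
      (q \<cdot> copair C (\<one> ?B) (in2 C M N) \<cdot> flat_ker C ?B N) \<cdot> flat_map C (in1 C M N) (\<one> N)"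
      using qN q Ob by simp
    note c = cosmash_to_flat_props[OF Ob] and j = cosmash3_to_flat_props[OF Ob Ob(2)]
      and f = fold_right_props[OF Ob]
    have "(q \<cdot> in2 C M N \<cdot> \<zeta>N) \<cdot> cosmash3_to_flat C M N N =
        q \<cdot> in2 C M N \<cdot> \<xi>MN \<cdot> cosmash_to_flat C M N \<cdot> fold_right C M N"
      using CN q z(2) j(1) Ob by simp
    also have "\<dots> = q \<cdot> cosmash_ker C M N \<cdot> fold_right C M N"
      using el3[OF qN, of "cosmash_to_flat C M N \<cdot> fold_right C M N"] el[OF c(2), of "fold_right C M N"]
        q a(3) c(1) f(1) Ob by simp
    also have "\<dots> = (q \<cdot> copair C (\<one> ?B) (in2 C M N) \<cdot> flat_ker C ?B N) \<cdot> cosmash3_to_flat C M N N"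
      using f(2) q j Ob by simp
    finally show "(q \<cdot> in2 C M N \<cdot> \<zeta>N) \<cdot> cosmash3_to_flat C M N N =
      (q \<cdot> copair C (\<one> ?B) (in2 C M N) \<cdot> flat_ker C ?B N) \<cdot> cosmash3_to_flat C M N N" .
  qed
  have "crossed_module C M L (q \<cdot> in1 C M N) \<xi>LM"
    by (rule crossed_module_descent[OF \<zeta>M rq q \<xi>LM _ _ equivM]) (use CM Ob in simp_all)
  moreover have "crossed_module C N L (q \<cdot> in2 C M N) \<xi>LN"
    by (rule crossed_module_descent[OF \<zeta>N rq q \<xi>LN _ _ equivN]) (use CN Ob in simp_all)
  moreover have "flat_map C (q \<cdot> in1 C M N) (\<one> N) = flat_map C q (\<one> N) \<cdot> flat_map C (in1 C M N) (\<one> N)"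
    "flat_map C (q \<cdot> in2 C M N) (\<one> M) = flat_map C q (\<one> M) \<cdot> flat_map C (in2 C M N) (\<one> M)"
    using q Ob by simp_all
  then have "\<xi>MN = \<xi>LN \<cdot> flat_map C (q \<cdot> in1 C M N) (\<one> N)" "\<xi>NM = \<xi>LM \<cdot> flat_map C (q \<cdot> in2 C M N) (\<one> M)"
    using el[OF \<xi>LN(2), of "flat_map C (in1 C M N) (\<one> N)"] el[OF \<xi>LM(2), of "flat_map C (in2 C M N) (\<one> M)"]
      CM CN \<xi>LM(1) \<xi>LN(1) q Ob by simp_all
  ultimately show ?thesis using L by blast
qed

section \<open>Semidirect products and the graph of a crossed module\<close>

text \<open>\<open>G\<close> is \<open>A + X\<close> with each element \<open>b\<close> of
  \<open>A \<flat> X\<close> identified with \<open>\<xi> b\<close> in \<open>X\<close>, which makes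
  the universal property immediate. The content is that \<open>X\<close> survives this quotient and
  is the whole kernel.\<close>

lemma semidirect_product:
  assumes \<xi>: "internal_action C A X \<xi>"
  obtains G p s k where "is_point C A G p s" "is_kernel C p X k" "k \<in> hom C X G"
    "k \<cdot> \<xi> = copair C s k \<cdot> flat_ker C A X"
    "\<forall>Z. \<forall>a \<in> hom C A Z. \<forall>b \<in> hom C X Z. copair C a b \<cdot> flat_ker C A X = b \<cdot> \<xi> \<longrightarrow>
      (\<exists>t \<in> hom C G Z. t \<cdot> s = a \<and> t \<cdot> k = b)"
proof -
  note a = internal_actionD[OF \<xi>]
  note Ob = a(1,2)
  let ?FX = "A \<flat> X" and ?i1 = "in1 C A X" and ?i2 = "in2 C A X"
  let ?d0 = "copair C ?i1 (flat_ker C A X)" and ?d1 = "coprod_map C (\<one> A) \<xi>"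
    and ?\<sigma> = "coprod_map C (\<one> A) (flat_unit C A X)" and ?r = "copair C (\<one> A) (zero C X A)"
  have d: "?d0 \<in> hom C (A \<oplus> ?FX) (A \<oplus> X)" "?d1 \<in> hom C (A \<oplus> ?FX) (A \<oplus> X)"
    and \<sigma>: "?\<sigma> \<in> hom C (A \<oplus> X) (A \<oplus> ?FX)" "?d0 \<cdot> ?\<sigma> = \<one> (A \<oplus> X)" "?d1 \<cdot> ?\<sigma> = \<one> (A \<oplus> X)"
    using a by simp_all
  obtain G q where co: "is_coequalizer C ?d0 ?d1 G q" and q: "q \<in> hom C (A \<oplus> X) G"
    using reflexive_coequalizer_ex[OF d \<sigma>] .
  have rq: "regular_epi C q" using coequalizer_regular_epi[OF co] .
  have G: "G \<in> Ob C" using hom_Ob q by blast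
  note qd = coequalizer_simps(2)[OF co]
  define s k where "s = q \<cdot> ?i1" and "k = q \<cdot> ?i2"
  have s: "s \<in> hom C A G" and k: "k \<in> hom C X G" unfolding s_def k_def using q Ob by simp_all
  have "?r \<cdot> ?d0 = ?r \<cdot> ?d1" using a by (simp add: comp_copair)
  moreover have "?r \<in> hom C (Cod C ?d0) A" using Ob by simp
  ultimately obtain p where p: "p \<in> hom C G A" "p \<cdot> q = ?r" using coequalizer_lift[OF co] by metis
  note ep = el[OF p(2)]
  have ps: "p \<cdot> s = \<one> A" and pk: "p \<cdot> k = zero C X A"
    unfolding s_def k_def using ep[of ?i1] ep[of ?i2] p(1) q Ob by simp_all
  have k\<xi>: "k \<cdot> \<xi> = q \<cdot> flat_ker C A X"
    unfolding k_def using el[OF qd, of "in2 C A ?FX"] q a(3) Ob by simp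
  have sk: "copair C s k = q"
    by (rule coprod_eqI[of _ A X G]) (use s k q Ob s_def k_def in simp_all)
  \<comment> \<open>If \<open>q\<close> identifies \<open>x\<close> and \<open>y\<close>, one
    element \<open>w\<close> relates them locally. It vanishes in \<open>A\<close>, so it comes from
    some \<open>v\<close> of \<open>A \<flat> (A \<flat> X)\<close>, whose images under the
    multiplication and under \<open>1 \<flat> \<xi>\<close> are the units at \<open>x\<close> and at
    \<open>y\<close>; the action laws then give \<open>x = y\<close>.\<close>
  have mk: "monic C k"
  proof (rule monicI[OF k])
    fix D x y assume xy: "x \<in> hom C D X" "y \<in> hom C D X" "k \<cdot> x = k \<cdot> y"
    have "q \<cdot> ?i2 \<cdot> x = q \<cdot> ?i2 \<cdot> y" using xy q Ob unfolding k_def by simp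
    moreover have "?i2 \<cdot> x \<in> hom C D (A \<oplus> X)" "?i2 \<cdot> y \<in> hom C D (A \<oplus> X)" using xy Ob by simp_all
    ultimately obtain D' r w where r: "regular_epi C r" "r \<in> hom C D' D" and w: "w \<in> hom C D' (A \<oplus> ?FX)"
      "?d0 \<cdot> w = (?i2 \<cdot> x) \<cdot> r" "?d1 \<cdot> w = (?i2 \<cdot> y) \<cdot> r"
      using reflexive_coequalizer_kernel_pair[OF d \<sigma> co] by metis
    have "copair C (\<one> A) (zero C ?FX A) \<cdot> w = ?r \<cdot> ?d0 \<cdot> w"
      using w(1) Ob by (simp add: comp_copair)
    also have "\<dots> = zero C D' A" using w(2) r xy Ob by simp
    finally obtain v where v: "v \<in> hom C D' (A \<flat> ?FX)" "flat_ker C A ?FX \<cdot> v = w"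
      using flat_lift[OF w(1)] Ob by auto
    have "flat_ker C A X \<cdot> flat_mult C A X \<cdot> v = flat_ker C A X \<cdot> flat_unit C A X \<cdot> x \<cdot> r"
      using v w(2) xy r Ob by simp
    then have 1: "flat_mult C A X \<cdot> v = flat_unit C A X \<cdot> x \<cdot> r"
      using flat_eqI[of "flat_mult C A X \<cdot> v" D' A X "flat_unit C A X \<cdot> x \<cdot> r"] v(1) xy r Ob by simp
    have "flat_ker C A X \<cdot> flat_map C (\<one> A) \<xi> \<cdot> v = flat_ker C A X \<cdot> flat_unit C A X \<cdot> y \<cdot> r"
      using v w(3) xy r a(3) Ob by simp
    then have 2: "flat_map C (\<one> A) \<xi> \<cdot> v = flat_unit C A X \<cdot> y \<cdot> r"
      using flat_eqI[of "flat_map C (\<one> A) \<xi> \<cdot> v" D' A X "flat_unit C A X \<cdot> y \<cdot> r"] v(1) xy r a(3) Ob by simp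
    have "x \<cdot> r = y \<cdot> r"
      using el[OF a(5), of v] el[OF a(4), of "x \<cdot> r"] el[OF a(4), of "y \<cdot> r"] 1 2 v(1) xy r a(3) Ob by simp
    then show "x = y" using regular_epi_cancel[OF r(1), of x X y] xy r by simp
  qed
  have ker: "is_kernel C p X k"
  proof (rule is_kernelI[OF p(1) k mk pk])
    fix D u assume u: "u \<in> hom C D G" "p \<cdot> u = zero C D A"
    \<comment> \<open>A local preimage \<open>b\<close> of \<open>u\<close> in \<open>A + X\<close>
      lies in \<open>A \<flat> X\<close>, where \<open>q\<close> is given by
      \<open>k \<xi>\<close>.\<close>
    obtain D' r b where r: "regular_epi C r" "r \<in> hom C D' D" and b: "b \<in> hom C D' (A \<oplus> X)" "q \<cdot> b = u \<cdot> r"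
      using regular_epi_cover[OF rq q u(1)] .
    have "?r \<cdot> b = zero C D' A"
      using ep[of b] el[OF u(2), of r] b r u(1) p(1) q Ob by simp
    then obtain c where c: "c \<in> hom C D' ?FX" "flat_ker C A X \<cdot> c = b" using flat_lift[OF b(1)] Ob by blast
    have "k \<cdot> \<xi> \<cdot> c = u \<cdot> r" using el[OF k\<xi>, of c] c b(2) k a(3) q Ob by simp
    moreover have "\<xi> \<cdot> c \<in> hom C D' X" using c a(3) by simp
    ultimately show "\<exists>v \<in> hom C D X. k \<cdot> v = u" using regular_epi_lift[OF r mk k u(1)] by blast
  qed
  have up: "\<exists>t \<in> hom C G Z. t \<cdot> s = f \<and> t \<cdot> k = g"
    if fg: "f \<in> hom C A Z" "g \<in> hom C X Z" "copair C f g \<cdot> flat_ker C A X = g \<cdot> \<xi>" for Z f g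
  proof -
    have "copair C f g \<cdot> ?d0 = copair C f g \<cdot> ?d1" using fg a by (simp add: comp_copair)
    moreover have "copair C f g \<in> hom C (Cod C ?d0) Z" using fg Ob by simp
    ultimately obtain t where t: "t \<in> hom C G Z" "t \<cdot> q = copair C f g" using coequalizer_lift[OF co] by metis
    have "t \<cdot> s = f" "t \<cdot> k = g"
      unfolding s_def k_def using el[OF t(2), of ?i1] el[OF t(2), of ?i2] t(1) q fg Ob by simp_all
    then show ?thesis using t by blast
  qed
  have "is_point C A G p s" unfolding is_point_def using p s ps by blast
  moreover have "\<forall>Z. \<forall>f \<in> hom C A Z. \<forall>g \<in> hom C X Z. copair C f g \<cdot> flat_ker C A X = g \<cdot> \<xi> \<longrightarrow>
      (\<exists>t \<in> hom C G Z. t \<cdot> s = f \<and> t \<cdot> k = g)"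
    using up by blast
  moreover have "k \<cdot> \<xi> = copair C s k \<cdot> flat_ker C A X" using k\<xi> sk by simp
  ultimately show ?thesis using that ker k by blast
qed

text \<open>\<open>\<xi>\<close> is conjugation inside \<open>E\<close> by \<open>s\<close>; both
  action laws become identities between copairs after the monic \<open>k\<close>. This is how
  conjugation on \<open>X\<close> is recognised as an action.\<close>

lemma point_internal_action:
  assumes s: "s \<in> hom C A E" and k: "k \<in> hom C X E" "monic C k" and \<xi>: "\<xi> \<in> hom C (A \<flat> X) X"
    "k \<cdot> \<xi> = copair C s k \<cdot> flat_ker C A X"
  shows "internal_action C A X \<xi>"
proof -
  have Ob: "A \<in> Ob C" "X \<in> Ob C" using hom_Ob s k by auto
  note e = el[OF \<xi>(2)]
  have "k \<cdot> \<xi> \<cdot> flat_unit C A X = k \<cdot> \<one> X"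
    using e[of "flat_unit C A X"] \<xi>(1) k(1) s Ob by simp
  then have "\<xi> \<cdot> flat_unit C A X = \<one> X"
    by (rule monicD[OF k(2), rotated -1]) (use \<xi>(1) k(1) Ob in simp_all)
  moreover have "\<xi> \<cdot> flat_mult C A X = \<xi> \<cdot> flat_map C (\<one> A) \<xi>"
  proof (rule monicD[OF k(2)])
    have "k \<cdot> \<xi> \<cdot> flat_mult C A X = copair C s (copair C s k \<cdot> flat_ker C A X) \<cdot> flat_ker C A (A \<flat> X)"
      using e[of "flat_mult C A X"] \<xi>(1) k(1) s Ob by (simp add: comp_copair)
    moreover have "k \<cdot> \<xi> \<cdot> flat_map C (\<one> A) \<xi> = copair C s (k \<cdot> \<xi>) \<cdot> flat_ker C A (A \<flat> X)"
      using e[of "flat_map C (\<one> A) \<xi>"] \<xi>(1) k(1) s Ob by simp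
    ultimately show "k \<cdot> \<xi> \<cdot> flat_mult C A X = k \<cdot> \<xi> \<cdot> flat_map C (\<one> A) \<xi>" using \<xi>(2) by simp
  qed (use \<xi> k(1) Ob in simp_all)
  ultimately show ?thesis unfolding internal_action_def using \<xi> Ob by blast
qed

lemma square_point:
  assumes X: "X \<in> Ob C"
  shows "is_point C X (prod_ob C X X) (proj2 C X X) (pair C (\<one> X) (\<one> X))"
  unfolding is_point_def using X by simp

lemma square_kernel:
  assumes X: "X \<in> Ob C" and x: "x \<in> hom C D (prod_ob C X X)" "proj2 C X X \<cdot> x = zero C D X"
  shows "x = pair C (\<one> X) (zero C X X) \<cdot> proj1 C X X \<cdot> x"
  by (rule prod_eqI[of _ D X X]) (use x X hom_Ob(1)[OF x(1)] in simp_all)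

text \<open>\<open>c\<close> extends \<open>(1, \<delta>)\<close> to the semidirect product, by
  equivariance. For \<open>\<phi>\<close>: the square \<open>X \<times> X\<close>, with second
  projection, diagonal and \<open>(x, 0)\<close>, is the semidirect product of \<open>X\<close> with
  itself under conjugation, so the Peiffer identity is what extends \<open>(s \<delta>, k)\<close>
  to it.\<close>

lemma crossed_module_graph:
  assumes cm: "crossed_module C X L \<delta> \<xi>"
  obtains G d c s k \<phi> where "is_point C L G d s" "is_kernel C d X k"
    "k \<cdot> \<xi> = copair C s k \<cdot> flat_ker C L X" "c \<in> hom C G L" "c \<cdot> s = \<one> L" "c \<cdot> k = \<delta>"
    "\<phi> \<in> hom C (prod_ob C X X) G" "\<phi> \<cdot> pair C (\<one> X) (zero C X X) = k" "\<phi> \<cdot> pair C (\<one> X) (\<one> X) = s \<cdot> \<delta>"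
proof -
  have \<delta>: "\<delta> \<in> hom C X L" and act: "internal_action C L X \<xi>"
    and peiffer: "\<xi> \<cdot> flat_map C \<delta> (\<one> X) = conjugation C X"
    and equiv: "\<delta> \<cdot> \<xi> = conjugation C L \<cdot> flat_map C (\<one> L) \<delta>"
    using cm unfolding crossed_module_def by blast+
  note a = internal_actionD[OF act]
  note Ob = a(1,2)
  obtain G d s k where pt: "is_point C L G d s" and ker: "is_kernel C d X k" and k: "k \<in> hom C X G"
    and k\<xi>: "k \<cdot> \<xi> = copair C s k \<cdot> flat_ker C L X"
    and up: "\<forall>Z. \<forall>f \<in> hom C L Z. \<forall>g \<in> hom C X Z. copair C f g \<cdot> flat_ker C L X = g \<cdot> \<xi> \<longrightarrow>
      (\<exists>t \<in> hom C G Z. t \<cdot> s = f \<and> t \<cdot> k = g)"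
    using semidirect_product[OF act] .
  have ds: "d \<in> hom C G L" "s \<in> hom C L G" using pt unfolding is_point_def by auto
  have L1: "\<one> L \<in> hom C L L" using ident_hom Ob by blast
  have "copair C (\<one> L) \<delta> \<cdot> flat_ker C L X = \<delta> \<cdot> \<xi>"
    using equiv conjugation_flat_map[OF L1 \<delta>] by simp
  then obtain c where c: "c \<in> hom C G L" "c \<cdot> s = \<one> L" "c \<cdot> k = \<delta>" using up L1 \<delta> by blast
  let ?\<Delta> = "pair C (\<one> X) (\<one> X)" and ?j = "pair C (\<one> X) (zero C X X)" and ?X2 = "prod_ob C X X"
  have \<Delta>j: "?\<Delta> \<in> hom C X ?X2" "?j \<in> hom C X ?X2" using Ob by simp_all
  have mj: "monic C ?j"
  proof (rule monicI[OF \<Delta>j(2)])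
    fix D x y assume xy: "x \<in> hom C D X" "y \<in> hom C D X" "?j \<cdot> x = ?j \<cdot> y"
    have "pair C x (zero C D X) = pair C y (zero C D X)" using xy Ob by simp
    then show "x = y" using pair_inject(1)[of x _ y _ D X X] xy Ob hom_Ob(1)[OF xy(1)] by simp
  qed
  have jc: "copair C ?\<Delta> ?j \<cdot> flat_ker C X X = ?j \<cdot> conjugation C X"
  proof (rule prod_eqI[of _ "X \<flat> X" X X])
    show "proj1 C X X \<cdot> copair C ?\<Delta> ?j \<cdot> flat_ker C X X = proj1 C X X \<cdot> ?j \<cdot> conjugation C X"
      using Ob unfolding conjugation_def by (simp add: comp_copair)
    show "proj2 C X X \<cdot> copair C ?\<Delta> ?j \<cdot> flat_ker C X X = proj2 C X X \<cdot> ?j \<cdot> conjugation C X"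
      using Ob by (simp add: comp_copair)
  qed (use Ob in simp_all)
  have "conjugation C X \<in> hom C (X \<flat> X) X" using Ob by simp
  then have "internal_action C X X (conjugation C X)"
    using point_internal_action[OF \<Delta>j mj _ jc[symmetric]] by blast
  then obtain H p t l where ptH: "is_point C X H p t" and kerH: "is_kernel C p X l" and l: "l \<in> hom C X H"
    and upH: "\<forall>Z. \<forall>f \<in> hom C X Z. \<forall>g \<in> hom C X Z. copair C f g \<cdot> flat_ker C X X = g \<cdot> conjugation C X \<longrightarrow>
      (\<exists>h \<in> hom C H Z. h \<cdot> t = f \<and> h \<cdot> l = g)"
    by (rule semidirect_product)
  have pt': "p \<in> hom C H X" "t \<in> hom C X H" "p \<cdot> t = \<one> X" using ptH unfolding is_point_def by auto
  obtain h where h: "h \<in> hom C H ?X2" "h \<cdot> t = ?\<Delta>" "h \<cdot> l = ?j" using upH \<Delta>j jc by blast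
  have s\<delta>: "s \<cdot> \<delta> \<in> hom C X G" using ds \<delta> by simp
  have "flat_ker C L X \<cdot> flat_map C \<delta> (\<one> X) = coprod_map C \<delta> (\<one> X) \<cdot> flat_ker C X X" using \<delta> Ob by simp
  then have "copair C s k \<cdot> flat_ker C L X \<cdot> flat_map C \<delta> (\<one> X) = copair C (s \<cdot> \<delta>) k \<cdot> flat_ker C X X"
    using ds k \<delta> Ob by simp
  then have "copair C (s \<cdot> \<delta>) k \<cdot> flat_ker C X X = k \<cdot> conjugation C X"
    using el[OF k\<xi>, of "flat_map C \<delta> (\<one> X)"] peiffer k ds a(3) \<delta> Ob by simp
  then obtain \<psi> where \<psi>: "\<psi> \<in> hom C H G" "\<psi> \<cdot> t = s \<cdot> \<delta>" "\<psi> \<cdot> l = k" using upH s\<delta> k by blast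
  note kH = is_kernelD[OF kerH]
  \<comment> \<open>\<open>h\<close> compares the semidirect product \<open>H\<close> with the
    square; both kernels are \<open>X\<close>, by \<open>l\<close> and by \<open>(x, 0)\<close>, so
    protomodularity applies.\<close>
  have "is_iso C H ?X2 h"
  proof (rule point_iso_kernel[OF ptH square_point[OF Ob(2)] h(1) _ h(2)])
    show "proj2 C X X \<cdot> h = p"
    proof (rule point_eqI[OF ptH])
      show "proj2 C X X \<cdot> h \<in> hom C H X" "p \<in> hom C H X" using h pt' Ob by simp_all
      show "(proj2 C X X \<cdot> h) \<cdot> t = p \<cdot> t" using h pt' Ob by simp
      fix D x assume x: "x \<in> hom C D H" "p \<cdot> x = zero C D X"
      then obtain y where y: "y \<in> hom C D X" "l \<cdot> y = x" using kH(4)[of x D] pt'(1) by auto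
      show "(proj2 C X X \<cdot> h) \<cdot> x = p \<cdot> x"
        using el[OF h(3), of y] y h(1) l x Ob by auto
    qed
    fix D x' assume x': "x' \<in> hom C D ?X2" "proj2 C X X \<cdot> x' = zero C D X"
    have "h \<cdot> l \<cdot> proj1 C X X \<cdot> x' = x'"
      using el[OF h(3), of "proj1 C X X \<cdot> x'"] square_kernel[OF Ob(2) x'] x'(1) h(1) l Ob by simp
    moreover have "l \<cdot> proj1 C X X \<cdot> x' \<in> hom C D H" using l x' Ob by simp
    ultimately show "\<exists>x \<in> hom C D H. h \<cdot> x = x'" by blast
  next
    fix D x y assume xy: "x \<in> hom C D H" "y \<in> hom C D H" "p \<cdot> x = zero C D X" "p \<cdot> y = zero C D X" "h \<cdot> x = h \<cdot> y"
    obtain u where u: "u \<in> hom C D X" "l \<cdot> u = x" using kH(4)[of x D] xy pt'(1) by auto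
    obtain v where v: "v \<in> hom C D X" "l \<cdot> v = y" using kH(4)[of y D] xy pt'(1) by auto
    have "h \<cdot> l \<cdot> u = ?j \<cdot> u" "h \<cdot> l \<cdot> v = ?j \<cdot> v"
      using el[OF h(3), of u] el[OF h(3), of v] u(1) v(1) h(1) l by simp_all
    then have "?j \<cdot> u = ?j \<cdot> v" using u(2) v(2) xy(5) by simp
    then have "u = v" using monicD[OF mj, of u D v] u(1) v(1) \<Delta>j by simp
    then show "x = y" using u v by simp
  qed
  then obtain h' where h': "h' \<in> hom C ?X2 H" "h' \<cdot> h = \<one> H" unfolding is_iso_def by blast
  note eh = el[OF h'(2)]
  have "(\<psi> \<cdot> h') \<cdot> ?j = k" "(\<psi> \<cdot> h') \<cdot> ?\<Delta> = s \<cdot> \<delta>"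
    using eh[of l] eh[of t] h h' \<psi> l pt'(2) Ob hom_Ob(1)[OF h(1)] by simp_all
  moreover have "\<psi> \<cdot> h' \<in> hom C ?X2 G" using \<psi> h' by simp
  ultimately show ?thesis using that pt ker k\<xi> c by blast
qed

section \<open>The connector of a crossed module\<close>

text \<open>
  With \<open>\<kappa> = \<phi>(0, -)\<close>: since \<open>(\<phi>, p\<^sub>2)\<close> identifies \<open>X \<times> X\<close> with the pullback of \<open>d\<close> and \<open>\<delta>\<close>, an
  element \<open>g\<close> with \<open>c g = 0\<close> is locally of the form \<open>\<phi>(n, m)\<close> with \<open>\<delta> n = 0\<close>.  The pairs \<open>(n, m)\<close>
  are generated by the diagonal, where \<open>\<phi>(n, n) = s \<delta> n = 0\<close>, and by the pairs \<open>(0, m)\<close>, so \<open>\<phi>(n, m)\<close>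
  lies in the image of \<open>\<kappa>\<close>.
\<close>

lemma peiffer_graph_codomain_kernel:
  assumes pt: "is_point C L G d s" and ker: "is_kernel C d X k" and \<delta>: "\<delta> \<in> hom C X L"
    and c: "c \<in> hom C G L" "c \<cdot> s = \<one> L" "c \<cdot> k = \<delta>"
    and \<phi>: "\<phi> \<in> hom C (prod_ob C X X) G" "\<phi> \<cdot> pair C (\<one> X) (zero C X X) = k"
      "\<phi> \<cdot> pair C (\<one> X) (\<one> X) = s \<cdot> \<delta>"
  shows "is_kernel C c X (\<phi> \<cdot> pair C (zero C X X) (\<one> X))"
proof -
  have ds: "d \<in> hom C G L" "s \<in> hom C L G" "d \<cdot> s = \<one> L" using pt unfolding is_point_def by auto
  have Ob: "X \<in> Ob C" "L \<in> Ob C" "G \<in> Ob C" using hom_Ob \<delta> ds by auto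
  note kd = is_kernelD[OF ker]
  have k: "k \<in> hom C X G" using kd(1) ds by simp
  let ?\<Delta> = "pair C (\<one> X) (\<one> X)" and ?j = "pair C (\<one> X) (zero C X X)" and ?j' = "pair C (zero C X X) (\<one> X)"
  let ?X2 = "prod_ob C X X" and ?p1 = "proj1 C X X" and ?p2 = "proj2 C X X"
  have \<phi>j: "\<phi> \<cdot> pair C x (zero C D X) = k \<cdot> x" if "x \<in> hom C D X" for D x
    using el[OF \<phi>(2), of x] that \<phi>(1) Ob by simp
  have \<phi>\<Delta>: "\<phi> \<cdot> pair C x x = s \<cdot> \<delta> \<cdot> x" if "x \<in> hom C D X" for D x
    using el[OF \<phi>(3), of x] that \<phi>(1) \<delta> ds(2) Ob by simp
  have \<phi>j': "\<phi> \<cdot> pair C (zero C D X) x = (\<phi> \<cdot> ?j') \<cdot> x" if "x \<in> hom C D X" for D x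
    using that \<phi>(1) Ob by simp
  \<comment> \<open>\<open>\<phi>(x, y)\<close> is an arrow from \<open>\<delta> y\<close> to
    \<open>\<delta> x\<close>. Its two ends are computed on the generators of the square, the
    diagonal and the pairs \<open>(x, 0)\<close>.\<close>
  have d\<phi>: "d \<cdot> \<phi> = \<delta> \<cdot> ?p2"
  proof (rule point_eqI[OF square_point[OF Ob(1)]])
    show "d \<cdot> \<phi> \<in> hom C ?X2 L" "\<delta> \<cdot> ?p2 \<in> hom C ?X2 L" using ds \<phi>(1) \<delta> Ob by simp_all
    show "(d \<cdot> \<phi>) \<cdot> ?\<Delta> = (\<delta> \<cdot> ?p2) \<cdot> ?\<Delta>" using \<phi>(1,3) el[OF ds(3), of \<delta>] ds \<delta> Ob by simp
    fix D x assume x: "x \<in> hom C D ?X2" "?p2 \<cdot> x = zero C D X"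
    have "\<phi> \<cdot> x = k \<cdot> ?p1 \<cdot> x"
      using square_kernel[OF Ob(1) x] el[OF \<phi>(2), of "?p1 \<cdot> x"] x \<phi>(1) Ob by simp
    then show "(d \<cdot> \<phi>) \<cdot> x = (\<delta> \<cdot> ?p2) \<cdot> x"
      using kd(3)[of "?p1 \<cdot> x"] x \<phi>(1) ds \<delta> Ob hom_Ob(1)[OF x(1)] by simp
  qed
  have c\<phi>: "c \<cdot> \<phi> = \<delta> \<cdot> ?p1"
  proof (rule point_eqI[OF square_point[OF Ob(1)]])
    show "c \<cdot> \<phi> \<in> hom C ?X2 L" "\<delta> \<cdot> ?p1 \<in> hom C ?X2 L" using c \<phi>(1) \<delta> Ob by simp_all
    show "(c \<cdot> \<phi>) \<cdot> ?\<Delta> = (\<delta> \<cdot> ?p1) \<cdot> ?\<Delta>" using \<phi>(1,3) el[OF c(2), of \<delta>] ds c \<delta> Ob by simp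
    fix D x assume x: "x \<in> hom C D ?X2" "?p2 \<cdot> x = zero C D X"
    have "\<phi> \<cdot> x = k \<cdot> ?p1 \<cdot> x"
      using square_kernel[OF Ob(1) x] el[OF \<phi>(2), of "?p1 \<cdot> x"] x \<phi>(1) Ob by simp
    then show "(c \<cdot> \<phi>) \<cdot> x = (\<delta> \<cdot> ?p1) \<cdot> x"
      using el[OF c(3), of "?p1 \<cdot> x"] x \<phi>(1) c(1) k \<delta> Ob by simp
  qed
  obtain W w1 w2 where W: "is_pullback C d \<delta> W w1 w2" using pullback_ex ds \<delta> by blast
  note hW = pullback_hom[OF W]
  have w: "w1 \<in> hom C W G" "w2 \<in> hom C W X" using hW ds \<delta> by simp_all
  have Dd: "Dom C d = G" "Dom C \<delta> = X" using ds \<delta> by simp_all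
  note WL = pullback_lift[OF W, unfolded Dd]
  obtain h where h: "h \<in> hom C ?X2 W" "w1 \<cdot> h = \<phi>" "w2 \<cdot> h = ?p2"
    using WL[OF \<phi>(1) _ d\<phi>] Ob by auto
  have "d \<cdot> s \<cdot> \<delta> = \<delta> \<cdot> \<one> X" using el[OF ds(3), of \<delta>] ds \<delta> Ob by simp
  moreover have "s \<cdot> \<delta> \<in> hom C X G" "\<one> X \<in> hom C X X" using ds \<delta> Ob by simp_all
  ultimately obtain t where t: "t \<in> hom C X W" "w1 \<cdot> t = s \<cdot> \<delta>" "w2 \<cdot> t = \<one> X" using WL by metis
  have ptW: "is_point C X W w2 t" unfolding is_point_def using w t by blast
  have "is_iso C ?X2 W h"
  proof (rule point_iso_kernel[OF square_point[OF Ob(1)] ptW h(1,3)])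
    show "h \<cdot> ?\<Delta> = t"
      by (rule pullback_eqI[OF W, of _ X])
        (use el[OF h(2), of ?\<Delta>] el[OF h(3), of ?\<Delta>] h(1) w \<phi>(3) t Ob in simp_all)
    fix D x assume x: "x \<in> hom C D W" "w2 \<cdot> x = zero C D X"
    have D: "D \<in> Ob C" using hom_Ob x by blast
    have "d \<cdot> w1 \<cdot> x = zero C D L" using el[OF hW(3), of x] x w \<delta> ds D by simp
    moreover have "w1 \<cdot> x \<in> hom C D (Dom C d)" "Cod C d = L" using x w ds by simp_all
    ultimately obtain m where m: "m \<in> hom C D X" "k \<cdot> m = w1 \<cdot> x" using kd(4) by metis
    have "h \<cdot> ?j \<cdot> m = x"
    proof (rule pullback_eqI[OF W, of _ D])
      show "w1 \<cdot> h \<cdot> ?j \<cdot> m = w1 \<cdot> x"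
        using el[OF h(2), of "?j \<cdot> m"] \<phi>j[OF m(1)] m h(1) w Ob D by simp
      show "w2 \<cdot> h \<cdot> ?j \<cdot> m = w2 \<cdot> x"
        using el[OF h(3), of "?j \<cdot> m"] x m h(1) w Ob D by simp
    qed (use h(1) m x Ob D in simp_all)
    moreover have "?j \<cdot> m \<in> hom C D ?X2" using m Ob D by simp
    ultimately show "\<exists>y \<in> hom C D ?X2. h \<cdot> y = x" by blast
  next
    fix D x y assume xy: "x \<in> hom C D ?X2" "y \<in> hom C D ?X2" "?p2 \<cdot> x = zero C D X" "?p2 \<cdot> y = zero C D X"
      "h \<cdot> x = h \<cdot> y"
    have "\<phi> \<cdot> x = \<phi> \<cdot> y" using el[OF h(2), of x] el[OF h(2), of y] xy h(1) w by simp
    moreover have "\<phi> \<cdot> x = k \<cdot> ?p1 \<cdot> x" "\<phi> \<cdot> y = k \<cdot> ?p1 \<cdot> y"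
      using square_kernel[OF Ob(1) xy(1,3)] el[OF \<phi>(2), of "?p1 \<cdot> x"]
        square_kernel[OF Ob(1) xy(2,4)] el[OF \<phi>(2), of "?p1 \<cdot> y"] xy \<phi>(1) Ob by simp_all
    ultimately have "?p1 \<cdot> x = ?p1 \<cdot> y"
      using monicD[OF kd(2), of "?p1 \<cdot> x" D "?p1 \<cdot> y"] xy k Ob by simp
    then show "x = y" using prod_eqI[OF xy(1,2) Ob(1,1)] xy(3,4) by simp
  qed
  then obtain h' where h': "h' \<in> hom C W ?X2" "h' \<cdot> h = \<one> ?X2" "h \<cdot> h' = \<one> W" unfolding is_iso_def by blast
  have fill: "\<exists>y \<in> hom C D ?X2. \<phi> \<cdot> y = g \<and> ?p2 \<cdot> y = m"
    if gm: "g \<in> hom C D G" "m \<in> hom C D X" "d \<cdot> g = \<delta> \<cdot> m" for D g m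
  proof -
    obtain x where x: "x \<in> hom C D W" "w1 \<cdot> x = g" "w2 \<cdot> x = m" using WL gm by metis
    have "h \<cdot> h' \<cdot> x = x" using el[OF h'(3), of x] x h' h(1) w hom_Ob(2)[OF h(1)] by simp
    then have "\<phi> \<cdot> h' \<cdot> x = g" "?p2 \<cdot> h' \<cdot> x = m"
      using el[OF h(2), of "h' \<cdot> x"] el[OF h(3), of "h' \<cdot> x"] x h'(1) h(1) w by simp_all
    moreover have "h' \<cdot> x \<in> hom C D ?X2" using h' x by simp
    ultimately show ?thesis by blast
  qed
  have inj: "x = y" if xy: "x \<in> hom C D ?X2" "y \<in> hom C D ?X2" "\<phi> \<cdot> x = \<phi> \<cdot> y" "?p2 \<cdot> x = ?p2 \<cdot> y" for D x y
  proof -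
    have "h \<cdot> x = h \<cdot> y"
      by (rule pullback_eqI[OF W, of _ D])
        (use el[OF h(2), of x] el[OF h(2), of y] el[OF h(3), of x] el[OF h(3), of y] xy h(1) w in simp_all)
    moreover have "h' \<cdot> h \<cdot> x = x" "h' \<cdot> h \<cdot> y = y"
      using el[OF h'(2), of x] el[OF h'(2), of y] xy h(1) h'(1) Ob by simp_all
    ultimately show ?thesis by metis
  qed
  define \<kappa> where "\<kappa> = \<phi> \<cdot> ?j'"
  have \<kappa>: "\<kappa> \<in> hom C X G" unfolding \<kappa>_def using \<phi>(1) Ob by simp
  have j': "?j' \<in> hom C X ?X2" using Ob by simp
  have "d \<cdot> \<kappa> = \<delta>"
    unfolding \<kappa>_def using el[OF d\<phi>, of ?j'] j' \<phi>(1) ds(1) \<delta> Ob by simp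
  note d\<kappa> = el[OF this]
  have c\<kappa>: "c \<cdot> \<kappa> = zero C X L"
    unfolding \<kappa>_def using el[OF c\<phi>, of ?j'] j' \<phi>(1) c(1) \<delta> Ob by simp
  \<comment> \<open>If \<open>\<kappa> x = 0\<close>, then
    \<open>\<delta> x = d \<kappa> x = 0\<close>, so
    \<open>\<phi>(x, x) = s \<delta> x = 0 = \<phi>(0, x)\<close>. The second entries agree, hence
    so do the first.\<close>
  have m\<kappa>: "monic C \<kappa>"
  proof (rule monic_if_trivial_kernel[OF \<kappa>])
    fix D x assume x: "x \<in> hom C D X" "\<kappa> \<cdot> x = zero C D G"
    have D: "D \<in> Ob C" using hom_Ob x by blast
    have "\<delta> \<cdot> x = zero C D L" using d\<kappa>[of x] x \<kappa> ds D by simp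
    then have 1: "\<phi> \<cdot> pair C x x = zero C D G" using \<phi>\<Delta>[OF x(1)] ds(2) D by simp
    have 2: "\<phi> \<cdot> pair C (zero C D X) x = zero C D G" using \<phi>j'[OF x(1)] x(2) \<kappa>_def by simp
    have "pair C x x = pair C (zero C D X) x"
      by (rule inj[of _ D]) (use 1 2 x(1) D Ob in simp_all)
    then show "x = zero C D X" using pair_inject(1)[of x x "zero C D X" x D X X] x(1) D Ob by simp
  qed
  have "is_kernel C c X \<kappa>"
  proof (rule is_kernelI[OF c(1) \<kappa> m\<kappa> c\<kappa>])
    fix D g assume g: "g \<in> hom C D G" "c \<cdot> g = zero C D L"
    have D: "D \<in> Ob C" using hom_Ob g by blast
    \<comment> \<open>The arrow \<open>g\<close> runs from \<open>d g\<close> to \<open>0\<close>,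
      and no inverses are available yet. As \<open>q\<close> identifies \<open>d g\<close> with
      \<open>0\<close>, there is locally an arrow \<open>w\<close> in the reverse direction, from
      \<open>0\<close> to \<open>d g\<close>; it lies in the kernel of \<open>d\<close>, so
      \<open>w = k m\<close> and \<open>\<delta> m = d g\<close>.\<close>
    obtain Q q where co: "is_coequalizer C d c Q q" and q: "q \<in> hom C L Q"
      using reflexive_coequalizer_ex[OF ds(1) c(1) ds(2,3) c(2)] .
    have Q: "Q \<in> Ob C" using hom_Ob q by blast
    have "q \<cdot> zero C D L = q \<cdot> d \<cdot> g"
      using el[OF coequalizer_simps(2)[OF co], of g] g c(1) ds(1) q D Q by simp
    moreover have "zero C D L \<in> hom C D L" "d \<cdot> g \<in> hom C D L" using D Ob g ds by simp_all
    ultimately obtain D' r w where r: "regular_epi C r" "r \<in> hom C D' D" and w: "w \<in> hom C D' G"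
      "d \<cdot> w = zero C D L \<cdot> r" "c \<cdot> w = (d \<cdot> g) \<cdot> r"
      using reflexive_coequalizer_kernel_pair[OF ds(1) c(1) ds(2,3) c(2) co] by metis
    have D': "D' \<in> Ob C" using hom_Ob r by blast
    have "d \<cdot> w = zero C D' (Cod C d)" "w \<in> hom C D' (Dom C d)" using w r ds Ob by simp_all
    then obtain m where m: "m \<in> hom C D' X" "k \<cdot> m = w" using kd(4) by metis
    have "d \<cdot> g \<cdot> r = \<delta> \<cdot> m" using el[OF c(3), of m] m w(3) c(1) k g r ds by simp
    moreover have "g \<cdot> r \<in> hom C D' G" using g r by simp
    ultimately obtain y where y: "y \<in> hom C D' ?X2" "\<phi> \<cdot> y = g \<cdot> r" "?p2 \<cdot> y = m" using fill m(1) by metis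
    \<comment> \<open>Locally \<open>g = \<phi>(m', m)\<close>, and
      \<open>\<delta> m' = c g = 0\<close> puts \<open>m'\<close> into the kernel of
      \<open>\<delta>\<close>.\<close>
    let ?m' = "?p1 \<cdot> y"
    have m': "?m' \<in> hom C D' X" using y Ob by simp
    have "\<delta> \<cdot> ?m' = zero C D' L"
      using el[OF c\<phi>, of y] y el[OF g(2), of r] g(1) r c(1) \<phi>(1) \<delta> Ob by simp
    then obtain n where n: "n \<in> hom C D' (ker_ob C \<delta>)" "ker C \<delta> \<cdot> n = ?m'"
      using ker_lift[of \<delta> ?m' D'] m' \<delta> by (metis hom_iff)
    let ?M0 = "ker_ob C \<delta>" and ?m0 = "ker C \<delta>"
    have M0: "?M0 \<in> Ob C" and m0: "?m0 \<in> hom C ?M0 X" "\<delta> \<cdot> ?m0 = zero C ?M0 L" using \<delta> by simp_all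
    let ?P = "prod_ob C ?M0 X" and ?q1 = "proj1 C ?M0 X" and ?q2 = "proj2 C ?M0 X"
    let ?\<psi> = "\<phi> \<cdot> pair C (?m0 \<cdot> ?q1) ?q2"
    have "\<exists>w \<in> hom C ?P X. \<kappa> \<cdot> w = ?\<psi>"
    proof (rule point_factor_kernel[of ?M0 ?P ?q1 "pair C (\<one> ?M0) ?m0"])
      show "is_point C ?M0 ?P ?q1 (pair C (\<one> ?M0) ?m0)" unfolding is_point_def using M0 m0 Ob by simp
      show "?\<psi> \<in> hom C ?P G" using \<phi>(1) m0 M0 Ob by simp
      show "\<kappa> \<in> hom C X G" "monic C \<kappa>" by fact+
      show "zero C ?M0 X \<in> hom C ?M0 X" using M0 Ob by simp
      show "\<kappa> \<cdot> zero C ?M0 X = ?\<psi> \<cdot> pair C (\<one> ?M0) ?m0"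
        using \<phi>\<Delta>[OF m0(1)] m0 \<phi>(1) ds(2) \<kappa> M0 Ob by simp
      fix D x assume x: "x \<in> hom C D ?P" "?q1 \<cdot> x = zero C D ?M0"
      have D: "D \<in> Ob C" using hom_Ob x by blast
      have "\<kappa> \<cdot> ?q2 \<cdot> x = ?\<psi> \<cdot> x"
        using \<phi>j'[of "?q2 \<cdot> x" D] x m0 \<phi>(1) D M0 Ob unfolding \<kappa>_def by simp
      moreover have "?q2 \<cdot> x \<in> hom C D X" using x M0 Ob by simp
      ultimately show "\<exists>w \<in> hom C D X. \<kappa> \<cdot> w = ?\<psi> \<cdot> x" by blast
    qed
    then obtain v where v: "v \<in> hom C ?P X" "\<kappa> \<cdot> v = ?\<psi>" by blast
    have "pair C ?m' m = y" by (rule prod_eqI[of _ D' X X]) (use m' m y Ob in simp_all)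
    then have "\<kappa> \<cdot> v \<cdot> pair C n m = g \<cdot> r"
      using el[OF v(2), of "pair C n m"] v(1) \<kappa> n m(1) m0(1) y(2) \<phi>(1) M0 Ob by simp
    moreover have "v \<cdot> pair C n m \<in> hom C D' X" using v n m by simp
    ultimately show "\<exists>v \<in> hom C D X. \<kappa> \<cdot> v = g" using regular_epi_lift[OF r m\<kappa> \<kappa> g(1)] by blast
  qed
  then show ?thesis unfolding \<kappa>_def .
qed

text \<open>A triple whose last two entries agree lies in the image of \<open>l\<close>, because
  \<open>S\<close> is jointly monic; likewise for the first two entries, \<open>r\<close> and
  \<open>R\<close>. The unit laws of the connector thus become statements about arbitrary elements
  of \<open>P\<close>.\<close>

lemma connector_unit_laws:
  assumes R: "equivalence_relation C X R r1 r2" and S: "equivalence_relation C X S s1 s2"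
    and sc: "smith_centralise C X R r1 r2 S s1 s2"
  obtains P p q \<theta> where "is_pullback C r2 s1 P p q" "\<theta> \<in> hom C P X"
    "\<forall>D. \<forall>y \<in> hom C D P. r2 \<cdot> p \<cdot> y = s2 \<cdot> q \<cdot> y \<longrightarrow> \<theta> \<cdot> y = r1 \<cdot> p \<cdot> y"
    "\<forall>D. \<forall>y \<in> hom C D P. r1 \<cdot> p \<cdot> y = s1 \<cdot> q \<cdot> y \<longrightarrow> \<theta> \<cdot> y = s2 \<cdot> q \<cdot> y"
proof -
  have r: "r1 \<in> hom C R X" "r2 \<in> hom C R X" and s: "s1 \<in> hom C S X" "s2 \<in> hom C S X"
    and jr: "jointly_monic C R r1 r2" and js: "jointly_monic C S s1 s2"
    using R S unfolding equivalence_relation_def by blast+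
  obtain P p q eR eS l t \<theta> where P: "is_pullback C r2 s1 P p q"
    and eR: "eR \<in> hom C X R" "r1 \<cdot> eR = \<one> X" "r2 \<cdot> eR = \<one> X"
    and eS: "eS \<in> hom C X S" "s1 \<cdot> eS = \<one> X" "s2 \<cdot> eS = \<one> X"
    and l: "l \<in> hom C R P" "p \<cdot> l = \<one> R" "q \<cdot> l = eS \<cdot> r2"
    and t: "t \<in> hom C S P" "p \<cdot> t = eR \<cdot> s1" "q \<cdot> t = \<one> S"
    and \<theta>: "\<theta> \<in> hom C P X" "\<theta> \<cdot> l = r1" "\<theta> \<cdot> t = s2"
    using sc unfolding smith_centralise_def by metis
  note hP = pullback_hom[OF P]
  have pq: "p \<in> hom C P R" "q \<in> hom C P S" using hP r s by simp_all
  have Ob: "X \<in> Ob C" "R \<in> Ob C" "S \<in> Ob C" using hom_Ob r s by blast+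
  have 1: "\<theta> \<cdot> y = r1 \<cdot> p \<cdot> y" if y: "y \<in> hom C D P" "r2 \<cdot> p \<cdot> y = s2 \<cdot> q \<cdot> y" for D y
  proof -
    have e: "r2 \<cdot> p \<cdot> y = s1 \<cdot> q \<cdot> y" using el[OF hP(3), of y] y pq r s by simp
    have "eS \<cdot> r2 \<cdot> p \<cdot> y \<in> hom C D S" "q \<cdot> y \<in> hom C D S" using eS y pq r s by simp_all
    moreover have "s1 \<cdot> eS \<cdot> r2 \<cdot> p \<cdot> y = s1 \<cdot> q \<cdot> y" "s2 \<cdot> eS \<cdot> r2 \<cdot> p \<cdot> y = s2 \<cdot> q \<cdot> y"
      using el[OF eS(2), of "r2 \<cdot> p \<cdot> y"] el[OF eS(3), of "r2 \<cdot> p \<cdot> y"] e y pq r s eS(1) Ob by simp_all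
    ultimately have q: "eS \<cdot> r2 \<cdot> p \<cdot> y = q \<cdot> y" using js unfolding jointly_monic_def by blast
    have "l \<cdot> p \<cdot> y = y"
      by (rule pullback_eqI[OF P, of _ D])
        (use el[OF l(2), of "p \<cdot> y"] el[OF l(3), of "p \<cdot> y"] q l(1) y(1) pq r eS(1) Ob in simp_all)
    then show ?thesis using el[OF \<theta>(2), of "p \<cdot> y"] \<theta>(1) l(1) y(1) pq by simp
  qed
  have 2: "\<theta> \<cdot> y = s2 \<cdot> q \<cdot> y" if y: "y \<in> hom C D P" "r1 \<cdot> p \<cdot> y = s1 \<cdot> q \<cdot> y" for D y
  proof -
    have e: "r2 \<cdot> p \<cdot> y = s1 \<cdot> q \<cdot> y" using el[OF hP(3), of y] y pq r s by simp
    have "eR \<cdot> s1 \<cdot> q \<cdot> y \<in> hom C D R" "p \<cdot> y \<in> hom C D R" using eR y pq r s by simp_all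
    moreover have "r1 \<cdot> eR \<cdot> s1 \<cdot> q \<cdot> y = r1 \<cdot> p \<cdot> y" "r2 \<cdot> eR \<cdot> s1 \<cdot> q \<cdot> y = r2 \<cdot> p \<cdot> y"
      using el[OF eR(2), of "s1 \<cdot> q \<cdot> y"] el[OF eR(3), of "s1 \<cdot> q \<cdot> y"] e y pq r s eR(1) Ob by simp_all
    ultimately have p: "eR \<cdot> s1 \<cdot> q \<cdot> y = p \<cdot> y" using jr unfolding jointly_monic_def by blast
    have "t \<cdot> q \<cdot> y = y"
      by (rule pullback_eqI[OF P, of _ D])
        (use el[OF t(2), of "q \<cdot> y"] el[OF t(3), of "q \<cdot> y"] p t(1) y(1) pq s eR(1) Ob in simp_all)
    then show ?thesis using el[OF \<theta>(3), of "q \<cdot> y"] \<theta>(1) t(1) y(1) pq by simp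
  qed
  show ?thesis using that[OF P \<theta>(1)] 1 2 by blast
qed

text \<open>
  In terms of the composition \<open>m\<close>, one has \<open>[v, k] = m([s c v, k], [v, 0])\<close> on \<open>B + X\<close>, and the second
  component vanishes on \<open>B \<flat> X\<close>.
\<close>

lemma crossed_module_conjugation:
  assumes SH: "smith_is_huq C" and cm: "crossed_module C X L \<delta> \<xi>"
  obtains G c s k where "s \<in> hom C L G" "k \<in> hom C X G" "c \<in> hom C G L" "monic C k" "c \<cdot> s = \<one> L"
    "c \<cdot> k = \<delta>" "k \<cdot> \<xi> = copair C s k \<cdot> flat_ker C L X"
    "\<forall>B. \<forall>v \<in> hom C B G. copair C (s \<cdot> c \<cdot> v) k \<cdot> flat_ker C B X = copair C v k \<cdot> flat_ker C B X"
proof -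
  have \<delta>: "\<delta> \<in> hom C X L" using cm unfolding crossed_module_def by blast
  obtain G d c s k \<phi> where pt: "is_point C L G d s" and ker: "is_kernel C d X k"
    and k\<xi>: "k \<cdot> \<xi> = copair C s k \<cdot> flat_ker C L X" and c: "c \<in> hom C G L" "c \<cdot> s = \<one> L" "c \<cdot> k = \<delta>"
    and \<phi>: "\<phi> \<in> hom C (prod_ob C X X) G" "\<phi> \<cdot> pair C (\<one> X) (zero C X X) = k"
      "\<phi> \<cdot> pair C (\<one> X) (\<one> X) = s \<cdot> \<delta>"
    using crossed_module_graph[OF cm] .
  let ?\<kappa> = "\<phi> \<cdot> pair C (zero C X X) (\<one> X)"
  have kerc: "is_kernel C c X ?\<kappa>" using peiffer_graph_codomain_kernel[OF pt ker \<delta> c \<phi>] .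
  have ds: "d \<in> hom C G L" "s \<in> hom C L G" "d \<cdot> s = \<one> L" using pt unfolding is_point_def by auto
  have Ob: "X \<in> Ob C" "L \<in> Ob C" "G \<in> Ob C" using hom_Ob \<delta> ds by auto
  note kd = is_kernelD[OF ker] and kc = is_kernelD[OF kerc]
  have k: "k \<in> hom C X G" using kd(1) ds by simp
  have dk: "d \<cdot> k = zero C X L" using ker ds(1) unfolding is_kernel_def by simp
  have Dom: "Dom C d = G" "Dom C c = G" "Cod C d = L" "Cod C c = L" using ds c by simp_all
  obtain R r1 r2 where R: "is_pullback C d d R r1 r2" using pullback_ex ds by blast
  obtain S s1 s2 where S: "is_pullback C c c S s1 s2" using pullback_ex c by blast
  note hR = pullback_hom[OF R] and hS = pullback_hom[OF S]
  have r: "r1 \<in> hom C R G" "r2 \<in> hom C R G" and s12: "s1 \<in> hom C S G" "s2 \<in> hom C S G"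
    using hR hS Dom by simp_all
  have eqR: "equivalence_relation C G R r1 r2" using equivalence_relation_kernel_pair[OF R ds(1)] .
  have eqS: "equivalence_relation C G S s1 s2" using equivalence_relation_kernel_pair[OF S c(1)] .
  define K1 K2 where "K1 = ker_ob C r1" and "K2 = ker_ob C s1"
  have K: "K1 \<in> Ob C" "K2 \<in> Ob C" unfolding K1_def K2_def using r s12 by simp_all
  have n: "normalisation C r1 r2 \<in> hom C K1 G" "normalisation C s1 s2 \<in> hom C K2 G"
    unfolding normalisation_def K1_def K2_def using r s12 by simp_all
  have "d \<cdot> normalisation C r1 r2 = zero C K1 L"
    unfolding normalisation_def K1_def using el[OF hR(3), of "ker C r1"] r ds by simp
  then obtain \<alpha> where \<alpha>: "\<alpha> \<in> hom C K1 X" "k \<cdot> \<alpha> = normalisation C r1 r2"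
    using kd(4)[unfolded Dom] n(1) by blast
  have "c \<cdot> normalisation C s1 s2 = zero C K2 L"
    unfolding normalisation_def K2_def using el[OF hS(3), of "ker C s1"] s12 c by simp
  then obtain \<beta> where \<beta>: "\<beta> \<in> hom C K2 X" "?\<kappa> \<cdot> \<beta> = normalisation C s1 s2"
    using kc(4)[unfolded Dom] n(2) by blast
  \<comment> \<open>The normalisations factor through \<open>k\<close> and \<open>?\<kappa>\<close>,
    the restrictions of \<open>\<phi>\<close> to the two factors; precomposing \<open>\<phi>\<close>
    with these factorisations gives the required arrow on the product.\<close>
  have "huq_commute C (normalisation C r1 r2) (normalisation C s1 s2)"
  proof -
    let ?\<phi> = "\<phi> \<cdot> pair C (\<alpha> \<cdot> proj1 C K1 K2) (\<beta> \<cdot> proj2 C K1 K2)"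
    have "?\<phi> \<in> hom C (prod_ob C K1 K2) G" using \<phi>(1) \<alpha> \<beta> K by simp
    moreover have "?\<phi> \<cdot> pair C (\<one> K1) (zero C K1 K2) = normalisation C r1 r2"
      using el[OF \<phi>(2), of \<alpha>] \<alpha> \<phi>(1) \<beta> K Ob by simp
    moreover have "?\<phi> \<cdot> pair C (zero C K2 K1) (\<one> K2) = normalisation C s1 s2"
      using \<alpha> \<beta>(1) \<beta>(2)[symmetric] \<phi>(1) K Ob by simp
    ultimately show ?thesis unfolding huq_commute_def using n by auto
  qed
  then have "smith_centralise C G R r1 r2 S s1 s2"
    using SH eqR eqS unfolding smith_is_huq_def by blast
  then obtain P p q \<theta> where P: "is_pullback C r2 s1 P p q" and \<theta>: "\<theta> \<in> hom C P G"
    and u1': "\<forall>D. \<forall>y \<in> hom C D P. r2 \<cdot> p \<cdot> y = s2 \<cdot> q \<cdot> y \<longrightarrow> \<theta> \<cdot> y = r1 \<cdot> p \<cdot> y"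
    and u2': "\<forall>D. \<forall>y \<in> hom C D P. r1 \<cdot> p \<cdot> y = s1 \<cdot> q \<cdot> y \<longrightarrow> \<theta> \<cdot> y = s2 \<cdot> q \<cdot> y"
    by (rule connector_unit_laws[OF eqR eqS])
  note u1 = u1'[rule_format] and u2 = u2'[rule_format]
  note hP = pullback_hom[OF P]
  have pq: "p \<in> hom C P R" "q \<in> hom C P S" using hP r s12 by simp_all
  have main: "copair C (s \<cdot> c \<cdot> v) k \<cdot> flat_ker C B X = copair C v k \<cdot> flat_ker C B X"
    if v: "v \<in> hom C B G" for B v
  proof -
    have B: "B \<in> Ob C" using hom_Ob v by blast
    \<comment> \<open>\<open>?g\<close> starts where \<open>?h\<close> ends:
      \<open>d g = c h\<close>. With the identity arrow \<open>s d g\<close> in the middle, the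
      triple \<open>(g, s d g, h)\<close> lies in the domain of the connector.\<close>
    let ?E = "B \<oplus> X" and ?g = "copair C (s \<cdot> c \<cdot> v) k" and ?h = "copair C v (zero C X G)"
    have scv: "s \<cdot> c \<cdot> v \<in> hom C B G" using v c(1) ds by simp
    have gh: "?g \<in> hom C ?E G" "?h \<in> hom C ?E G" using v c(1) ds k Ob by simp_all
    have dg: "d \<cdot> ?g = copair C (c \<cdot> v) (zero C X L)"
      using scv k ds(1) el[OF ds(3), of "c \<cdot> v"] v c(1) ds(2) dk Ob by (simp add: comp_copair)
    have ch: "c \<cdot> ?h = copair C (c \<cdot> v) (zero C X L)"
      using v c(1) Ob by (simp add: comp_copair)
    have sdg: "s \<cdot> d \<cdot> ?g = copair C (s \<cdot> c \<cdot> v) (zero C X G)"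
      unfolding dg using v c(1) ds(2) Ob by (simp add: comp_copair)
    have sE: "s \<cdot> d \<cdot> ?g \<in> hom C ?E G" using gh ds by simp
    have "d \<cdot> ?g = d \<cdot> s \<cdot> d \<cdot> ?g" using el[OF ds(3), of "d \<cdot> ?g"] gh ds(1,2) Ob by simp
    then obtain \<rho> where \<rho>: "\<rho> \<in> hom C ?E R" "r1 \<cdot> \<rho> = ?g" "r2 \<cdot> \<rho> = s \<cdot> d \<cdot> ?g"
      using pullback_lift[OF R, unfolded Dom, OF gh(1) sE] by metis
    have "c \<cdot> s \<cdot> d \<cdot> ?g = c \<cdot> ?h" using el[OF c(2), of "d \<cdot> ?g"] gh ds(1,2) c(1) dg ch v Ob by simp
    then obtain \<sigma> where \<sigma>: "\<sigma> \<in> hom C ?E S" "s1 \<cdot> \<sigma> = s \<cdot> d \<cdot> ?g" "s2 \<cdot> \<sigma> = ?h"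
      using pullback_lift[OF S, unfolded Dom, OF sE gh(2)] by metis
    have "\<rho> \<in> hom C ?E (Dom C r2)" "\<sigma> \<in> hom C ?E (Dom C s1)" "r2 \<cdot> \<rho> = s1 \<cdot> \<sigma>" using \<rho> \<sigma> r s12 by simp_all
    then obtain y where y: "y \<in> hom C ?E P" "p \<cdot> y = \<rho>" "q \<cdot> y = \<sigma>" using pullback_lift[OF P] by metis
    have comps: "r1 \<cdot> p \<cdot> y \<cdot> x = ?g \<cdot> x" "r2 \<cdot> p \<cdot> y \<cdot> x = copair C (s \<cdot> c \<cdot> v) (zero C X G) \<cdot> x"
      "s1 \<cdot> q \<cdot> y \<cdot> x = copair C (s \<cdot> c \<cdot> v) (zero C X G) \<cdot> x" "s2 \<cdot> q \<cdot> y \<cdot> x = ?h \<cdot> x"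
      if x: "x \<in> hom C D ?E" for D x
      using el[OF y(2), of x] el[OF y(3), of x] el[OF \<rho>(2), of x] el[OF \<rho>(3)[unfolded sdg], of x]
        el[OF \<sigma>(2)[unfolded sdg], of x] el[OF \<sigma>(3), of x] x y(1) \<rho>(1) \<sigma>(1) pq r s12 by simp_all
    \<comment> \<open>On \<open>B\<close> the first two entries are both \<open>s c v\<close>, which
      leaves \<open>v\<close>; on \<open>X\<close> the last two are zero, which leaves
      \<open>k\<close>.\<close>
    have \<theta>y: "\<theta> \<cdot> y = copair C v k"
    proof (rule coprod_eqI[of _ B X G])
      have i: "in1 C B X \<in> hom C B ?E" "in2 C B X \<in> hom C X ?E" using B Ob by simp_all
      have "r1 \<cdot> p \<cdot> y \<cdot> in1 C B X = s1 \<cdot> q \<cdot> y \<cdot> in1 C B X"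
        using comps[OF i(1)] scv k Ob B by simp
      then show "(\<theta> \<cdot> y) \<cdot> in1 C B X = copair C v k \<cdot> in1 C B X"
        using u2[of "y \<cdot> in1 C B X" B] comps[OF i(1)] y(1) i \<theta> v k Ob by simp
      have "r2 \<cdot> p \<cdot> y \<cdot> in2 C B X = s2 \<cdot> q \<cdot> y \<cdot> in2 C B X"
        using comps[OF i(2)] scv v k Ob B by simp
      then show "(\<theta> \<cdot> y) \<cdot> in2 C B X = copair C v k \<cdot> in2 C B X"
        using u1[of "y \<cdot> in2 C B X" X] comps[OF i(2)] y(1) i \<theta> v scv k Ob by simp
    qed (use \<theta> y(1) v k B Ob in simp_all)
    have fk: "flat_ker C B X \<in> hom C (B \<flat> X) ?E" using B Ob by simp
    have "r2 \<cdot> p \<cdot> y \<cdot> flat_ker C B X = s2 \<cdot> q \<cdot> y \<cdot> flat_ker C B X"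
      using comps[OF fk] scv v Ob by simp
    then have "\<theta> \<cdot> y \<cdot> flat_ker C B X = ?g \<cdot> flat_ker C B X"
      using u1[of "y \<cdot> flat_ker C B X" "B \<flat> X"] comps[OF fk] y(1) fk by simp
    then show ?thesis using el[OF \<theta>y, of "flat_ker C B X"] \<theta> y(1) fk by simp
  qed
  show ?thesis using that[OF ds(2) k c(1) kd(2) c(2,3) k\<xi>] main by blast
qed

section \<open>From crossed modules to compatible actions\<close>

lemma crossed_modules_imp_compatible:
  assumes SH: "smith_is_huq C" and Ob: "M \<in> Ob C" "N \<in> Ob C"
    and cM: "crossed_module C M L \<mu> \<xi>LM" and cN: "crossed_module C N L \<nu> \<xi>LN"
    and \<xi>MN: "\<xi>MN = \<xi>LN \<cdot> flat_map C \<mu> (\<one> N)" and \<xi>NM: "\<xi>NM = \<xi>LM \<cdot> flat_map C \<nu> (\<one> M)"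
  shows "compatible C M N \<xi>MN \<xi>NM"
proof -
  note cM' = cM[unfolded crossed_module_def] and cN' = cN[unfolded crossed_module_def]
  have \<mu>: "\<mu> \<in> hom C M L" and \<nu>: "\<nu> \<in> hom C N L" using cM' cN' by blast+
  have aM: "internal_action C L M \<xi>LM" and aN: "internal_action C L N \<xi>LN" using cM' cN' by blast+
  note \<xi> = internal_actionD(3)[OF aM] internal_actionD(3)[OF aN]
  have L: "L \<in> Ob C" using hom_Ob \<mu> by blast
  have L1: "\<one> L \<in> hom C L L" using ident_hom L by blast
  let ?B = "M \<oplus> N" and ?b = "copair C \<mu> \<nu>"
  define \<zeta>M \<zeta>N where "\<zeta>M = \<xi>LM \<cdot> flat_map C ?b (\<one> M)" and "\<zeta>N = \<xi>LN \<cdot> flat_map C ?b (\<one> N)"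
  have b: "?b \<in> hom C ?B L" using \<mu> \<nu> by simp
  have act: "internal_action C ?B M \<zeta>M" "internal_action C ?B N \<zeta>N"
    unfolding \<zeta>M_def \<zeta>N_def using internal_action_pullback aM aN b by blast+
  have \<zeta>f: "\<zeta>M \<cdot> flat_map C f (\<one> M) = \<xi>LM \<cdot> flat_map C (?b \<cdot> f) (\<one> M)"
    "\<zeta>N \<cdot> flat_map C f (\<one> N) = \<xi>LN \<cdot> flat_map C (?b \<cdot> f) (\<one> N)" if "f \<in> hom C A ?B" for f A
    unfolding \<zeta>M_def \<zeta>N_def using that \<xi> b Ob by simp_all
  have \<mu>\<xi>: "\<mu> \<cdot> \<xi>NM = copair C \<nu> \<mu> \<cdot> flat_ker C N M"
  proof -
    have "\<mu> \<cdot> \<xi>NM = (\<mu> \<cdot> \<xi>LM) \<cdot> flat_map C \<nu> (\<one> M)" unfolding \<xi>NM using \<mu> \<nu> \<xi> Ob by simp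
    also have "\<dots> = conjugation C L \<cdot> flat_map C \<nu> \<mu>" using cM' \<mu> \<nu> L Ob by simp
    finally show ?thesis using conjugation_flat_map[OF \<nu> \<mu>] by simp
  qed
  have \<nu>\<xi>: "\<nu> \<cdot> \<xi>MN = copair C \<mu> \<nu> \<cdot> flat_ker C M N"
  proof -
    have "\<nu> \<cdot> \<xi>MN = (\<nu> \<cdot> \<xi>LN) \<cdot> flat_map C \<mu> (\<one> N)" unfolding \<xi>MN using \<mu> \<nu> \<xi> Ob by simp
    also have "\<dots> = conjugation C L \<cdot> flat_map C \<mu> \<nu>" using cN' \<mu> \<nu> L Ob by simp
    finally show ?thesis using conjugation_flat_map[OF \<mu> \<nu>] by simp
  qed
  have h\<xi>: "\<xi>MN \<in> hom C (M \<flat> N) N" "\<xi>NM \<in> hom C (N \<flat> M) M" unfolding \<xi>MN \<xi>NM using \<xi> \<mu> \<nu> Ob by simp_all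
  have CA: "CA_on C M N \<xi>MN \<xi>NM M \<zeta>M" "CA_on C M N \<xi>MN \<xi>NM N \<zeta>N"
  proof -
    let ?f = "coprod_map C \<xi>NM \<xi>MN" and ?g = "copair C (coprod_swap C N M \<cdot> flat_ker C N M) (flat_ker C M N)"
    have fg: "?f \<in> hom C ((N \<flat> M) \<oplus> (M \<flat> N)) ?B" "?g \<in> hom C ((N \<flat> M) \<oplus> (M \<flat> N)) ?B" using h\<xi> Ob by simp_all
    \<comment> \<open>By equivariance of both crossed modules the two legs agree under
      \<open>[\<mu>, \<nu>]\<close>, through which \<open>\<zeta>M\<close> and
      \<open>\<zeta>N\<close> act.\<close>
    have e: "?b \<cdot> ?f = ?b \<cdot> ?g" using h\<xi> \<mu> \<nu> \<mu>\<xi> \<nu>\<xi> Ob by (simp add: comp_copair)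
    show "CA_on C M N \<xi>MN \<xi>NM M \<zeta>M" "CA_on C M N \<xi>MN \<xi>NM N \<zeta>N"
      unfolding CA_on_def \<zeta>f[OF fg(1)] \<zeta>f[OF fg(2)] e by (rule refl)+
  qed
  have "CA0_M C M N \<xi>NM \<zeta>M"
  proof -
    obtain G c s k where s: "s \<in> hom C L G" and k: "k \<in> hom C M G" "monic C k" and c: "c \<in> hom C G L"
      "c \<cdot> s = \<one> L" "c \<cdot> k = \<mu>" and k\<xi>: "k \<cdot> \<xi>LM = copair C s k \<cdot> flat_ker C L M"
      and conj: "\<forall>B. \<forall>v \<in> hom C B G. copair C (s \<cdot> c \<cdot> v) k \<cdot> flat_ker C B M = copair C v k \<cdot> flat_ker C B M"
      by (rule crossed_module_conjugation[OF SH cM])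
    note j = cosmash3_to_flat_props[OF Ob Ob(1)] and i = cosmash_to_flat_props[OF Ob(2,1)]
      and f = fold_outer_props[OF Ob]
    note ek\<xi> = el[OF k\<xi>]
    \<comment> \<open>Another lift of \<open>[\<mu>, \<nu>]\<close> along \<open>c\<close>, chosen
      so that \<open>[v, k]\<close> treats both copies of \<open>M\<close> alike and factors through
      the folding.\<close>
    let ?v = "copair C k (s \<cdot> \<nu>)"
    have v: "?v \<in> hom C ?B G" using k s \<nu> by simp
    have scv: "s \<cdot> c \<cdot> ?v = s \<cdot> ?b"
      using el[OF c(2), of \<nu>] c k(1) s \<mu> \<nu> L by (simp add: comp_copair)
    have "copair C (s \<cdot> ?b) k \<cdot> flat_ker C ?B M = copair C ?v k \<cdot> flat_ker C ?B M"
      using conj v scv by metis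
    note sv = el[OF this, of "cosmash3_to_flat C M N M"]
    have "k \<cdot> \<zeta>M \<cdot> cosmash3_to_flat C M N M = copair C (s \<cdot> ?b) k \<cdot> flat_ker C ?B M \<cdot> cosmash3_to_flat C M N M"
      unfolding \<zeta>M_def using ek\<xi>[of "flat_map C ?b (\<one> M) \<cdot> cosmash3_to_flat C M N M"] j(1) s k b \<xi> \<mu> \<nu> L Ob by simp
    also have "\<dots> = copair C ?v k \<cdot> cosmash3_ker C M N M"
      using sv j s k b v \<mu> \<nu> Ob by simp
    also have "\<dots> = copair C (s \<cdot> \<nu>) k \<cdot> cosmash_ker C N M \<cdot> fold_outer C N M"
      using f(2) s k \<nu> Ob by (simp add: comp_copair)
    also have "\<dots> = copair C s k \<cdot> flat_ker C L M \<cdot> flat_map C \<nu> (\<one> M) \<cdot> cosmash_to_flat C N M \<cdot> fold_outer C N M"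
      using el[OF i(2), of "fold_outer C N M"] i(1) f(1) s k \<nu> L Ob by simp
    also have "\<dots> = k \<cdot> \<xi>NM \<cdot> cosmash_to_flat C N M \<cdot> fold_outer C N M"
      unfolding \<xi>NM using ek\<xi>[of "flat_map C \<nu> (\<one> M) \<cdot> cosmash_to_flat C N M \<cdot> fold_outer C N M"]
        i(1) f(1) s k \<nu> \<xi> L Ob by simp
    finally have "k \<cdot> \<zeta>M \<cdot> cosmash3_to_flat C M N M = k \<cdot> \<xi>NM \<cdot> cosmash_to_flat C N M \<cdot> fold_outer C N M" .
    then have "\<zeta>M \<cdot> cosmash3_to_flat C M N M = \<xi>NM \<cdot> cosmash_to_flat C N M \<cdot> fold_outer C N M"
      by (rule monicD[OF k(2), rotated -1])
        (use internal_actionD(3)[OF act(1)] h\<xi> i(1) f(1) j(1) k(1) Ob in simp_all)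
    moreover have "\<zeta>M \<cdot> flat_map C (in2 C M N) (\<one> M) = \<xi>NM" "\<zeta>M \<cdot> flat_map C (in1 C M N) (\<one> M) = conjugation C M"
      using \<zeta>f(1)[of "in2 C M N" N] \<zeta>f(1)[of "in1 C M N" M] cM' \<xi>NM \<mu> \<nu> Ob by simp_all
    ultimately show ?thesis unfolding CA0_M_def by blast
  qed
  moreover have "CA0_N C M N \<xi>MN \<zeta>N"
  proof -
    obtain G c s k where s: "s \<in> hom C L G" and k: "k \<in> hom C N G" "monic C k" and c: "c \<in> hom C G L"
      "c \<cdot> s = \<one> L" "c \<cdot> k = \<nu>" and k\<xi>: "k \<cdot> \<xi>LN = copair C s k \<cdot> flat_ker C L N"
      and conj: "\<forall>B. \<forall>v \<in> hom C B G. copair C (s \<cdot> c \<cdot> v) k \<cdot> flat_ker C B N = copair C v k \<cdot> flat_ker C B N"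
      by (rule crossed_module_conjugation[OF SH cN])
    note j = cosmash3_to_flat_props[OF Ob Ob(2)] and i = cosmash_to_flat_props[OF Ob]
      and f = fold_right_props[OF Ob]
    note ek\<xi> = el[OF k\<xi>]
    let ?v = "copair C (s \<cdot> \<mu>) k"
    have v: "?v \<in> hom C ?B G" using k s \<mu> by simp
    have scv: "s \<cdot> c \<cdot> ?v = s \<cdot> ?b"
      using el[OF c(2), of \<mu>] c k(1) s \<mu> \<nu> L by (simp add: comp_copair)
    have "copair C (s \<cdot> ?b) k \<cdot> flat_ker C ?B N = copair C ?v k \<cdot> flat_ker C ?B N"
      using conj v scv by metis
    note sv = el[OF this, of "cosmash3_to_flat C M N N"]
    have "k \<cdot> \<zeta>N \<cdot> cosmash3_to_flat C M N N = copair C (s \<cdot> ?b) k \<cdot> flat_ker C ?B N \<cdot> cosmash3_to_flat C M N N"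
      unfolding \<zeta>N_def using ek\<xi>[of "flat_map C ?b (\<one> N) \<cdot> cosmash3_to_flat C M N N"] j(1) s k b \<xi> \<mu> \<nu> L Ob by simp
    also have "\<dots> = copair C ?v k \<cdot> cosmash3_ker C M N N"
      using sv j s k b v \<mu> \<nu> Ob by simp
    also have "\<dots> = copair C (s \<cdot> \<mu>) k \<cdot> cosmash_ker C M N \<cdot> fold_right C M N"
      using f(2) s k \<mu> Ob by (simp add: comp_copair)
    also have "\<dots> = copair C s k \<cdot> flat_ker C L N \<cdot> flat_map C \<mu> (\<one> N) \<cdot> cosmash_to_flat C M N \<cdot> fold_right C M N"
      using el[OF i(2), of "fold_right C M N"] i(1) f(1) s k \<mu> L Ob by simp
    also have "\<dots> = k \<cdot> \<xi>MN \<cdot> cosmash_to_flat C M N \<cdot> fold_right C M N"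
      unfolding \<xi>MN using ek\<xi>[of "flat_map C \<mu> (\<one> N) \<cdot> cosmash_to_flat C M N \<cdot> fold_right C M N"]
        i(1) f(1) s k \<mu> \<xi> L Ob by simp
    finally have "k \<cdot> \<zeta>N \<cdot> cosmash3_to_flat C M N N = k \<cdot> \<xi>MN \<cdot> cosmash_to_flat C M N \<cdot> fold_right C M N" .
    then have "\<zeta>N \<cdot> cosmash3_to_flat C M N N = \<xi>MN \<cdot> cosmash_to_flat C M N \<cdot> fold_right C M N"
      by (rule monicD[OF k(2), rotated -1])
        (use internal_actionD(3)[OF act(2)] h\<xi> i(1) f(1) j(1) k(1) Ob in simp_all)
    moreover have "\<zeta>N \<cdot> flat_map C (in1 C M N) (\<one> N) = \<xi>MN" "\<zeta>N \<cdot> flat_map C (in2 C M N) (\<one> N) = conjugation C N"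
      using \<zeta>f(2)[of "in1 C M N" M] \<zeta>f(2)[of "in2 C M N" N] cN' \<xi>MN \<mu> \<nu> Ob by simp_all
    ultimately show ?thesis unfolding CA0_N_def by blast
  qed
  ultimately show ?thesis unfolding compatible_def using act CA by blast
qed

end

theorem theorem3p11:
  fixes C :: "('o, 'm) cat" (structure)
    and M N :: 'o and \<xi>MN \<xi>NM :: 'm
  assumes "semi_abelian_category C"
    and "smith_is_huq C"
    and "M \<in> Ob C" and "N \<in> Ob C"
    and "internal_action C M N \<xi>MN"
    and "internal_action C N M \<xi>NM"
  shows "compatible C M N \<xi>MN \<xi>NM \<longleftrightarrow>
    (\<exists>L \<in> Ob C. \<exists>\<mu> \<nu> \<xi>LM \<xi>LN.
      crossed_module C M L \<mu> \<xi>LM \<and> crossed_module C N L \<nu> \<xi>LN \<and>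
      \<xi>MN = \<xi>LN \<cdot> flat_map C \<mu> (\<one> N) \<and>
      \<xi>NM = \<xi>LM \<cdot> flat_map C \<nu> (\<one> M))"
proof -
  interpret semi_abelian_category C by fact
  show ?thesis
    using compatible_imp_crossed_modules[OF assms(5,6)] crossed_modules_imp_compatible[OF assms(2-4)]
    by blast
qed

end
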